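(* Let $K$ be a field and let $G$ be a Cohen-Macaulay bipartite graph on $V_n$, $n\ge1$. If $h=(h_0,h_1,\dots,h_n)$ is the $h$-vector of $A(G)$, then $$\binom nj\le h_j\le h''_j\quad\text{for all }0\le j\le n,$$ where $G''$ is a bipartite graph that comes from an antichain with $n$ elements and $h''=(h''_0,h''_1,\dots,h''_n)$ is the $h$-vector of $A(G'')$.
   Context: $V_n=W\cup W'$ with $W=\{x_1,\dots,x_n\}$, $W'=\{y_1,\dots,y_n\}$; a bipartite graph on $V_n$ has bipartition $W,W'$. For a poset $P_n=\{p_1,\dots,p_n\}$, $G(P_n)$ is the bipartite graph on $V_n$ whose edges are all $\{x_i,y_j\}$ with $p_i\le p_j$. A bipartite graph $G$ on $V_n$ comes from a poset if there is a poset $P_n=\{p_1,\dots,p_n\}$ with $p_i\le p_j\Rightarrow i\le j$ such that, after relabelling the vertices, $G=G(P_n)$; it comes from an antichain if $P_n$ can be taken to be an antichain. A graph is Cohen-Macaulay if the quotient of the polynomial ring over $K$ in its vertices by its edge ideal is Cohen-Macaulay; graphs are assumed to have no isolated vertices, and then by a theorem of Herzog and Hibi a bipartite graph on $V_n$ is Cohen-Macaulay if and only if it comes from a poset. Let $S=K[x_1,\dots,x_n,y_1,\dots,y_n]$. A $k$-vertex cover of $G$ ($k\in\mathbb N$, $0\in\mathbb N$) is a vector $c\in\mathbb N^{2n}$, indexed by the vertices, with $c(v)+c(w)\ge k$ for every edge $\{v,w\}$. The vertex cover algebra $A(G)$ is the subalgebra of $S[t]$ generated over $K$ by all monomials $x_1^{c_1}\cdots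 x_n^{c_n}y_1^{c_{n+1}}\cdots y_n^{c_{2n}}t^k$ with $c$ a $k$-vertex cover, $k\in\mathbb N$. It is known that $A(G)=\bigoplus_{k\ge0}I_G^kt^k$, where the cover ideal $I_G\subset S$ is minimally generated by the monomials $m_C=\prod_{v\in C}v$, $C$ a minimal vertex cover of $G$, and each such $C$ has exactly $n$ elements. $A(G)$ is a standard graded $K$-algebra by giving degree $1$ to each $x_i$, each $y_j$ and each $m_Ct$. Its Krull dimension is $2n+1$, and its $h$-vector is the coefficient sequence of the polynomial $h(z)$ (of degree at most $n$) with $H_{A(G)}(z)=h(z)/(1-z)^{2n+1}$. *)

theory Defs
  imports
    "HOL-Algebra.Ring_Divisibility"
    "HOL-Library.Poly_Mapping"
    "HOL-Library.Extended_Nat"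
    "HOL-Computational_Algebra.Polynomial"
    "HOL-Computational_Algebra.Formal_Power_Series"
begin

section \<open>Cohen-Macaulay rings\<close>

definition regular_sequence :: "('a, 'b) ring_scheme \<Rightarrow> 'a list \<Rightarrow> bool" where
  "regular_sequence R fs \<longleftrightarrow>
     set fs \<subseteq> carrier R \<and>
     (\<forall>i<length fs. \<forall>a\<in>carrier R.
        fs ! i \<otimes>\<^bsub>R\<^esub> a \<in> Idl\<^bsub>R\<^esub> (set (take i fs)) \<longrightarrow> a \<in> Idl\<^bsub>R\<^esub> (set (take i fs))) \<and>
     Idl\<^bsub>R\<^esub> (set fs) \<noteq> carrier R"

definition depth_of_ideal :: "('a, 'b) ring_scheme \<Rightarrow> 'a set \<Rightarrow> enat" where
  "depth_of_ideal R I = (SUP fs\<in>{fs. regular_sequence R fs \<and> set fs \<subseteq> I}. enat (length fs))"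

definition height_of_prime :: "('a, 'b) ring_scheme \<Rightarrow> 'a set \<Rightarrow> enat" where
  "height_of_prime R P =
     (SUP Ps\<in>{Ps. Ps \<noteq> [] \<and> last Ps = P \<and> (\<forall>Q\<in>set Ps. primeideal Q R) \<and> sorted_wrt (\<subset>) Ps}.
        enat (length Ps - 1))"

text \<open>
  This is Eisenbud's definition (Commutative Algebra, Section 18.2). It avoids localizations: for a
  maximal ideal \<open>P\<close> of a Noetherian ring, the depth and the dimension of the local ring at \<open>P\<close> are
  the depth of \<open>P\<close> on the ring and the height of \<open>P\<close>.
\<close>

definition cohen_macaulay_ring :: "('a, 'b) ring_scheme \<Rightarrow> bool" where
  "cohen_macaulay_ring R \<longleftrightarrow>
     cring R \<and> noetherian_ring R \<and>
     (\<forall>P. maximalideal P R \<longrightarrow> depth_of_ideal R P = height_of_prime R P)"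


section \<open>Polynomial rings and edge ideals\<close>

text \<open>
  A polynomial is a finitely supported map from exponent vectors to coefficients, with the
  convolution product of \<open>HOL-Library.Poly_Mapping\<close>.
\<close>

type_synonym ('v, 'k) mpoly = "('v \<Rightarrow>\<^sub>0 nat) \<Rightarrow>\<^sub>0 'k"

definition mpoly_ring :: "'v set \<Rightarrow> ('v, 'k::field) mpoly ring" where
  "mpoly_ring V =
     \<lparr>carrier = {p. \<forall>m\<in>Poly_Mapping.keys p. Poly_Mapping.keys m \<subseteq> V},
      mult = (*), one = 1, zero = 0, add = (+)\<rparr>"

lemma cring_mpoly_ring: "cring (mpoly_ring V :: ('v, 'k::field) mpoly ring)"
proof -
  let ?R = "mpoly_ring V :: ('v, 'k) mpoly ring"
  have add: "p + q \<in> carrier ?R" if "p \<in> carrier ?R" "q \<in> carrier ?R" for p q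
    using that keys_add[of p q] by (auto simp: mpoly_ring_def dest!: subsetD)
  have neg: "- p \<in> carrier ?R" if "p \<in> carrier ?R" for p
    using that by (simp add: mpoly_ring_def in_keys_iff)
  have mult: "p * q \<in> carrier ?R" if p: "p \<in> carrier ?R" and q: "q \<in> carrier ?R" for p q
    unfolding mpoly_ring_def
  proof (simp, intro ballI)
    fix m assume "m \<in> Poly_Mapping.keys (p * q)"
    then obtain a b where "m = a + b" "a \<in> Poly_Mapping.keys p" "b \<in> Poly_Mapping.keys q"
      using keys_mult[of p q] by blast
    moreover from this have "Poly_Mapping.keys a \<subseteq> V" "Poly_Mapping.keys b \<subseteq> V"
      using p q by (simp_all add: mpoly_ring_def)
    ultimately show "Poly_Mapping.keys m \<subseteq> V"
      using keys_add[of a b] by blast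
  qed
  have ops: "mult ?R = (*)" "one ?R = 1" "zero ?R = 0" "add ?R = (+)"
    by (simp_all add: mpoly_ring_def)
  have zero_one: "0 \<in> carrier ?R" "1 \<in> carrier ?R"
    by (simp_all add: mpoly_ring_def)
  have "abelian_group ?R"
  proof (rule abelian_groupI, unfold ops)
    fix p assume "p \<in> carrier ?R"
    then show "\<exists>q\<in>carrier ?R. q + p = 0"
      using neg by (intro bexI[of _ "- p"]) simp_all
  qed (simp_all add: add zero_one add_ac)
  moreover have "comm_monoid ?R"
    by (rule comm_monoidI, unfold ops) (simp_all add: mult zero_one mult_ac)
  ultimately show ?thesis
    by (rule cringI, unfold ops) (simp add: distrib_right)
qed

definition mvar :: "'v \<Rightarrow> ('v, 'k::field) mpoly" where
  "mvar v = Poly_Mapping.single (Poly_Mapping.single v 1) 1"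

text \<open>A graph is given by its set of edges, each edge being the set of its two endpoints.\<close>

definition edge_ideal :: "'v set \<Rightarrow> 'v set set \<Rightarrow> ('v, 'k::field) mpoly set" where
  "edge_ideal V E = Idl\<^bsub>mpoly_ring V\<^esub> {\<Prod>v\<in>e. mvar v | e. e \<in> E}"

definition cohen_macaulay_graph :: "'k::field itself \<Rightarrow> 'v set \<Rightarrow> 'v set set \<Rightarrow> bool" where
  "cohen_macaulay_graph K V E \<longleftrightarrow>
     cohen_macaulay_ring ((mpoly_ring V :: ('v, 'k) mpoly ring) Quot edge_ideal V E)"


section \<open>Bipartite graphs and posets\<close>

datatype vertex = Xv nat | Yv nat

definition vertices :: "nat \<Rightarrow> vertex set" where
  "vertices n = Xv ` {1..n} \<union> Yv ` {1..n}"

text \<open>All graphs are required to have no isolated vertices.\<close>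

definition bipartite_graph :: "nat \<Rightarrow> vertex set set \<Rightarrow> bool" where
  "bipartite_graph n E \<longleftrightarrow>
     E \<subseteq> {{Xv i, Yv j} | i j. i \<in> {1..n} \<and> j \<in> {1..n}} \<and> (\<forall>v\<in>vertices n. \<exists>e\<in>E. v \<in> e)"

text \<open>The poset \<open>{p\<^sub>1, \<dots>, p\<^sub>n}\<close> is given by the relation \<open>{(i, j). p\<^sub>i \<le> p\<^sub>j}\<close> on the indices.\<close>

definition labelled_poset :: "nat \<Rightarrow> (nat \<times> nat) set \<Rightarrow> bool" where
  "labelled_poset n r \<longleftrightarrow> partial_order_on {1..n} r \<and> (\<forall>(i, j)\<in>r. i \<le> j)"

definition poset_graph :: "nat \<Rightarrow> (nat \<times> nat) set \<Rightarrow> vertex set set" where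
  "poset_graph n r = {{Xv i, Yv j} | i j. i \<in> {1..n} \<and> j \<in> {1..n} \<and> (i, j) \<in> r}"

definition comes_from :: "nat \<Rightarrow> vertex set set \<Rightarrow> (nat \<times> nat) set \<Rightarrow> bool" where
  "comes_from n E r \<longleftrightarrow>
     labelled_poset n r \<and>
     (\<exists>\<phi>. bij_betw \<phi> (vertices n) (vertices n) \<and> E = (\<lambda>e. \<phi> ` e) ` poset_graph n r)"

definition comes_from_antichain :: "nat \<Rightarrow> vertex set set \<Rightarrow> bool" where
  "comes_from_antichain n E \<longleftrightarrow> (\<exists>r. comes_from n E r \<and> (\<forall>(i, j)\<in>r. i = j))"


section \<open>Vertex cover algebras\<close>

definition vertex_cover_vector :: "nat \<Rightarrow> vertex set set \<Rightarrow> nat \<Rightarrow> (vertex \<Rightarrow>\<^sub>0 nat) \<Rightarrow> bool" where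
  "vertex_cover_vector n E k c \<longleftrightarrow>
     Poly_Mapping.keys c \<subseteq> vertices n \<and>
     (\<forall>v w. {v, w} \<in> E \<longrightarrow> k \<le> Poly_Mapping.lookup c v + Poly_Mapping.lookup c w)"

definition vertex_cover :: "nat \<Rightarrow> vertex set set \<Rightarrow> vertex set \<Rightarrow> bool" where
  "vertex_cover n E C \<longleftrightarrow> C \<subseteq> vertices n \<and> (\<forall>e\<in>E. e \<inter> C \<noteq> {})"

definition minimal_vertex_cover :: "nat \<Rightarrow> vertex set set \<Rightarrow> vertex set \<Rightarrow> bool" where
  "minimal_vertex_cover n E C \<longleftrightarrow> vertex_cover n E C \<and> (\<forall>D. D \<subset> C \<longrightarrow> \<not> vertex_cover n E D)"

text \<open>\<open>S[t]\<close> is the type of univariate polynomials over \<open>S\<close>; the following is its \<open>K\<close>-scaling.\<close>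

definition kscale :: "'k::field \<Rightarrow> ('v, 'k) mpoly poly \<Rightarrow> ('v, 'k) mpoly poly" where
  "kscale a f = smult (Poly_Mapping.single 0 a) f"

interpretation kvs: vector_space kscale
  by unfold_locales
    (simp_all add: kscale_def smult_add_right smult_add_left single_add mult_single
      single_one)

inductive_set subalgebra_generated :: "('v, 'k::field) mpoly poly set \<Rightarrow> ('v, 'k) mpoly poly set"
  for B where
    one: "1 \<in> subalgebra_generated B"
  | gen: "f \<in> B \<Longrightarrow> f \<in> subalgebra_generated B"
  | scale: "f \<in> subalgebra_generated B \<Longrightarrow> kscale a f \<in> subalgebra_generated B"
  | add: "f \<in> subalgebra_generated B \<Longrightarrow> g \<in> subalgebra_generated B \<Longrightarrow> f + g \<in> subalgebra_generated B"
  | mult: "f \<in> subalgebra_generated B \<Longrightarrow> g \<in> subalgebra_generated B \<Longrightarrow> f * g \<in> subalgebra_generated B"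

definition vertex_cover_algebra :: "nat \<Rightarrow> vertex set set \<Rightarrow> (vertex, 'k::field) mpoly poly set" where
  "vertex_cover_algebra n E =
     subalgebra_generated {monom (Poly_Mapping.single c 1) k | c k. vertex_cover_vector n E k c}"

definition degree_one_generators :: "nat \<Rightarrow> vertex set set \<Rightarrow> (vertex, 'k::field) mpoly poly set" where
  "degree_one_generators n E =
     {monom (mvar v) 0 | v. v \<in> vertices n} \<union>
     {monom (\<Prod>v\<in>C. mvar v) 1 | C. minimal_vertex_cover n E C}"

text \<open>
  The degree-\<open>d\<close> component of the standard grading of \<open>A(G)\<close>: the \<open>K\<close>-span of the \<open>d\<close>-fold
  products of the degree-one generators.
\<close>

definition graded_component ::
    "nat \<Rightarrow> vertex set set \<Rightarrow> nat \<Rightarrow> (vertex, 'k::field) mpoly poly set" where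
  "graded_component n E d =
     vertex_cover_algebra n E \<inter>
     kvs.span {prod_list fs | fs. length fs = d \<and> set fs \<subseteq> degree_one_generators n E}"

definition hilbert_function :: "'k::field itself \<Rightarrow> nat \<Rightarrow> vertex set set \<Rightarrow> nat \<Rightarrow> nat" where
  "hilbert_function K n E d =
     kvs.dim (graded_component n E d :: (vertex, 'k) mpoly poly set)"

definition hilbert_series :: "'k::field itself \<Rightarrow> nat \<Rightarrow> vertex set set \<Rightarrow> int fps" where
  "hilbert_series K n E = Abs_fps (\<lambda>d. int (hilbert_function K n E d))"

text \<open>
  \<open>2 * n + 1\<close> is the Krull dimension of \<open>A(G)\<close>, so the power series below is the numerator \<open>h(z)\<close>
  in \<open>H(z) = h(z) / (1 - z)\<^bsup>2n+1\<^esup>\<close>.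
\<close>

definition h_vector :: "'k::field itself \<Rightarrow> nat \<Rightarrow> vertex set set \<Rightarrow> nat \<Rightarrow> int" where
  "h_vector K n E j = fps_nth (hilbert_series K n E * (1 - fps_X) ^ (2 * n + 1)) j"

end

theory Submission
  imports Defs
begin

text \<open>
  A regular sequence of length \<open>l\<close> in the irrelevant ideal forces the Koszul cohomology of the edge
  ring, for the sequence \<open>x\<^sub>v\<^sup>2\<close> (\<open>v \<in> F\<close>), \<open>x\<^sub>v\<close> (\<open>v \<notin> F\<close>), to vanish in degrees below \<open>l\<close>, whereas a
  facet \<open>F\<close> of the independence complex gives a class in degree \<open>|F|\<close> and a face \<open>F\<close> with
  disconnected link one in degree \<open>|F| + 1\<close>. As the irrelevant ideal has height at least the
  cardinality of every independent set, all facets of a Cohen-Macaulay graph have equal size and no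
  small face has a disconnected link. For bipartite graphs this lets the sets of left vertices that
  are closed under \<open>A \<mapsto> {x. N(x) \<subseteq> N(A)}\<close> grow one element at a time, and such a chain is a labelling
  by a poset.

  If \<open>G\<close> comes from the poset \<open>P\<close>, the monomials of \<open>A(G)\<close> are the \<open>k\<close>-covers. Truncating the
  \<open>x\<close>-exponents to an order-reversing function \<open>w : P \<rightarrow> {0..k}\<close> and sorting by \<open>w\<close> the elements at
  which \<open>w\<close> is smaller than both \<open>k\<close> and its values at all smaller elements, one splits the \<open>k\<close>-covers
  into half-open cones of dimension \<open>2n + 1\<close>. They are indexed by the linear extensions \<open>\<pi>\<close> of
  subposets of \<open>P\<close>, and the shift of the cone of \<open>\<pi>\<close> is the number of ascents of \<open>0\<pi>\<close>. Hence \<open>h\<^sub>j\<close>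
  counts the \<open>\<pi>\<close> for which this number is \<open>j\<close>. This count grows when relations are removed, and the
  increasing words alone contribute \<open>n choose j\<close>.
\<close>

section \<open>Koszul cochains and regular sequences\<close>

text \<open>Quotient rings are avoided in the Koszul computations: cochains take values in the
  subring \<open>S\<close>, and the cocycle and coboundary conditions are imposed modulo an ideal
  \<open>J\<close>, which grows by one element of the regular sequence at a time. The squares make
  the obstruction visible: on the face F a coboundary is a sum of multiples of x_u^2 with u in F, so
  it cannot contain the squarefree monomial x_F, whereas the cochain built from a facet F does. They
  cost nothing in the vanishing argument, where the exponent two can be lowered step by step.

  On the counting side, levels are sorted decreasingly and ties are broken by decreasing label.
  Hence the level must drop at every ascent, and each ascent costs one unit of degree. The letter 0
  in front carries the value k; as it is smaller than all labels, the step to the first letter is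
  always an ascent, which encodes that w is smaller than k at the letters.\<close>

locale koszul =
  fixes S :: "'a::comm_ring_1 set" and V :: "'v::linorder set" and X a :: "'v \<Rightarrow> 'a"
    and F :: "'v set"
  assumes S_one: "1 \<in> S"
    and S_add: "x \<in> S \<Longrightarrow> y \<in> S \<Longrightarrow> x + y \<in> S"
    and S_minus: "x \<in> S \<Longrightarrow> - x \<in> S"
    and S_mult: "x \<in> S \<Longrightarrow> y \<in> S \<Longrightarrow> x * y \<in> S"
    and fin_V: "finite V" and F_sub: "F \<subseteq> V"
    and X_in: "v \<in> V \<Longrightarrow> X v \<in> S"
    and a_eq: "v \<in> V \<Longrightarrow> a v = (if v \<in> F then X v ^ 2 else X v)"
begin

text \<open>Ideals of a subring of a ring type, so that the computations below use ordinary ring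
  arithmetic; \<open>is_ideal_iff\<close> identifies them with the ideals of the ring
  record.\<close>

definition is_ideal :: "'a set \<Rightarrow> bool" where
  "is_ideal J \<longleftrightarrow> J \<subseteq> S \<and> 0 \<in> J \<and> (\<forall>x\<in>J. \<forall>y\<in>J. x + y \<in> J) \<and> (\<forall>x\<in>S. \<forall>y\<in>J. x * y \<in> J)"

lemma S_zero: "0 \<in> S"
  using S_add[OF S_one S_minus[OF S_one]] by simp

lemma S_diff: "x \<in> S \<Longrightarrow> y \<in> S \<Longrightarrow> x - y \<in> S"
  using S_add[OF _ S_minus] by fastforce

lemma ideal_S: "is_ideal S"
  using S_zero S_add S_mult by (auto simp: is_ideal_def)

lemma ideal_add: "is_ideal J \<Longrightarrow> x \<in> J \<Longrightarrow> y \<in> J \<Longrightarrow> x + y \<in> J"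
  and ideal_mult: "is_ideal J \<Longrightarrow> z \<in> S \<Longrightarrow> x \<in> J \<Longrightarrow> z * x \<in> J"
  and ideal_zero: "is_ideal J \<Longrightarrow> 0 \<in> J"
  by (auto simp: is_ideal_def)

lemma ideal_minus: "is_ideal J \<Longrightarrow> x \<in> J \<Longrightarrow> - x \<in> J"
  using ideal_mult[of J "- 1" x] S_minus[OF S_one] by simp

lemma ideal_sum: "is_ideal J \<Longrightarrow> (\<And>i. i \<in> I \<Longrightarrow> f i \<in> J) \<Longrightarrow> sum f I \<in> J"
  by (induction I rule: infinite_finite_induct) (auto intro: ideal_zero ideal_add)

definition ksign :: "'v \<Rightarrow> 'v set \<Rightarrow> 'a" where
  "ksign v s = (- 1) ^ card {w \<in> s. w < v}"

text \<open>Identify a set with the exterior product of its elements in increasing order. Then this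
  is exterior multiplication by the sum of the a_v e_v, and \<open>ksign v s\<close> is the sign of
  moving e_v into its place in \<open>s\<close>.\<close>

definition kd :: "('v set \<Rightarrow> 'a) \<Rightarrow> 'v set \<Rightarrow> 'a" where
  "kd c s = (\<Sum>v\<in>s. ksign v s * a v * c (s - {v}))"

text \<open>Interior product with the dual of e_v.\<close>

definition contraction :: "'v \<Rightarrow> ('v set \<Rightarrow> 'a) \<Rightarrow> 'v set \<Rightarrow> 'a" where
  "contraction v c s = (if v \<in> s then 0 else ksign v (insert v s) * c (insert v s))"

lemma ksign_in: "ksign v s \<in> S"
proof -
  have "(- 1) ^ k \<in> S" for k by (induction k) (simp_all add: S_one S_minus)
  then show ?thesis by (simp add: ksign_def)
qed

lemma ksign_sq: "ksign v s * ksign v s = 1"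
  by (simp add: ksign_def flip: power_mult_distrib)

lemma a_in: "v \<in> V \<Longrightarrow> a v \<in> S"
  using a_eq[of v] X_in[of v] by (simp add: power2_eq_square S_mult)

text \<open>Deleting the smaller of the two elements moves the larger one down by one place, while
  deleting the larger one leaves the smaller one in place.\<close>

lemma ksign_swap:
  assumes s: "finite s" "v \<in> s" "w \<in> s" "v \<noteq> w"
  shows "ksign v s * ksign w (s - {v}) = - (ksign w s * ksign v (s - {w}))"
proof -
  have less: "ksign v (s - {w}) = ksign v s \<and> ksign w s = - ksign w (s - {v})"
    if "v < w" "v \<in> s" for v w
  proof
    have "{x \<in> s - {w}. x < v} = {x \<in> s. x < v}" using that by auto
    then show "ksign v (s - {w}) = ksign v s" by (simp add: ksign_def)
    have "{x \<in> s. x < w} = insert v {x \<in> s - {v}. x < w}" using that by auto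
    then have "card {x \<in> s. x < w} = Suc (card {x \<in> s - {v}. x < w})" using s(1) by simp
    then show "ksign w s = - ksign w (s - {v})" by (simp add: ksign_def)
  qed
  show ?thesis
  proof (cases "v < w")
    case True
    then show ?thesis using less[OF True s(2)] by simp
  next
    case False
    then have "w < v" using s(4) by simp
    then show ?thesis using less[OF _ s(3), of v] by simp
  qed
qed

lemma kd_in:
  assumes J: "is_ideal J" and s: "s \<subseteq> V" "card s = Suc m"
    and c: "\<And>t. t \<subseteq> V \<Longrightarrow> card t = m \<Longrightarrow> c t \<in> J"
  shows "kd c s \<in> J"
  unfolding kd_def
proof (rule ideal_sum[OF J])
  fix v assume v: "v \<in> s"
  have "finite s" using s(2) by (simp add: card_ge_0_finite)
  then have "c (s - {v}) \<in> J" using v s by (intro c) auto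
  then show "ksign v s * a v * c (s - {v}) \<in> J"
    using ideal_mult[OF J] S_mult[OF ksign_in a_in] v s by blast
qed

lemma kd_in_S: "s \<subseteq> V \<Longrightarrow> (\<And>t. c t \<in> S) \<Longrightarrow> kd c s \<in> S"
  unfolding kd_def using S_mult[OF ksign_in a_in] S_mult by (intro ideal_sum[OF ideal_S]) blast

lemma kd_add: "kd (\<lambda>s. b s + c s) s = kd b s + kd c s"
  by (simp add: kd_def algebra_simps sum.distrib)

lemma kd_diff: "kd (\<lambda>s. b s - c s) s = kd b s - kd c s"
  by (simp add: kd_def algebra_simps sum_subtractf)

lemma kd_scale: "kd (\<lambda>s. x * c s) s = x * kd c s"
  by (simp add: kd_def algebra_simps sum_distrib_left)

text \<open>The two orders of deleting a pair of elements contribute opposite terms by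
  \<open>ksign_swap\<close>.\<close>

lemma kd_kd:
  assumes s: "finite s"
  shows "kd (kd c) s = 0"
proof -
  define T where "T = (\<lambda>(v, w). ksign v s * ksign w (s - {v}) * a v * a w * c (s - {v} - {w}))"
  define P where "P = {(v, w). v \<in> s \<and> w \<in> s \<and> v < w}"
  have fin: "finite P" by (rule finite_subset[of _ "s \<times> s"]) (auto simp: P_def s)
  have Sig: "(SIGMA v:s. s - {v}) = P \<union> prod.swap ` P"
    by (auto simp: P_def image_iff)
  have swap: "T (prod.swap vw) = - T vw" if "vw \<in> P" for vw
  proof -
    obtain v w where vw: "vw = (v, w)" "v \<in> s" "w \<in> s" "v \<noteq> w" using \<open>vw \<in> P\<close> by (auto simp: P_def)
    have "s - {w} - {v} = s - {v} - {w}" by auto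
    then have "T (prod.swap vw) =
        (ksign w s * ksign v (s - {w})) * (a v * a w * c (s - {v} - {w}))"
      by (simp add: T_def vw mult_ac)
    also have "ksign w s * ksign v (s - {w}) = - (ksign v s * ksign w (s - {v}))"
      using ksign_swap[OF s vw(3,2)] vw(4) by simp
    finally show ?thesis by (simp add: T_def vw mult_ac)
  qed
  have "kd (kd c) s = (\<Sum>v\<in>s. \<Sum>w\<in>s - {v}. T (v, w))"
    by (simp add: kd_def T_def sum_distrib_left mult_ac)
  also have "\<dots> = sum T (SIGMA v:s. s - {v})"
    using s by (simp add: sum.Sigma case_prod_unfold)
  also have "\<dots> = sum T P + sum T (prod.swap ` P)"
    unfolding Sig using fin by (intro sum.union_disjoint) (auto simp: P_def)
  also have "sum T (prod.swap ` P) = (\<Sum>vw\<in>P. - T vw)"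
    using swap by (simp add: sum.reindex)
  finally show ?thesis by (simp add: sum_negf)
qed

text \<open>Multiplication by \<open>a v\<close> is null-homotopic, so every \<open>a v\<close>
  annihilates the Koszul cohomology. If v is in s, only the term deleting v survives; otherwise the
  terms deleting some other w cancel by \<open>ksign_swap\<close>.\<close>

lemma contraction_homotopy:
  assumes s: "finite s"
  shows "kd (contraction v c) s + contraction v (kd c) s = a v * c s"
proof (cases "v \<in> s")
  case True
  have "kd (contraction v c) s = (\<Sum>w\<in>s. if w = v then ksign v s * a v * (ksign v s * c s) else 0)"
    unfolding kd_def by (intro sum.cong) (auto simp: contraction_def insert_absorb True)
  also have "\<dots> = (ksign v s * ksign v s) * (a v * c s)" using s True by (simp add: mult_ac)
  finally show ?thesis using True by (simp add: ksign_sq contraction_def)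
next
  case False
  let ?t = "insert v s"
  have "contraction v (kd c) s =
      ksign v ?t * (ksign v ?t * a v * c s + (\<Sum>w\<in>s. ksign w ?t * a w * c (?t - {w})))"
    using False s by (simp add: contraction_def kd_def)
  also have "\<dots> = (ksign v ?t * ksign v ?t) * (a v * c s) +
      (\<Sum>w\<in>s. (ksign v ?t * ksign w ?t) * (a w * c (?t - {w})))"
    by (simp add: distrib_left sum_distrib_left mult_ac)
  finally have 1: "contraction v (kd c) s =
      a v * c s + (\<Sum>w\<in>s. (ksign v ?t * ksign w ?t) * (a w * c (?t - {w})))"
    by (simp add: ksign_sq)
  have "kd (contraction v c) s = (\<Sum>w\<in>s. - ((ksign v ?t * ksign w ?t) * (a w * c (?t - {w}))))"
    unfolding kd_def
  proof (intro sum.cong refl)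
    fix w assume w: "w \<in> s"
    then have vw: "v \<noteq> w" using False by auto
    have set_eq: "?t - {v} = s" "insert v (s - {w}) = ?t - {w}" using False vw by auto
    have "ksign w s * ksign v (?t - {w}) =
        (ksign v ?t * ksign v ?t) * (ksign w s * ksign v (?t - {w}))" by (simp add: ksign_sq)
    also have "\<dots> = ksign v ?t * (ksign v ?t * ksign w (?t - {v})) * ksign v (?t - {w})"
      by (simp add: set_eq mult_ac)
    also have "\<dots> = - (ksign v ?t * ksign w ?t * (ksign v (?t - {w}) * ksign v (?t - {w})))"
      using ksign_swap[of ?t v w] s w vw by (simp add: mult_ac)
    finally have "ksign w s * ksign v (?t - {w}) = - (ksign v ?t * ksign w ?t)"
      by (simp add: ksign_sq)
    moreover have "ksign w s * a w * contraction v c (s - {w}) =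
        (ksign w s * ksign v (?t - {w})) * (a w * c (?t - {w}))"
      using False by (simp add: contraction_def set_eq mult_ac)
    ultimately show "ksign w s * a w * contraction v c (s - {w}) =
        - ((ksign v ?t * ksign w ?t) * (a w * c (?t - {w})))" by simp
  qed
  then show ?thesis using 1 by (simp add: sum_negf)
qed

section \<open>Koszul cohomology modulo an ideal and its vanishing\<close>

definition cocycle :: "'a set \<Rightarrow> nat \<Rightarrow> ('v set \<Rightarrow> 'a) \<Rightarrow> bool" where
  "cocycle J m c \<longleftrightarrow> (\<forall>s. c s \<in> S) \<and> (\<forall>s. s \<subseteq> V \<and> card s = Suc m \<longrightarrow> kd c s \<in> J)"

definition coboundary :: "'a set \<Rightarrow> nat \<Rightarrow> ('v set \<Rightarrow> 'a) \<Rightarrow> bool" where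
  "coboundary J m c \<longleftrightarrow>
     (\<exists>b. (\<forall>s. b s \<in> S) \<and> (\<forall>s. s \<subseteq> V \<and> card s = m \<longrightarrow> c s - kd b s \<in> J))"

lemma coboundaryI:
  "(\<And>s. b s \<in> S) \<Longrightarrow> (\<And>s. s \<subseteq> V \<Longrightarrow> card s = m \<Longrightarrow> c s - kd b s \<in> J) \<Longrightarrow> coboundary J m c"
  unfolding coboundary_def by blast

definition regular_on :: "'a \<Rightarrow> 'a set \<Rightarrow> bool" where
  "regular_on f J \<longleftrightarrow> f \<in> S \<and> (\<forall>x\<in>S. f * x \<in> J \<longrightarrow> x \<in> J)"

definition ideal_plus :: "'a set \<Rightarrow> 'a \<Rightarrow> 'a set" where
  "ideal_plus J f = {y \<in> S. \<exists>x\<in>S. y - f * x \<in> J}"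

text \<open>Injectivity of multiplication by f on degree-m cohomology modulo J, given vanishing in
  degree m - 1 modulo J + (f): a piece of the long exact sequence of multiplication by f, written
  with cochains. In degree 0 there are no nonzero coboundaries and regularity alone
  suffices.\<close>

lemma coboundary_cancel:
  assumes J: "is_ideal J" and f: "regular_on f J" and c: "\<And>s. c s \<in> S"
    and fc: "coboundary J m (\<lambda>s. f * c s)"
    and van: "\<And>b. m > 0 \<Longrightarrow> cocycle (ideal_plus J f) (m - 1) b \<Longrightarrow>
      coboundary (ideal_plus J f) (m - 1) b"
  shows "coboundary J m c"
proof -
  have fS: "f \<in> S" and reg: "\<And>x. x \<in> S \<Longrightarrow> f * x \<in> J \<Longrightarrow> x \<in> J"
    using f by (auto simp: regular_on_def)
  obtain b where b: "\<And>s. b s \<in> S" "\<And>s. s \<subseteq> V \<Longrightarrow> card s = m \<Longrightarrow> f * c s - kd b s \<in> J"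
    using fc by (auto simp: coboundary_def)
  show ?thesis
  proof (cases m)
    case 0
    have "c s - kd (\<lambda>_. 0) s \<in> J" if s: "s \<subseteq> V" "card s = m" for s
    proof -
      have "s = {}" using s 0 finite_subset[OF _ fin_V] by auto
      then show ?thesis using b(2)[OF s] reg[OF c] by (simp add: kd_def)
    qed
    then show ?thesis using S_zero by (rule coboundaryI[rotated])
  next
    case (Suc m')
    have "kd b s \<in> ideal_plus J f" if s: "s \<subseteq> V" "card s = m" for s
    proof -
      have "kd b s - f * c s \<in> J" using ideal_minus[OF J b(2)[OF s]] by simp
      then show ?thesis
        unfolding ideal_plus_def using kd_in_S[OF s(1) b(1)] c by (intro CollectI conjI bexI)
    qed
    then have "cocycle (ideal_plus J f) (m - 1) b"
      using b(1) Suc by (simp add: cocycle_def)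
    then have "coboundary (ideal_plus J f) m' b" using van[of b] Suc by simp
    then obtain e where e: "\<And>s. e s \<in> S"
      "\<And>s. s \<subseteq> V \<Longrightarrow> card s = m' \<Longrightarrow> b s - kd e s \<in> ideal_plus J f"
      unfolding coboundary_def by blast
    \<comment> \<open>Modulo J, b = kd e + f g. Hence f c = kd b = f kd g modulo J, because kd kd e
      = 0, and f cancels. The value 0 outside the relevant sets keeps g inside
      \<open>S\<close>.\<close>
    define g where "g s = (if s \<subseteq> V \<and> card s = m' then SOME x. x \<in> S \<and> b s - kd e s - f * x \<in> J else 0)" for s
    have g1: "g s \<in> S \<and> b s - kd e s - f * g s \<in> J" if "s \<subseteq> V" "card s = m'" for s
    proof -
      have "\<exists>x. x \<in> S \<and> b s - kd e s - f * x \<in> J"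
        using e(2)[OF that] by (auto simp: ideal_plus_def)
      from someI_ex[OF this] show ?thesis using that by (simp add: g_def)
    qed
    then have g2: "g s \<in> S" for s using S_zero by (auto simp: g_def)
    have "c s - kd g s \<in> J" if s: "s \<subseteq> V" "card s = m" for s
    proof (rule reg)
      show "c s - kd g s \<in> S" using S_diff c kd_in_S[OF s(1)] g2 by blast
      have "finite s" using finite_subset[OF s(1) fin_V] .
      have "kd (\<lambda>s. b s - kd e s - f * g s) s \<in> J"
        by (rule kd_in[OF J s(1), of m']) (use s Suc g1 in auto)
      then have "kd b s - f * kd g s \<in> J"
        using kd_kd[OF \<open>finite s\<close>, of e] by (simp add: kd_diff kd_scale)
      then have "(f * c s - kd b s) + (kd b s - f * kd g s) \<in> J"
        using b(2)[OF s] ideal_add[OF J] by blast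
      then show "f * (c s - kd g s) \<in> J" by (simp add: algebra_simps)
    qed
    then show ?thesis using g2 by (rule coboundaryI[rotated])
  qed
qed

text \<open>Squares are lowered one variable at a time. For u in the set of squared variables, X_u
  \<alpha> satisfies the hypotheses with u counted as linear, so it lies in N; then \<alpha> itself
  satisfies them.\<close>

lemma squares_to_one:
  assumes N: "is_ideal N" and max: "\<And>\<alpha>. \<alpha> \<in> S \<Longrightarrow> (\<And>v. v \<in> V \<Longrightarrow> X v * \<alpha> \<in> N) \<Longrightarrow> \<alpha> \<in> N"
    and G: "finite G" "G \<subseteq> V" and \<alpha>: "\<alpha> \<in> S"
    and lin: "\<And>v. v \<in> V - G \<Longrightarrow> X v * \<alpha> \<in> N" and sq: "\<And>v. v \<in> G \<Longrightarrow> X v ^ 2 * \<alpha> \<in> N"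
  shows "\<alpha> \<in> N"
  using G \<alpha> lin sq
proof (induction G arbitrary: \<alpha> rule: finite_induct)
  case empty
  then show ?case using max by blast
next
  case (insert u G)
  have u: "X u \<in> S" using insert.prems X_in by blast
  have mul: "x * (X u * \<alpha>) \<in> N" if "x * \<alpha> \<in> N" for x
    using ideal_mult[OF N u that] by (simp add: mult_ac)
  have "X u * \<alpha> \<in> N"
  proof (rule insert.IH)
    show "G \<subseteq> V" "X u * \<alpha> \<in> S" using insert.prems u S_mult by auto
    show "X v * (X u * \<alpha>) \<in> N" if "v \<in> V - G" for v
    proof (cases "v = u")
      case True
      then show ?thesis using insert.prems(4)[of u] by (simp add: power2_eq_square mult_ac)
    qed (use that insert.prems(3) mul in blast)
    show "X v ^ 2 * (X u * \<alpha>) \<in> N" if "v \<in> G" for v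
      using that insert.prems(4) mul by blast
  qed
  note u\<alpha> = this
  show ?case
  proof (rule insert.IH)
    show "G \<subseteq> V" "\<alpha> \<in> S" using insert.prems by auto
    show "X v * \<alpha> \<in> N" if "v \<in> V - G" for v
      using that u\<alpha> insert.prems(3) by (cases "v = u") auto
    show "X v ^ 2 * \<alpha> \<in> N" if "v \<in> G" for v
      using that insert.prems(4) by blast
  qed
qed

text \<open>The ideal N of multipliers that kill the class of c contains all \<open>a v\<close> by
  the homotopy. If all X_v \<alpha> lie in N, so does f \<alpha>, since f is a combination of the
  X_v, and cancelling f puts \<alpha> into N. Hence 1 lies in N by
  \<open>squares_to_one\<close>.\<close>

lemma cocycle_coboundary_step:
  assumes J: "is_ideal J" and f: "regular_on f J"
    and fX: "f = (\<Sum>v\<in>V. q v * X v)" "\<And>v. v \<in> V \<Longrightarrow> q v \<in> S"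
    and van: "\<And>b. m > 0 \<Longrightarrow> cocycle (ideal_plus J f) (m - 1) b \<Longrightarrow>
      coboundary (ideal_plus J f) (m - 1) b"
    and c: "cocycle J m c"
  shows "coboundary J m c"
proof -
  have cS: "c s \<in> S" for s using c by (simp add: cocycle_def)
  define N where "N = {\<alpha> \<in> S. coboundary J m (\<lambda>s. \<alpha> * c s)}"
  have N: "is_ideal N"
    unfolding is_ideal_def
  proof (intro conjI ballI)
    show "0 \<in> N"
      unfolding N_def using S_zero ideal_zero[OF J]
      by (intro CollectI conjI coboundaryI[of "\<lambda>_. 0"]) (simp_all add: kd_def)
    fix x y assume "x \<in> N" "y \<in> N"
    then obtain b b' where b: "x \<in> S" "y \<in> S" "\<And>s. b s \<in> S" "\<And>s. b' s \<in> S"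
      "\<And>s. s \<subseteq> V \<Longrightarrow> card s = m \<Longrightarrow> x * c s - kd b s \<in> J"
      "\<And>s. s \<subseteq> V \<Longrightarrow> card s = m \<Longrightarrow> y * c s - kd b' s \<in> J"
      by (auto simp: N_def coboundary_def)
    have "(x + y) * c s - kd (\<lambda>s. b s + b' s) s \<in> J" if "s \<subseteq> V" "card s = m" for s
      using ideal_add[OF J b(5)[OF that] b(6)[OF that]] by (simp add: kd_add algebra_simps)
    then show "x + y \<in> N"
      unfolding N_def using b(1-4) S_add
      by (intro CollectI conjI coboundaryI[of "\<lambda>s. b s + b' s"]) blast+
  next
    fix x y assume x: "x \<in> S" and "y \<in> N"
    then obtain b where b: "y \<in> S" "\<And>s. b s \<in> S"
      "\<And>s. s \<subseteq> V \<Longrightarrow> card s = m \<Longrightarrow> y * c s - kd b s \<in> J"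
      by (auto simp: N_def coboundary_def)
    have "x * y * c s - kd (\<lambda>s. x * b s) s \<in> J" if "s \<subseteq> V" "card s = m" for s
      using ideal_mult[OF J x b(3)[OF that]] by (simp add: kd_scale algebra_simps)
    then show "x * y \<in> N"
      unfolding N_def using b(1,2) x S_mult
      by (intro CollectI conjI coboundaryI[of "\<lambda>s. x * b s"]) blast+
  qed (auto simp: N_def)
  have aN: "a v \<in> N" if v: "v \<in> V" for v
  proof -
    have "a v * c s - kd (contraction v c) s \<in> J" if s: "s \<subseteq> V" "card s = m" for s
    proof -
      have fin: "finite s" using finite_subset[OF s(1) fin_V] .
      have "contraction v (kd c) s \<in> J"
        using c s v fin ideal_zero[OF J] ideal_mult[OF J ksign_in]
        by (auto simp: contraction_def cocycle_def)
      then show ?thesis by (simp flip: contraction_homotopy[OF fin, of v c])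
    qed
    moreover have "contraction v c s \<in> S" for s
      using cS S_mult ksign_in S_zero by (simp add: contraction_def)
    ultimately show ?thesis
      unfolding N_def using a_in[OF v]
      by (intro CollectI conjI coboundaryI[of "contraction v c"]) blast+
  qed
  have "1 \<in> N"
  proof (rule squares_to_one[OF N _ _ F_sub S_one])
    show "finite F" using F_sub fin_V finite_subset by blast
    show "X v * 1 \<in> N" if "v \<in> V - F" for v using aN[of v] a_eq[of v] that by simp
    show "X v ^ 2 * 1 \<in> N" if "v \<in> F" for v using aN[of v] a_eq[of v] that F_sub by auto
    fix \<alpha> assume \<alpha>: "\<alpha> \<in> S" and XN: "\<And>v. v \<in> V \<Longrightarrow> X v * \<alpha> \<in> N"
    have "f * \<alpha> = (\<Sum>v\<in>V. q v * (X v * \<alpha>))" unfolding fX(1) sum_distrib_right by (simp only: mult.assoc)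
    also have "\<dots> \<in> N" using fX(2) XN ideal_mult[OF N] by (intro ideal_sum[OF N]) blast
    finally have "coboundary J m (\<lambda>s. f * (\<alpha> * c s))" by (simp add: N_def mult_ac)
    then have "coboundary J m (\<lambda>s. \<alpha> * c s)"
      by (rule coboundary_cancel[OF J f S_mult[OF \<alpha> cS] _ van])
    then show "\<alpha> \<in> N" using \<alpha> by (simp add: N_def)
  qed
  then show ?thesis by (simp add: N_def)
qed

text \<open>Degree m modulo J_j needs degree m - 1 modulo J_(j+1), so m + j is invariant in the
  induction; the bound m + j < r leaves a regular element for every step.\<close>

theorem cocycle_coboundary:
  assumes J: "\<And>j. j < r \<Longrightarrow> is_ideal (J j)" and reg: "\<And>j. j < r \<Longrightarrow> regular_on (f j) (J j)"
    and step: "\<And>j. j < r \<Longrightarrow> J (Suc j) = ideal_plus (J j) (f j)"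
    and fX: "\<And>j. j < r \<Longrightarrow> \<exists>q. f j = (\<Sum>v\<in>V. q v * X v) \<and> (\<forall>v\<in>V. q v \<in> S)"
    and m: "m + j < r" and c: "cocycle (J j) m c"
  shows "coboundary (J j) m c"
  using m c
proof (induction m arbitrary: j c)
  case 0
  obtain q where "f j = (\<Sum>v\<in>V. q v * X v)" "\<forall>v\<in>V. q v \<in> S" using fX[of j] 0 by auto
  then show ?case
    using 0 J[of j] reg[of j] by (intro cocycle_coboundary_step[of "J j" "f j" q 0 c]) simp_all
next
  case (Suc m)
  then have j: "j < r" by simp
  obtain q where q: "f j = (\<Sum>v\<in>V. q v * X v)" "\<forall>v\<in>V. q v \<in> S" using fX[OF j] by auto
  show ?case
  proof (rule cocycle_coboundary_step[OF J[OF j] reg[OF j] q(1) _ _ Suc.prems(2)])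
    fix b assume "cocycle (ideal_plus (J j) (f j)) (Suc m - 1) b"
    then show "coboundary (ideal_plus (J j) (f j)) (Suc m - 1) b"
      using Suc.IH[of "Suc j" b] Suc.prems(1) by (simp add: step[OF j])
  qed (use q in blast)
qed

end

section \<open>Squarefree monomial ideals\<close>

definition set_exponent :: "'v set \<Rightarrow> 'v \<Rightarrow>\<^sub>0 nat" where
  "set_exponent C = (\<Sum>v\<in>C. Poly_Mapping.single v 1)"

lemma prod_mvar: "finite C \<Longrightarrow> (\<Prod>v\<in>C. mvar v) = Poly_Mapping.single (set_exponent C) 1"
  by (induction C rule: finite_induct)
    (simp_all add: mvar_def mult_single single_one set_exponent_def)

lemma lookup_set_exponent:
  "finite C \<Longrightarrow> Poly_Mapping.lookup (set_exponent C) w = of_bool (w \<in> C)"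
  by (simp add: set_exponent_def lookup_sum lookup_single when_def)

lemma keys_set_exponent: "finite C \<Longrightarrow> Poly_Mapping.keys (set_exponent C) = C"
  by (auto simp: in_keys_iff lookup_set_exponent)

lemma mem_keys_add: "m \<in> Poly_Mapping.keys (p + q) \<Longrightarrow> m \<in> Poly_Mapping.keys p \<or> m \<in> Poly_Mapping.keys q"
  using keys_add[of p q] by blast

lemma keys_plus_exponent:
  "Poly_Mapping.keys (a + b :: 'v \<Rightarrow>\<^sub>0 nat) = Poly_Mapping.keys a \<union> Poly_Mapping.keys b"
  by (auto simp: in_keys_iff lookup_add)

lemma keys_mult_exponent:
  assumes "m \<in> Poly_Mapping.keys (p * q)"
  obtains a b where "a \<in> Poly_Mapping.keys p" "b \<in> Poly_Mapping.keys q"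
    "(m :: 'v \<Rightarrow>\<^sub>0 nat) = a + b" "Poly_Mapping.keys m = Poly_Mapping.keys a \<union> Poly_Mapping.keys b"
proof -
  from keys_mult[of p q] assms obtain a b
    where "a \<in> Poly_Mapping.keys p" "b \<in> Poly_Mapping.keys q" "m = a + b"
    by (auto dest!: subsetD)
  then show thesis using that keys_plus_exponent by metis
qed

lemma set_exponent_insert:
  "finite F \<Longrightarrow> v \<notin> F \<Longrightarrow> set_exponent (insert v F) = Poly_Mapping.single v 1 + set_exponent F"
  by (simp add: set_exponent_def)

lemma lookup_mvar_mult:
  "Poly_Mapping.lookup (mvar v * q) (Poly_Mapping.single v 1 + m) = Poly_Mapping.lookup q m"
proof -
  have inner: "(\<Sum>b. Poly_Mapping.lookup q b when Poly_Mapping.single v 1 + m = a + b) =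
      Poly_Mapping.lookup q m" if "a = Poly_Mapping.single v (1::nat)" for a
    using that by (simp add: eq_commute[of m])
  have "Poly_Mapping.lookup (mvar v * q) (Poly_Mapping.single v 1 + m) =
      (\<Sum>a. (\<Sum>b. Poly_Mapping.lookup q b when Poly_Mapping.single v 1 + m = a + b)
         when a = Poly_Mapping.single v 1)"
    unfolding lookup_mult by (rule Sum_any.cong) (auto simp: mvar_def lookup_single when_def)
  also have "\<dots> = Poly_Mapping.lookup q m" by (simp add: inner)
  finally show ?thesis .
qed

lemma lookup_mvar_power2_mult:
  assumes "Poly_Mapping.lookup m u < 2"
  shows "Poly_Mapping.lookup (mvar u ^ 2 * q) m = 0"
proof (rule ccontr)
  assume "Poly_Mapping.lookup (mvar u ^ 2 * q) m \<noteq> 0"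
  then have "m \<in> Poly_Mapping.keys (mvar u ^ 2 * q)" by (simp add: in_keys_iff)
  then obtain a b where ab: "a \<in> Poly_Mapping.keys (mvar u ^ 2 :: ('a, 'b) mpoly)" "m = a + b"
    by (rule keys_mult_exponent) blast
  have "mvar u ^ 2 = (Poly_Mapping.single (Poly_Mapping.single u 2) 1 :: ('a, 'b) mpoly)"
    by (simp add: mvar_def power2_eq_square mult_single numeral_2_eq_2 flip: single_add)
  then have "a = Poly_Mapping.single u 2" using ab(1) by (simp split: if_splits)
  then show False using assms ab(2) by (simp add: lookup_add)
qed

section \<open>Ideals of the polynomial ring and primes generated by variables\<close>

lemma mpoly_ring_simps [simp]:
  "mult (mpoly_ring V) = (*)" "one (mpoly_ring V) = 1" "zero (mpoly_ring V) = 0"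
  "add (mpoly_ring V) = (+)"
  by (simp_all add: mpoly_ring_def)

lemma mem_mpoly_ring:
  "p \<in> carrier (mpoly_ring V) \<longleftrightarrow> (\<forall>m\<in>Poly_Mapping.keys p. Poly_Mapping.keys m \<subseteq> V)"
  by (simp add: mpoly_ring_def)

lemma single_in_mpoly_ring: "Poly_Mapping.keys m \<subseteq> V \<Longrightarrow> Poly_Mapping.single m c \<in> carrier (mpoly_ring V)"
  by (simp add: mem_mpoly_ring)

lemma mvar_in_mpoly_ring: "v \<in> V \<Longrightarrow> mvar v \<in> carrier (mpoly_ring V)"
  unfolding mvar_def by (rule single_in_mpoly_ring) simp

lemma uminus_in_mpoly_ring: "p \<in> carrier (mpoly_ring V) \<Longrightarrow> - p \<in> carrier (mpoly_ring V)"
  by (simp add: mem_mpoly_ring in_keys_iff)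

lemma a_inv_mpoly_ring:
  assumes "p \<in> carrier (mpoly_ring V)"
  shows "\<ominus>\<^bsub>mpoly_ring V\<^esub> p = - p"
proof -
  interpret cring "mpoly_ring V" by (rule cring_mpoly_ring)
  show ?thesis using minus_equality[of "- p" p] assms uminus_in_mpoly_ring[OF assms] by simp
qed

lemma ideal_mpoly_ring_iff:
  fixes V :: "'v set" and J :: "('v, 'k::field) mpoly set"
  shows "ideal J (mpoly_ring V) \<longleftrightarrow> J \<subseteq> carrier (mpoly_ring V) \<and> 0 \<in> J \<and>
    (\<forall>x\<in>J. \<forall>y\<in>J. x + y \<in> J) \<and> (\<forall>x\<in>carrier (mpoly_ring V). \<forall>y\<in>J. x * y \<in> J)" (is "_ \<longleftrightarrow> ?rhs")
proof
  interpret R: cring "mpoly_ring V :: ('v, 'k) mpoly ring" by (rule cring_mpoly_ring)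
  {
    assume "ideal J (mpoly_ring V)"
    then interpret ideal J "mpoly_ring V" .
    show ?rhs using a_subset zero_closed a_closed I_l_closed by auto
  next
    assume J: ?rhs
    show "ideal J (mpoly_ring V)"
    proof (rule idealI)
      show "subgroup J (add_monoid (mpoly_ring V))"
      proof (rule group.subgroupI[OF R.a_group])
        fix a assume a: "a \<in> J"
        have "- 1 * a \<in> J" using J a uminus_in_mpoly_ring R.one_closed by (metis mpoly_ring_simps(2))
        then have "\<ominus>\<^bsub>mpoly_ring V\<^esub> a \<in> J" using J a a_inv_mpoly_ring by (metis mult_minus1 subsetD)
        then show "inv\<^bsub>add_monoid (mpoly_ring V)\<^esub> a \<in> J" by (simp add: a_inv_def)
      qed (use J in auto)
      show "ring (mpoly_ring V :: ('v, 'k) mpoly ring)" by (rule R.ring_axioms)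
      show "x \<otimes>\<^bsub>mpoly_ring V\<^esub> a \<in> J" "a \<otimes>\<^bsub>mpoly_ring V\<^esub> x \<in> J"
        if "a \<in> J" "x \<in> carrier (mpoly_ring V)" for a x
        using J that by (auto simp: mult.commute)
    qed
  }
qed

text \<open>The ideal generated by the variables in A \<inter> V, described through its monomials so
  that membership can be read off the support.\<close>

definition vars_ideal :: "'v set \<Rightarrow> 'v set \<Rightarrow> ('v, 'k::field) mpoly set" where
  "vars_ideal V A =
     {p \<in> carrier (mpoly_ring V). \<forall>m\<in>Poly_Mapping.keys p. Poly_Mapping.keys m \<inter> A \<noteq> {}}"

lemma ideal_vars_ideal: "ideal (vars_ideal V A :: ('v, 'k::field) mpoly set) (mpoly_ring V)"
proof -
  interpret R: cring "mpoly_ring V" by (rule cring_mpoly_ring)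
  show ?thesis
    unfolding ideal_mpoly_ring_iff
  proof (intro conjI ballI)
    show "0 \<in> vars_ideal V A" by (simp add: vars_ideal_def mem_mpoly_ring)
    fix x y :: "('v, 'k) mpoly" assume xy: "x \<in> vars_ideal V A" "y \<in> vars_ideal V A"
    then have "x + y \<in> carrier (mpoly_ring V)"
      using R.a_closed[of x y] by (simp add: vars_ideal_def)
    moreover have "Poly_Mapping.keys m \<inter> A \<noteq> {}" if "m \<in> Poly_Mapping.keys (x + y)" for m
      using mem_keys_add[OF that] xy unfolding vars_ideal_def by blast
    ultimately show "x + y \<in> vars_ideal V A" unfolding vars_ideal_def by blast
  next
    fix x y :: "('v, 'k) mpoly" assume xy: "x \<in> carrier (mpoly_ring V)" "y \<in> vars_ideal V A"
    have "Poly_Mapping.keys m \<inter> A \<noteq> {}" if "m \<in> Poly_Mapping.keys (x * y)" for m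
      using that
    proof (rule keys_mult_exponent)
      fix a b assume "b \<in> Poly_Mapping.keys y"
        "Poly_Mapping.keys m = Poly_Mapping.keys a \<union> Poly_Mapping.keys b"
      then show ?thesis using xy(2) by (auto simp: vars_ideal_def)
    qed
    then show "x * y \<in> vars_ideal V A"
      using R.m_closed[of x y] xy by (simp add: vars_ideal_def)
  qed (auto simp: vars_ideal_def)
qed

lemma mvar_in_vars_ideal_iff: "v \<in> V \<Longrightarrow> mvar v \<in> vars_ideal V A \<longleftrightarrow> v \<in> A"
  by (simp add: vars_ideal_def mvar_in_mpoly_ring) (simp add: mvar_def)

lemma one_notin_vars_ideal: "1 \<notin> vars_ideal V A"
  by (simp add: vars_ideal_def flip: single_one)

text \<open>Modulo the ideal, p equals its part \<open>free p\<close> supported on monomials without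
  variables from A. A product of two such parts again has only such monomials, so if it lies in the
  ideal it is 0, and the polynomial ring is a domain.\<close>

lemma primeideal_vars_ideal:
  fixes V :: "'v::linorder set"
  shows "primeideal (vars_ideal V A :: ('v, 'k::field) mpoly set) (mpoly_ring V)"
proof (rule primeidealI[OF ideal_vars_ideal cring_mpoly_ring])
  let ?P = "vars_ideal V A :: ('v, 'k) mpoly set" and ?R = "mpoly_ring V :: ('v, 'k) mpoly ring"
  interpret R: cring ?R by (rule cring_mpoly_ring)
  interpret P: ideal ?P ?R by (rule ideal_vars_ideal)
  show "carrier ?R \<noteq> ?P" using R.one_closed one_notin_vars_ideal by auto
  define free where "free p = Poly_Mapping.mapp (\<lambda>m x. if Poly_Mapping.keys m \<inter> A = {} then x else 0) p"
    for p :: "('v, 'k) mpoly"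
  have lookup_free: "Poly_Mapping.lookup (free p) m =
      (if Poly_Mapping.keys m \<inter> A = {} then Poly_Mapping.lookup p m else 0)" for p m
    by (simp add: free_def lookup_mapp when_def in_keys_iff[of _ p])
  have keys_free: "Poly_Mapping.keys (free p) = {m \<in> Poly_Mapping.keys p. Poly_Mapping.keys m \<inter> A = {}}"
    for p by (auto simp: in_keys_iff[of _ p] in_keys_iff[of _ "free p"] lookup_free split: if_splits)
  have free_in: "free p \<in> carrier ?R" if "p \<in> carrier ?R" for p
    using that by (auto simp: mem_mpoly_ring keys_free)
  have diff: "p - free p \<in> ?P" if "p \<in> carrier ?R" for p
  proof -
    have "Poly_Mapping.keys (p - free p) \<subseteq> {m \<in> Poly_Mapping.keys p. Poly_Mapping.keys m \<inter> A \<noteq> {}}"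
      by (auto simp: in_keys_iff[of _ p] in_keys_iff[of _ "p - free p"] lookup_minus lookup_free
          split: if_splits)
    then show ?thesis using that by (auto simp: vars_ideal_def mem_mpoly_ring)
  qed
  fix p q assume p: "p \<in> carrier ?R" and q: "q \<in> carrier ?R" and "p \<otimes>\<^bsub>?R\<^esub> q \<in> ?P"
  then have pq: "p * q \<in> ?P" by simp
  define z where "z = free p * (q - free q) + q * (p - free p)"
  have z: "z \<in> ?P"
    using P.I_l_closed[OF diff[OF q] free_in[OF p]] P.I_l_closed[OF diff[OF p] q] P.a_closed
    by (simp add: z_def)
  have "- 1 \<in> carrier ?R" using uminus_in_mpoly_ring R.one_closed by force
  then have "p * q + (- 1) * z \<in> ?P"
    using P.a_closed[OF pq P.I_l_closed[OF z]] by (simp only: mpoly_ring_simps)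
  moreover have "p * q + (- 1) * z = free p * free q" by (simp add: z_def algebra_simps)
  ultimately have free: "free p * free q \<in> ?P" by simp
  have "free p * free q = 0"
  proof (rule ccontr)
    assume "free p * free q \<noteq> 0"
    then obtain m where m: "m \<in> Poly_Mapping.keys (free p * free q)" by fastforce
    then have "Poly_Mapping.keys m \<inter> A = {}"
      by (rule keys_mult_exponent) (auto simp: keys_free)
    moreover have "\<forall>m\<in>Poly_Mapping.keys (free p * free q). Poly_Mapping.keys m \<inter> A \<noteq> {}"
      using free unfolding vars_ideal_def mem_Collect_eq by (rule conjunct2)
    ultimately show False using m by blast
  qed
  then have "free p = 0 \<or> free q = 0" by simp
  then show "p \<in> ?P \<or> q \<in> ?P" using diff[OF p] diff[OF q] by auto
qed

text \<open>Each monomial gives up one of its variables. This supplies the expansion that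
  \<open>cocycle_coboundary\<close> demands of the elements of the sequence.\<close>

lemma vars_ideal_combination:
  fixes V :: "'v set"
  assumes V: "finite V" and p: "(p :: ('v, 'k::field) mpoly) \<in> vars_ideal V V"
  shows "\<exists>q. p = (\<Sum>v\<in>V. q v * mvar v) \<and> (\<forall>v\<in>V. q v \<in> carrier (mpoly_ring V))"
proof -
  let ?R = "mpoly_ring V :: ('v, 'k) mpoly ring"
  interpret R: cring ?R by (rule cring_mpoly_ring)
  define C where "C p \<longleftrightarrow> (\<exists>q. p = (\<Sum>v\<in>V. q v * mvar v) \<and> (\<forall>v\<in>V. q v \<in> carrier ?R))" for p
  have zero: "C 0" unfolding C_def by (rule exI[of _ "\<lambda>_. 0"]) (simp add: mem_mpoly_ring)
  have add: "C (p + p')" if C: "C p" "C p'" for p p'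
  proof -
    obtain q q' where "p = (\<Sum>v\<in>V. q v * mvar v)" "\<forall>v\<in>V. q v \<in> carrier ?R"
      "p' = (\<Sum>v\<in>V. q' v * mvar v)" "\<forall>v\<in>V. q' v \<in> carrier ?R" using C unfolding C_def by blast
    then show ?thesis unfolding C_def using R.a_closed
      by (intro exI[of _ "\<lambda>v. q v + q' v"]) (auto simp: sum.distrib distrib_right)
  qed
  have monomial: "C (Poly_Mapping.single m x)" if m: "m \<in> Poly_Mapping.keys p" for m x
  proof -
    obtain v where v: "v \<in> Poly_Mapping.keys m" "v \<in> V" using p m by (auto simp: vars_ideal_def)
    have "m = (m - Poly_Mapping.single v 1) + Poly_Mapping.single v 1"
      by (rule poly_mapping_eqI)
        (use v(1) in \<open>auto simp: lookup_add lookup_minus lookup_single when_def in_keys_iff\<close>)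
    then have eq: "Poly_Mapping.single m x =
        Poly_Mapping.single (m - Poly_Mapping.single v 1) x * mvar v"
      by (simp add: mvar_def mult_single)
    have "Poly_Mapping.keys (m - Poly_Mapping.single v 1) \<subseteq> Poly_Mapping.keys m"
      by (auto simp: in_keys_iff lookup_minus)
    also have "\<dots> \<subseteq> V" using p m by (auto simp: vars_ideal_def mem_mpoly_ring)
    finally have "Poly_Mapping.single (m - Poly_Mapping.single v 1) x \<in> carrier ?R"
      by (rule single_in_mpoly_ring)
    moreover have "(\<Sum>w\<in>V. (if w = v then Poly_Mapping.single (m - Poly_Mapping.single v 1) x else 0) * mvar w) =
        (\<Sum>w\<in>V. if w = v then Poly_Mapping.single m x else 0)"
      by (intro sum.cong) (simp_all add: eq)
    then have "(\<Sum>w\<in>V. (if w = v then Poly_Mapping.single (m - Poly_Mapping.single v 1) x else 0) * mvar w) =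
        Poly_Mapping.single m x"
      using v(2) V by simp
    ultimately show ?thesis
      unfolding C_def
      by (intro exI[of _ "\<lambda>w. if w = v then Poly_Mapping.single (m - Poly_Mapping.single v 1) x else 0"])
        (auto simp: mem_mpoly_ring)
  qed
  have "C (\<Sum>m\<in>M. Poly_Mapping.single m (Poly_Mapping.lookup p m))"
    if "finite M" "M \<subseteq> Poly_Mapping.keys p" for M
    using that
  proof (induction M rule: finite_induct)
    case (insert m M)
    then show ?case using add[OF monomial[of m]] by simp
  qed (use zero in simp)
  moreover have "p = (\<Sum>m\<in>Poly_Mapping.keys p. Poly_Mapping.single m (Poly_Mapping.lookup p m))"
    by (rule poly_mapping_eqI) (auto simp: lookup_sum lookup_single when_def in_keys_iff)
  ultimately have "C p" by (metis finite_keys order_refl)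
  then show ?thesis by (simp add: C_def)
qed

section \<open>Edge ideals and the edge ring\<close>

lemma edge_ideal_ideal:
  assumes E: "\<And>e. e \<in> E \<Longrightarrow> e \<subseteq> V" and V: "finite V"
  shows "ideal (edge_ideal V E) (mpoly_ring V)"
proof -
  interpret R: cring "mpoly_ring V" by (rule cring_mpoly_ring)
  have "{\<Prod>v\<in>e. mvar v | e. e \<in> E} \<subseteq> carrier (mpoly_ring V)"
    using E V finite_subset by (fastforce simp: prod_mvar keys_set_exponent intro!: single_in_mpoly_ring)
  then show ?thesis unfolding edge_ideal_def by (rule R.genideal_ideal)
qed

text \<open>The polynomials with this property form an ideal that contains the generators.\<close>

lemma edge_ideal_keys:
  fixes V :: "'v set"
  assumes E: "\<And>e. e \<in> E \<Longrightarrow> e \<subseteq> V" and V: "finite V"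
    and p: "(p :: ('v, 'k::field) mpoly) \<in> edge_ideal V E" and m: "m \<in> Poly_Mapping.keys p"
  shows "\<exists>e\<in>E. e \<subseteq> Poly_Mapping.keys m"
proof -
  let ?R = "mpoly_ring V :: ('v, 'k) mpoly ring"
  interpret R: cring ?R by (rule cring_mpoly_ring)
  let ?J = "{p \<in> carrier ?R. \<forall>m\<in>Poly_Mapping.keys p. \<exists>e\<in>E. e \<subseteq> Poly_Mapping.keys m}"
  have "ideal ?J ?R"
    unfolding ideal_mpoly_ring_iff
  proof (intro conjI ballI)
    show "0 \<in> ?J" by (simp add: mem_mpoly_ring)
    fix x y :: "('v, 'k) mpoly" assume xy: "x \<in> ?J" "y \<in> ?J"
    then have "x + y \<in> carrier ?R" using R.a_closed[of x y] by simp
    moreover have "\<exists>e\<in>E. e \<subseteq> Poly_Mapping.keys m" if "m \<in> Poly_Mapping.keys (x + y)" for m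
      using mem_keys_add[OF that] xy by blast
    ultimately show "x + y \<in> ?J" by blast
  next
    fix x y :: "('v, 'k) mpoly" assume xy: "x \<in> carrier ?R" "y \<in> ?J"
    have "\<exists>e\<in>E. e \<subseteq> Poly_Mapping.keys m" if "m \<in> Poly_Mapping.keys (x * y)" for m
      using that
    proof (rule keys_mult_exponent)
      fix a b assume "b \<in> Poly_Mapping.keys y"
        "Poly_Mapping.keys m = Poly_Mapping.keys a \<union> Poly_Mapping.keys b"
      then show ?thesis using xy(2) by blast
    qed
    moreover have "y \<in> carrier ?R" using xy(2) by blast
    from R.m_closed[OF xy(1) this] have "x * y \<in> carrier ?R" by (simp only: mpoly_ring_simps)
    ultimately show "x * y \<in> ?J" by blast
  qed auto
  moreover have "{\<Prod>v\<in>e. mvar v | e. e \<in> E} \<subseteq> ?J"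
  proof
    fix x :: "('v, 'k) mpoly" assume "x \<in> {\<Prod>v\<in>e. mvar v | e. e \<in> E}"
    then obtain e where e: "e \<in> E" "x = (\<Prod>v\<in>e. mvar v)" by blast
    then have "finite e" "e \<subseteq> V" using E V finite_subset by blast+
    then show "x \<in> ?J"
      using e single_in_mpoly_ring[of "set_exponent e" V] by (auto simp: prod_mvar keys_set_exponent)
  qed
  ultimately have "edge_ideal V E \<subseteq> ?J"
    unfolding edge_ideal_def by (rule R.genideal_minimal)
  then show ?thesis using p m by blast
qed

lemma monomial_in_edge_ideal:
  assumes E: "\<And>e. e \<in> E \<Longrightarrow> e \<subseteq> V" and V: "finite V"
    and e: "e \<in> E" "e \<subseteq> Poly_Mapping.keys m" and m: "Poly_Mapping.keys m \<subseteq> V"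
  shows "Poly_Mapping.single m 1 \<in> edge_ideal V E"
proof -
  interpret R: cring "mpoly_ring V" by (rule cring_mpoly_ring)
  interpret I: ideal "edge_ideal V E" "mpoly_ring V" by (rule edge_ideal_ideal[OF E V])
  have fin: "finite e" using E[OF e(1)] V finite_subset by blast
  have "{\<Prod>v\<in>e. mvar v | e. e \<in> E} \<subseteq> carrier (mpoly_ring V)"
    using E V finite_subset by (fastforce simp: prod_mvar keys_set_exponent intro!: single_in_mpoly_ring)
  then have "(\<Prod>v\<in>e. mvar v) \<in> edge_ideal V E"
    unfolding edge_ideal_def using R.genideal_self e(1) by blast
  then have 1: "Poly_Mapping.single (set_exponent e) 1 \<in> edge_ideal V E" by (simp add: prod_mvar fin)
  have eq: "m = (m - set_exponent e) + set_exponent e"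
    by (rule poly_mapping_eqI)
      (use e(2) in \<open>auto simp: lookup_add lookup_minus lookup_set_exponent[OF fin] in_keys_iff Suc_leI\<close>)
  have "Poly_Mapping.keys (m - set_exponent e) \<subseteq> V"
    using m by (auto simp: in_keys_iff lookup_minus)
  then have "Poly_Mapping.single (m - set_exponent e) 1 * Poly_Mapping.single (set_exponent e) 1
      \<in> edge_ideal V E"
    using I.I_l_closed[OF 1 single_in_mpoly_ring] by simp
  then show ?thesis by (subst eq) (simp add: mult_single)
qed

text \<open>\<open>R\<close> is a parameter because vertices and edges do not determine the
  coefficient field.\<close>

locale edge_ring =
  fixes V :: "'v::linorder set" and E :: "'v set set" and R :: "('v, 'k::field) mpoly ring"
  assumes R_eq: "R = mpoly_ring V" and fin_V: "finite V" and E_sub: "e \<in> E \<Longrightarrow> e \<subseteq> V"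
begin

abbreviation I :: "('v, 'k) mpoly set" where "I \<equiv> edge_ideal V E"
abbreviation Q where "Q \<equiv> R Quot I"
abbreviation coset where "coset \<equiv> a_r_coset R I"

definition independent :: "'v set \<Rightarrow> bool" where
  "independent F \<longleftrightarrow> F \<subseteq> V \<and> (\<forall>e\<in>E. \<not> e \<subseteq> F)"

lemma R_ops [simp]: "mult R = (*)" "one R = 1" "zero R = 0" "add R = (+)"
  by (simp_all add: R_eq)

sublocale R: cring R
  unfolding R_eq by (rule cring_mpoly_ring)

sublocale I: ideal I R
  unfolding R_eq using E_sub fin_V by (rule edge_ideal_ideal)

sublocale hom: ring_hom_ring R Q coset
  by (rule I.rcos_ring_hom_ring)

sublocale Q: cring Q
  by (rule I.quotient_is_cring[OF R.cring_axioms])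

lemma carrier_Q: "carrier Q = coset ` carrier R"
  by (auto simp: FactRing_def A_RCOSETS_def')

lemma coset_mem_iff:
  assumes P: "ideal P R" "I \<subseteq> P" and x: "x \<in> carrier R"
  shows "coset x \<in> coset ` P \<longleftrightarrow> x \<in> P"
proof
  interpret P: ideal P R by (rule P(1))
  assume "coset x \<in> coset ` P"
  then obtain p where p: "p \<in> P" "coset x = coset p" by blast
  have "x \<in> coset p" using I.a_rcos_self[OF x] p(2) by simp
  then obtain i where "i \<in> I" "x = i + p" by (auto simp: a_r_coset_def')
  then show "x \<in> P" using P.a_closed[of i p] P(2) p(1) by auto
qed blast

lemma coset_zero_iff: "x \<in> carrier R \<Longrightarrow> coset x = \<zero>\<^bsub>Q\<^esub> \<longleftrightarrow> x \<in> I"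
  using I.a_rcos_self[of x] I.a_rcos_const[of x] by (auto simp: FactRing_def)

lemma primeideal_coset:
  assumes P: "primeideal P R" "I \<subseteq> P"
  shows "primeideal (coset ` P) Q"
proof (rule primeidealI)
  interpret P: primeideal P R by (rule P(1))
  have ideal: "ideal P R" by (rule P.ideal_axioms)
  show "ideal (coset ` P) Q"
    using R.ring_ideal_imp_quot_ideal[OF I.ideal_axioms ideal] .
  show "carrier Q \<noteq> coset ` P"
  proof
    assume eq: "carrier Q = coset ` P"
    have "x \<in> P" if "x \<in> carrier R" for x
      using hom.hom_closed[OF that] coset_mem_iff[OF ideal P(2) that] eq by simp
    then show False using P.I_notcarr P.a_subset by blast
  qed
  fix a b assume ab: "a \<in> carrier Q" "b \<in> carrier Q" "a \<otimes>\<^bsub>Q\<^esub> b \<in> coset ` P"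
  then obtain x y where xy: "x \<in> carrier R" "y \<in> carrier R" "a = coset x" "b = coset y"
    unfolding carrier_Q by blast
  then have "coset (x \<otimes>\<^bsub>R\<^esub> y) \<in> coset ` P"
    using ab(3) by (simp only: hom.hom_mult)
  then have "x \<otimes>\<^bsub>R\<^esub> y \<in> P" using coset_mem_iff[OF ideal P(2)] xy by blast
  then show "a \<in> coset ` P \<or> b \<in> coset ` P" using P.I_prime xy by blast
qed (rule Q.cring_axioms)

abbreviation irrelevant :: "('v, 'k) mpoly set" where "irrelevant \<equiv> vars_ideal V V"

lemma edge_ideal_sub_vars_ideal:
  assumes "\<And>e. e \<in> E \<Longrightarrow> e \<inter> A \<noteq> {}"
  shows "I \<subseteq> vars_ideal V A"
proof
  fix p :: "('v, 'k) mpoly" assume p: "p \<in> I"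
  have "Poly_Mapping.keys m \<inter> A \<noteq> {}" if "m \<in> Poly_Mapping.keys p" for m
    using edge_ideal_keys[OF E_sub fin_V p that] assms by fast
  then show "p \<in> vars_ideal V A" using p I.a_subset by (auto simp: vars_ideal_def R_eq)
qed

lemma ideal_vars: "ideal (vars_ideal V A) R"
  unfolding R_eq by (rule ideal_vars_ideal)

lemma vars_ideal_sub: "vars_ideal V A \<subseteq> carrier R"
  by (auto simp: vars_ideal_def R_eq)

text \<open>A polynomial outside the irrelevant ideal has a nonzero constant term c. An ideal that
  contains both the irrelevant ideal and this polynomial contains c, which is a unit.\<close>

lemma maximalideal_irrelevant:
  assumes ne: "\<And>e. e \<in> E \<Longrightarrow> e \<noteq> {}"
  shows "maximalideal (coset ` irrelevant) Q"
proof (rule maximalidealI)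
  have sub: "I \<subseteq> irrelevant"
    using ne E_sub by (intro edge_ideal_sub_vars_ideal) blast
  have prime: "primeideal (coset ` irrelevant) Q"
    using primeideal_coset[OF _ sub] primeideal_vars_ideal R_eq by blast
  show "ideal (coset ` irrelevant) Q" using prime by (rule primeideal.axioms(1))
  show "carrier Q \<noteq> coset ` irrelevant" using prime by (rule primeideal.I_notcarr)
  fix J assume J: "ideal J Q" "coset ` irrelevant \<subseteq> J" "J \<subseteq> carrier Q"
  show "J = coset ` irrelevant \<or> J = carrier Q"
  proof (rule disjCI)
    assume "J \<noteq> carrier Q"
    interpret J: ideal J Q by (rule J(1))
    define L where "L = {x \<in> carrier R. coset x \<in> J}"
    interpret L: ideal L R unfolding L_def by (rule hom.ideal_vimage[OF J(1)])
    have "x \<in> irrelevant" if x: "x \<in> carrier R" "coset x \<in> J" for x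
    proof (rule ccontr)
      assume nx: "x \<notin> irrelevant"
      define c where "c = Poly_Mapping.lookup x 0"
      have "\<exists>m\<in>Poly_Mapping.keys x. Poly_Mapping.keys m \<inter> V = {}"
        using nx x(1) by (auto simp: vars_ideal_def R_eq)
      then obtain m where "m \<in> Poly_Mapping.keys x" "Poly_Mapping.keys m \<inter> V = {}" "Poly_Mapping.keys m \<subseteq> V"
        using x(1) by (auto simp: R_eq mem_mpoly_ring)
      then have "0 \<in> Poly_Mapping.keys x" by (metis inf.absorb1 keys_eq_empty)
      then have c: "c \<noteq> 0" by (simp add: c_def in_keys_iff)
      have s: "Poly_Mapping.single 0 d \<in> carrier R" for d
        unfolding R_eq by (rule single_in_mpoly_ring) simp
      have "x - Poly_Mapping.single 0 c \<in> irrelevant"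
        unfolding vars_ideal_def mem_Collect_eq
      proof
        have *: "m \<in> Poly_Mapping.keys x \<and> m \<noteq> 0" if "m \<in> Poly_Mapping.keys (x - Poly_Mapping.single 0 c)" for m
          using that by (auto simp: in_keys_iff[of _ x] in_keys_iff[of _ "x - _"] lookup_minus
              lookup_single when_def c_def split: if_splits)
        then show "x - Poly_Mapping.single 0 c \<in> carrier (mpoly_ring V)"
          using x(1) by (auto simp: R_eq mem_mpoly_ring)
        show "\<forall>m\<in>Poly_Mapping.keys (x - Poly_Mapping.single 0 c). Poly_Mapping.keys m \<inter> V \<noteq> {}"
        proof
          fix m assume "m \<in> Poly_Mapping.keys (x - Poly_Mapping.single 0 c)"
          then have "Poly_Mapping.keys m \<subseteq> V" "Poly_Mapping.keys m \<noteq> {}"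
            using * x(1) by (auto simp: R_eq mem_mpoly_ring)
          then show "Poly_Mapping.keys m \<inter> V \<noteq> {}" by blast
        qed
      qed
      then have d: "x - Poly_Mapping.single 0 c \<in> L"
        unfolding L_def using J(2) vars_ideal_sub by blast
      have m1: "- 1 \<in> carrier R"
        using R.one_closed[unfolded R_ops] unfolding R_eq by (rule uminus_in_mpoly_ring)
      have "x \<in> L" unfolding L_def using x by (intro CollectI conjI)
      from L.a_closed[OF this L.I_l_closed[OF d m1]]
      have "x + (- 1) * (x - Poly_Mapping.single 0 c) \<in> L" by (simp only: R_ops)
      moreover have "x + (- 1) * (x - Poly_Mapping.single 0 c) = Poly_Mapping.single 0 c" by simp
      ultimately have "Poly_Mapping.single 0 c \<in> L" by (simp only:)
      from L.I_l_closed[OF this s[of "1 / c"]]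
      have "Poly_Mapping.single 0 (1 / c) * Poly_Mapping.single 0 c \<in> L" by (simp only: R_ops)
      moreover have "Poly_Mapping.single 0 (1 / c) * Poly_Mapping.single 0 c = \<one>\<^bsub>R\<^esub>"
        using c by (simp add: mult_single single_one)
      ultimately have "coset \<one>\<^bsub>R\<^esub> \<in> J" by (simp only: L_def mem_Collect_eq)
      then have "\<one>\<^bsub>Q\<^esub> \<in> J" by (simp only: hom.hom_one)
      then show False using J.one_imp_carrier \<open>J \<noteq> carrier Q\<close> by blast
    qed
    then have "J \<subseteq> coset ` irrelevant" using J(3) unfolding carrier_Q by blast
    then show "J = coset ` irrelevant" using J(2) by blast
  qed
qed

text \<open>The chain of primes starts with the variables outside F, which already meet every edge
  because F is independent, and then adds the elements of F one at a time.\<close>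

lemma height_irrelevant:
  assumes F: "independent F"
  shows "enat (card F) \<le> height_of_prime Q (coset ` irrelevant)"
proof -
  have finF: "finite F" and FV: "F \<subseteq> V"
    using F fin_V finite_subset by (auto simp: independent_def)
  obtain vs where vs: "set vs = F" "distinct vs" using finite_distinct_list[OF finF] by blast
  have len: "length vs = card F" using vs distinct_card by metis
  define A where "A i = (V - F) \<union> set (take i vs)" for i
  define P where "P i = coset ` (vars_ideal V (A i))" for i
  have sub: "I \<subseteq> vars_ideal V (A i)" for i
  proof (rule edge_ideal_sub_vars_ideal)
    fix e assume e: "e \<in> E"
    then obtain v where "v \<in> e" "v \<notin> F" using F by (auto simp: independent_def)
    then show "e \<inter> A i \<noteq> {}" using E_sub[OF e] by (auto simp: A_def)
  qed
  have "primeideal (P i) Q" for i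
    unfolding P_def using primeideal_coset[OF _ sub] primeideal_vars_ideal R_eq by blast
  moreover have "P i \<subset> P j" if ij: "i < j" "j \<le> length vs" for i j
  proof
    have "A i \<subseteq> A j" using set_take_subset_set_take[of i j vs] ij by (auto simp: A_def)
    then show "P i \<subseteq> P j" unfolding P_def vars_ideal_def by blast
    have v: "vs ! i \<in> V" using ij vs FV by auto
    have "vs ! i \<in> set (take j vs)" using ij by (auto simp: in_set_conv_nth intro!: exI[of _ i])
    moreover have "vs ! i \<notin> set (take i vs)"
      using ij vs(2) by (auto simp: in_set_conv_nth nth_eq_iff_index_eq)
    moreover have "vs ! i \<in> F" using ij vs by auto
    ultimately have "vs ! i \<in> A j" "vs ! i \<notin> A i" by (auto simp: A_def)
    then have "coset (mvar (vs ! i)) \<in> P j" "coset (mvar (vs ! i)) \<notin> P i"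
      unfolding P_def using v mvar_in_vars_ideal_iff[OF v] mvar_in_mpoly_ring[OF v]
        coset_mem_iff[OF ideal_vars sub] by (auto simp: R_eq)
    then show "P i \<noteq> P j" by blast
  qed
  moreover have "P (length vs) = coset ` irrelevant"
    unfolding P_def A_def using vs(1) FV by (simp add: Un_absorb2)
  then have "last (map P [0..<Suc (length vs)]) = coset ` irrelevant" by simp
  ultimately have "map P [0..<Suc (length vs)] \<in> {Ps. Ps \<noteq> [] \<and> last Ps = coset ` irrelevant \<and>
      (\<forall>Q'\<in>set Ps. primeideal Q' Q) \<and> sorted_wrt (\<subset>) Ps}"
    by (auto simp: sorted_wrt_iff_nth_less nth_append simp del: upt_Suc)
  then have "enat (length (map P [0..<Suc (length vs)]) - 1) \<le> height_of_prime Q (coset ` irrelevant)"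
    unfolding height_of_prime_def by (rule SUP_upper)
  then show ?thesis using len by simp
qed

text \<open>Otherwise the depth of the irrelevant ideal would be at most N, although it equals the
  height, which is at least \<open>card F\<close>.\<close>

lemma long_regular_sequence:
  assumes CM: "cohen_macaulay_ring Q" and ne: "\<And>e. e \<in> E \<Longrightarrow> e \<noteq> {}"
    and F: "independent F" "N < card F"
  shows "\<exists>fs. regular_sequence Q fs \<and> set fs \<subseteq> coset ` irrelevant \<and> N < length fs"
proof (rule ccontr)
  assume *: "\<not> ?thesis"
  have "depth_of_ideal Q (coset ` irrelevant) \<le> enat N"
    unfolding depth_of_ideal_def using * by (intro SUP_least) (auto simp: not_less)
  also have "\<dots> < enat (card F)" using F(2) by simp
  also have "\<dots> \<le> height_of_prime Q (coset ` irrelevant)" by (rule height_irrelevant[OF F(1)])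
  also have "\<dots> = depth_of_ideal Q (coset ` irrelevant)"
    using CM maximalideal_irrelevant[OF ne] by (simp add: cohen_macaulay_ring_def)
  finally show False by simp
qed

end

section \<open>Koszul classes attached to faces of the independence complex\<close>

locale edge_ring_face = edge_ring V E R
  for V :: "'v::linorder set" and E and R :: "('v, 'k::field) mpoly ring" +
  fixes F :: "'v set"
  assumes F_indep: "independent F"
begin

definition face_power :: "'v \<Rightarrow> ('v, 'k) mpoly" where
  "face_power v = (if v \<in> F then mvar v ^ 2 else mvar v)"

lemma F_V: "F \<subseteq> V"
  using F_indep by (simp add: independent_def)

lemma fin_F: "finite F"
  using F_V fin_V finite_subset by blast

lemma carrier_uminus: "p \<in> carrier R \<Longrightarrow> - p \<in> carrier R"
  unfolding R_eq by (rule uminus_in_mpoly_ring)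

sublocale K: koszul "carrier R" V mvar face_power F
proof
  show "1 \<in> carrier R" using R.one_closed by (simp only: R_ops)
  show "x + y \<in> carrier R" "x * y \<in> carrier R" if "x \<in> carrier R" "y \<in> carrier R" for x y
    using R.a_closed[OF that] R.m_closed[OF that] by (simp_all only: R_ops)
  show "mvar v \<in> carrier R" if "v \<in> V" for v
    unfolding R_eq using that by (rule mvar_in_mpoly_ring)
qed (use fin_V F_V carrier_uminus in \<open>simp_all add: face_power_def\<close>)

lemma is_ideal_iff: "K.is_ideal J \<longleftrightarrow> ideal J R"
  unfolding K.is_ideal_def ideal_mpoly_ring_iff[of J V, folded R_eq] by blast

lemma is_ideal_plus:
  assumes J: "K.is_ideal J" and g: "g \<in> carrier R"
  shows "K.is_ideal (K.ideal_plus J g)"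
  unfolding K.is_ideal_def
proof (intro conjI ballI)
  show "K.ideal_plus J g \<subseteq> carrier R" by (auto simp: K.ideal_plus_def)
  show "0 \<in> K.ideal_plus J g"
    unfolding K.ideal_plus_def using K.ideal_zero[OF J] K.S_zero
    by (intro CollectI conjI bexI[of _ 0]) simp_all
  fix x y assume "x \<in> K.ideal_plus J g" "y \<in> K.ideal_plus J g"
  then obtain a b where ab: "x \<in> carrier R" "y \<in> carrier R" "a \<in> carrier R" "b \<in> carrier R"
    "x - g * a \<in> J" "y - g * b \<in> J" by (auto simp: K.ideal_plus_def)
  then have "(x + y) - g * (a + b) \<in> J"
    using K.ideal_add[OF J ab(5,6)] by (simp add: algebra_simps)
  then show "x + y \<in> K.ideal_plus J g"
    unfolding K.ideal_plus_def using ab K.S_add by (intro CollectI conjI bexI[of _ "a + b"]) auto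
next
  fix x y assume x: "x \<in> carrier R" and "y \<in> K.ideal_plus J g"
  then obtain b where b: "y \<in> carrier R" "b \<in> carrier R" "y - g * b \<in> J"
    by (auto simp: K.ideal_plus_def)
  then have "x * y - g * (x * b) \<in> J"
    using K.ideal_mult[OF J x b(3)] by (simp add: algebra_simps)
  then show "x * y \<in> K.ideal_plus J g"
    unfolding K.ideal_plus_def using b x K.S_mult by (intro CollectI conjI bexI[of _ "x * b"]) auto
qed

text \<open>The ideals generated by the initial segments of the sequence are pulled back to the
  polynomial ring. They start at the edge ideal, and each arises from the previous one by adding a
  lift that is regular modulo it; so \<open>cocycle_coboundary\<close> applies.\<close>

theorem regular_sequence_kills_cocycles:
  assumes reg: "regular_sequence Q fs" and fs: "set fs \<subseteq> coset ` irrelevant"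
    and m: "m < length fs" and c: "K.cocycle I m c"
  shows "K.coboundary I m c"
proof -
  let ?r = "length fs"
  have "\<exists>g. g \<in> irrelevant \<and> fs ! j = coset g" if "j < ?r" for j
    using fs that nth_mem by fastforce
  then obtain g where g: "\<And>j. j < ?r \<Longrightarrow> g j \<in> irrelevant" "\<And>j. j < ?r \<Longrightarrow> fs ! j = coset (g j)"
    by metis
  have gR: "g j \<in> carrier R" if "j < ?r" for j using g(1)[OF that] vars_ideal_sub by blast
  have fsQ: "set fs \<subseteq> carrier Q" using reg by (simp add: regular_sequence_def)
  then have idlQ: "ideal (Idl\<^bsub>Q\<^esub> (set (take j fs))) Q" for j
    using set_take_subset[of j fs] by (intro hom.S.genideal_ideal) blast
  define J where "J j = {p \<in> carrier R. coset p \<in> Idl\<^bsub>Q\<^esub> (set (take j fs))}" for j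
  have idl: "ideal (J j) R" for j
    unfolding J_def by (rule hom.ideal_vimage[OF idlQ])
  then have J: "K.is_ideal (J j)" for j using is_ideal_iff by blast
  have sub_IJ: "I \<subseteq> J j" for j
  proof
    fix p :: "('v, 'k) mpoly" assume p: "p \<in> I"
    have pR: "p \<in> carrier R" using p I.a_subset by blast
    have "coset p = \<zero>\<^bsub>Q\<^esub>" using coset_zero_iff[OF pR] p by blast
    moreover have "\<zero>\<^bsub>Q\<^esub> \<in> Idl\<^bsub>Q\<^esub> (set (take j fs))"
      using additive_subgroup.zero_closed[OF ideal.axioms(1)[OF idlQ]] .
    ultimately show "p \<in> J j" unfolding J_def using pR by (intro CollectI conjI) simp_all
  qed
  have J0: "J 0 = I"
  proof
    have "Idl\<^bsub>Q\<^esub> (set (take 0 fs)) \<subseteq> {\<zero>\<^bsub>Q\<^esub>}"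
      by (rule hom.S.genideal_minimal[OF hom.S.zeroideal]) simp
    then show "J 0 \<subseteq> I" unfolding J_def using coset_zero_iff by blast
  qed (rule sub_IJ)
  have reg_on: "K.regular_on (g j) (J j)" if j: "j < ?r" for j
    unfolding K.regular_on_def
  proof (intro conjI ballI impI)
    show "g j \<in> carrier R" by (rule gR[OF j])
    fix x assume x: "x \<in> carrier R" "g j * x \<in> J j"
    then have "coset (g j \<otimes>\<^bsub>R\<^esub> x) \<in> Idl\<^bsub>Q\<^esub> (set (take j fs))" by (simp only: R_ops J_def mem_Collect_eq)
    then have "fs ! j \<otimes>\<^bsub>Q\<^esub> coset x \<in> Idl\<^bsub>Q\<^esub> (set (take j fs))"
      by (simp only: hom.hom_mult[OF gR[OF j] x(1)] g(2)[OF j])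
    then have "coset x \<in> Idl\<^bsub>Q\<^esub> (set (take j fs))"
      using reg j hom.hom_closed[OF x(1)] by (simp add: regular_sequence_def)
    then show "x \<in> J j" unfolding J_def using x(1) by (intro CollectI conjI)
  qed
  have step: "J (Suc j) = K.ideal_plus (J j) (g j)" if j: "j < ?r" for j
  proof
    have take: "set (take (Suc j) fs) = insert (coset (g j)) (set (take j fs))"
      using j g(2)[OF j] by (simp add: take_Suc_conv_app_nth)
    have takeQ: "set (take (Suc j) fs) \<subseteq> carrier Q" using fsQ set_take_subset by fastforce
    let ?B = "K.ideal_plus (J j) (g j)"
    have B: "ideal ?B R" using is_ideal_plus[OF J gR[OF j]] is_ideal_iff by blast
    have JB: "J j \<subseteq> ?B"
    proof
      fix p assume p: "p \<in> J j"
      then have "p \<in> carrier R" by (simp only: J_def mem_Collect_eq)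
      then show "p \<in> ?B"
        unfolding K.ideal_plus_def using p K.S_zero by (intro CollectI conjI bexI[of _ 0]) simp_all
    qed
    have gB: "g j \<in> ?B"
      unfolding K.ideal_plus_def using gR[OF j] K.S_one K.ideal_zero[OF J]
      by (intro CollectI conjI bexI[of _ 1]) simp_all
    have "set (take (Suc j) fs) \<subseteq> coset ` ?B"
    proof
      fix f assume f: "f \<in> set (take (Suc j) fs)"
      show "f \<in> coset ` ?B"
      proof (cases "f = coset (g j)")
        case False
        then have f': "f \<in> set (take j fs)" using f take by blast
        then obtain x where x: "x \<in> carrier R" "f = coset x"
          using fsQ carrier_Q set_take_subset by (metis imageE subsetD)
        have "set (take j fs) \<subseteq> carrier Q" using fsQ set_take_subset by fastforce
        then have "coset x \<in> Idl\<^bsub>Q\<^esub> (set (take j fs))" using hom.S.genideal_self f' x(2) by blast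
        then have "x \<in> J j" unfolding J_def using x(1) by (intro CollectI conjI)
        then show ?thesis using JB x(2) by blast
      qed (use gB in blast)
    qed
    then have "Idl\<^bsub>Q\<^esub> (set (take (Suc j) fs)) \<subseteq> coset ` ?B"
      by (rule hom.S.genideal_minimal[OF R.ring_ideal_imp_quot_ideal[OF I.ideal_axioms B]])
    then show "J (Suc j) \<subseteq> ?B"
      unfolding J_def[of "Suc j"] using coset_mem_iff[OF B] sub_IJ JB by blast
    show "?B \<subseteq> J (Suc j)"
    proof
      fix y assume "y \<in> ?B"
      then obtain x where x: "x \<in> carrier R" "y - g j * x \<in> J j" by (auto simp: K.ideal_plus_def)
      have "Idl\<^bsub>Q\<^esub> (set (take j fs)) \<subseteq> Idl\<^bsub>Q\<^esub> (set (take (Suc j) fs))"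
        using hom.S.subset_Idl_subset[OF takeQ] take by blast
      then have 1: "y - g j * x \<in> J (Suc j)" using x(2) unfolding J_def by blast
      have "coset (g j) \<in> Idl\<^bsub>Q\<^esub> (set (take (Suc j) fs))"
        using hom.S.genideal_self[OF takeQ] take by blast
      then have "g j \<in> J (Suc j)" unfolding J_def using gR[OF j] by (intro CollectI conjI)
      then have "x * g j \<in> J (Suc j)" using K.ideal_mult[OF J x(1)] by blast
      then have "(y - g j * x) + x * g j \<in> J (Suc j)" using K.ideal_add[OF J 1] by blast
      then show "y \<in> J (Suc j)" by (simp add: mult.commute)
    qed
  qed
  have comb: "\<exists>q. g j = (\<Sum>v\<in>V. q v * mvar v) \<and> (\<forall>v\<in>V. q v \<in> carrier R)" if "j < ?r" for j
    using vars_ideal_combination[OF fin_V g(1)[OF that]] unfolding R_eq .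
  have "K.coboundary (J 0) m c"
    by (rule K.cocycle_coboundary[where r = ?r and f = g])
      (use J reg_on step comb m c in \<open>simp_all add: J0\<close>)
  then show ?thesis by (simp add: J0)
qed

definition face_monom :: "('v, 'k) mpoly" where
  "face_monom = Poly_Mapping.single (set_exponent F) 1"

lemma face_monom_in: "face_monom \<in> carrier R"
  unfolding face_monom_def R_eq using F_V fin_F
  by (intro single_in_mpoly_ring) (simp add: keys_set_exponent)

lemma mvar_face_monom:
  assumes "v \<notin> F"
  shows "mvar v * face_monom = Poly_Mapping.single (set_exponent (insert v F)) 1"
  using assms fin_F by (simp add: face_monom_def mvar_def mult_single set_exponent_insert)

lemma non_face_in_edge_ideal:
  assumes "G \<subseteq> V" "\<not> independent G"
  shows "Poly_Mapping.single (set_exponent G) 1 \<in> I"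
proof -
  have "finite G" using assms(1) fin_V finite_subset by blast
  moreover obtain e where "e \<in> E" "e \<subseteq> G" using assms by (auto simp: independent_def)
  ultimately show ?thesis
    using assms(1) E_sub fin_V by (intro monomial_in_edge_ideal[of E V e]) (simp_all add: keys_set_exponent)
qed

lemma lookup_edge_ideal_face:
  assumes "p \<in> I" "independent G"
  shows "Poly_Mapping.lookup p (set_exponent G) = 0"
proof (rule ccontr)
  assume "Poly_Mapping.lookup p (set_exponent G) \<noteq> 0"
  then have "set_exponent G \<in> Poly_Mapping.keys p" by (simp add: in_keys_iff)
  then obtain e where "e \<in> E" "e \<subseteq> Poly_Mapping.keys (set_exponent G)"
    using edge_ideal_keys[OF E_sub fin_V assms(1)] by blast
  moreover have "finite G" using assms(2) fin_V finite_subset by (auto simp: independent_def)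
  ultimately show False using assms(2) by (simp add: independent_def keys_set_exponent)
qed

text \<open>A multiple of the square of a variable has no squarefree monomial; this is the reason
  for squaring the variables of F.\<close>

lemma lookup_face_power_term:
  assumes "u \<in> F" "finite G"
  shows "Poly_Mapping.lookup (K.ksign v s * face_power u * q) (set_exponent G) = 0"
proof -
  have "face_power u = mvar u ^ 2" using assms(1) by (simp add: face_power_def)
  then have eq: "K.ksign v s * face_power u * q = mvar u ^ 2 * (K.ksign v s * q)"
    by (simp only: mult_ac)
  show ?thesis
    unfolding eq by (rule lookup_mvar_power2_mult) (simp add: lookup_set_exponent[OF assms(2)])
qed

text \<open>The class is that of \<open>F \<mapsto> x\<^sub>F\<close>.\<close>

theorem facet_class:
  assumes facet: "\<And>v. v \<in> V - F \<Longrightarrow> \<not> independent (insert v F)"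
  shows "\<exists>c. K.cocycle I (card F) c \<and> \<not> K.coboundary I (card F) c"
proof (intro exI conjI notI)
  let ?c = "\<lambda>s. if s = F then face_monom else 0"
  have I: "K.is_ideal I" using I.ideal_axioms is_ideal_iff by blast
  show "K.cocycle I (card F) ?c"
    unfolding K.cocycle_def
  proof (intro conjI allI impI)
    show "?c s \<in> carrier R" for s using face_monom_in K.S_zero by simp
    fix s assume s: "s \<subseteq> V \<and> card s = Suc (card F)"
    show "K.kd ?c s \<in> I"
      unfolding K.kd_def
    proof (rule K.ideal_sum[OF I])
      fix v assume v: "v \<in> s"
      show "K.ksign v s * face_power v * ?c (s - {v}) \<in> I"
      proof (cases "s - {v} = F")
        case True
        then have vF: "v \<in> V - F" using v s by auto
        then have "mvar v * face_monom \<in> I"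
          using facet[OF vF] F_V by (simp add: mvar_face_monom non_face_in_edge_ideal)
        from K.ideal_mult[OF I K.ksign_in this] show ?thesis
          using True vF by (simp add: face_power_def mult.assoc)
      qed (use K.ideal_zero[OF I] in simp)
    qed
  qed
  assume "K.coboundary I (card F) ?c"
  then obtain b where "\<forall>s. s \<subseteq> V \<and> card s = card F \<longrightarrow> ?c s - K.kd b s \<in> I"
    unfolding K.coboundary_def by (elim exE conjE)
  from spec[OF this, of F] have "face_monom - K.kd b F \<in> I" using F_V by simp
  from lookup_edge_ideal_face[OF this F_indep]
  have "Poly_Mapping.lookup (K.kd b F) (set_exponent F) = 1"
    by (simp add: lookup_minus face_monom_def)
  moreover have "Poly_Mapping.lookup (K.kd b F) (set_exponent F) = 0"
    unfolding K.kd_def lookup_sum using fin_F by (intro sum.neutral ballI lookup_face_power_term)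
  ultimately show False by simp
qed

text \<open>
  If the link of \<open>F\<close> is disconnected, say with \<open>A\<close> a union of components of its vertex set, then the
  cochain \<open>F \<union> {v} \<mapsto> \<plusminus> x\<^sub>v x\<^sub>F\<close> for \<open>v \<in> A\<close> represents a nontrivial class in degree \<open>|F| + 1\<close>.
\<close>

theorem disconnected_link_class:
  assumes A: "A \<subseteq> V - F" "p \<in> A" "independent (insert p F)"
    and B: "q \<in> V - F" "q \<notin> A" "independent (insert q F)"
    and sep: "\<And>v w. v \<in> A \<Longrightarrow> w \<in> V - F \<Longrightarrow> w \<notin> A \<Longrightarrow> \<not> independent (insert v (insert w F))"
  shows "\<exists>c. K.cocycle I (Suc (card F)) c \<and> \<not> K.coboundary I (Suc (card F)) c"
proof (intro exI conjI notI)
  \<comment> \<open>At most one summand is nonzero, since v is the only element of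
    \<open>insert v F\<close> outside F.\<close>
  define c where "c s = (\<Sum>v\<in>A. if s = insert v F then K.ksign v s * (mvar v * face_monom) else 0)" for s
  have I: "K.is_ideal I" using I.ideal_axioms is_ideal_iff by blast
  have finA: "finite A" using A(1) fin_V finite_subset by blast
  have c_insert: "c (insert v F) = (if v \<in> A then K.ksign v (insert v F) * (mvar v * face_monom) else 0)"
    if "v \<notin> F" for v
  proof -
    have "insert v F = insert w F \<longleftrightarrow> w = v" if "w \<in> A" for w
      using A(1) that \<open>v \<notin> F\<close> by blast
    then have "c (insert v F) =
        (\<Sum>w\<in>A. if w = v then K.ksign v (insert v F) * (mvar v * face_monom) else 0)"
      unfolding c_def by (intro sum.cong) auto
    then show ?thesis using finA by simp
  qed
  have c_0: "c s = 0" if "\<not> F \<subseteq> s" for s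
    unfolding c_def using that by (intro sum.neutral) auto
  have c_in: "c s \<in> carrier R" for s
    unfolding c_def using A(1) face_monom_in K.X_in K.ksign_in K.S_mult K.S_zero
    by (intro K.ideal_sum[OF K.ideal_S]) auto
  show "K.cocycle I (Suc (card F)) c"
    unfolding K.cocycle_def
  proof (intro conjI allI impI)
    show "c s \<in> carrier R" for s by (rule c_in)
    fix s assume s: "s \<subseteq> V \<and> card s = Suc (Suc (card F))"
    then have fs: "finite s" by (simp add: card_ge_0_finite)
    show "K.kd c s \<in> I"
    proof (cases "F \<subseteq> s")
      case False
      then have "c (s - {v}) = 0" for v by (intro c_0) blast
      then have "K.kd c s = 0" by (simp add: K.kd_def)
      then show ?thesis using K.ideal_zero[OF I] by simp
    next
      case True
      then have "card (s - F) = 2" using s fin_F by (simp add: card_Diff_subset)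
      then obtain v w where vw: "s - F = {v, w}" "v \<noteq> w" by (auto simp: card_2_iff)
      then have mem: "v \<in> s" "w \<in> s" "v \<in> V - F" "w \<in> V - F" using s by auto
      have s_eq: "s = insert v (insert w F)" using vw True by blast
      have sw: "s - {v} = insert w F" "s - {w} = insert v F" using s_eq mem vw(2) by auto
      have "K.kd c s = (\<Sum>u\<in>{v, w}. K.ksign u s * face_power u * c (s - {u}))"
        unfolding K.kd_def
      proof (rule sum.mono_neutral_right[OF fs])
        show "\<forall>u\<in>s - {v, w}. K.ksign u s * face_power u * c (s - {u}) = 0"
        proof
          fix u assume "u \<in> s - {v, w}"
          then have "u \<in> F" using vw(1) by blast
          then have "c (s - {u}) = 0" by (intro c_0) blast
          then show "K.ksign u s * face_power u * c (s - {u}) = 0" by simp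
        qed
      qed (use mem in blast)
      then have kd: "K.kd c s = K.ksign v s * mvar v * c (insert w F) + K.ksign w s * mvar w * c (insert v F)"
        using vw(2) mem sw by (simp add: face_power_def)
      have one: "K.ksign x s * mvar x * c (insert y F) + K.ksign y s * mvar y * c (insert x F) \<in> I"
        if xy: "x \<in> A" "y \<notin> A" "s = insert x (insert y F)" "x \<notin> F" "y \<in> V - F" "x \<noteq> y" for x y
      proof -
        have "mvar y * (mvar x * face_monom) = Poly_Mapping.single (set_exponent s) 1"
          using xy fin_F set_exponent_insert[of "insert x F" y]
          by (simp add: mvar_face_monom insert_commute) (simp add: mvar_def mult_single)
        then have "mvar y * (mvar x * face_monom) \<in> I"
          using non_face_in_edge_ideal[of s] sep[OF xy(1,5,2)] s xy(3) by simp
        from K.ideal_mult[OF I K.S_mult[OF K.ksign_in K.ksign_in] this]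
        show ?thesis using xy by (simp add: c_insert mult_ac)
      qed
      \<comment> \<open>Both in A: the two terms cancel by sign. Exactly one in A: the surviving
        term is a multiple of the monomial of s, which is no face by \<open>sep\<close>. None in A:
        c vanishes on both sets.\<close>
      consider "v \<in> A" "w \<in> A" | "v \<in> A" "w \<notin> A" | "v \<notin> A" "w \<in> A" | "v \<notin> A" "w \<notin> A" by blast
      then show ?thesis
      proof cases
        case 1
        have "K.kd c s = (K.ksign v s * K.ksign w (s - {v}) + K.ksign w s * K.ksign v (s - {w})) *
            (mvar v * mvar w * face_monom)"
          unfolding kd sw using 1 mem by (simp add: c_insert algebra_simps)
        also have "\<dots> = 0" using K.ksign_swap[OF fs mem(1,2) vw(2)] by simp
        finally show ?thesis using K.ideal_zero[OF I] by simp
      next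
        case 2
        then show ?thesis unfolding kd using one[OF 2] s_eq mem vw(2) by simp
      next
        case 3
        then show ?thesis unfolding kd using one[OF 3(2,1)] s_eq mem vw(2)
          by (simp add: insert_commute add.commute)
      next
        case 4
        then show ?thesis unfolding kd using K.ideal_zero[OF I] mem by (simp add: c_insert)
      qed
    qed
  qed
  assume "K.coboundary I (Suc (card F)) c"
  then obtain b where "\<forall>s. s \<subseteq> V \<and> card s = Suc (card F) \<longrightarrow> c s - K.kd b s \<in> I"
    unfolding K.coboundary_def by (elim exE conjE)
  then have b: "c s - K.kd b s \<in> I" if "s \<subseteq> V" "card s = Suc (card F)" for s
    using that by simp
  \<comment> \<open>After multiplication by the sign, a coboundary has the same coefficient \<beta>
    of x_v x_F on all faces \<open>insert v F\<close>, as its other terms involve squares. For c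
    this coefficient is 1 at p and 0 at q.\<close>
  define \<beta> where "\<beta> = Poly_Mapping.lookup (b F) (set_exponent F)"
  have coeff: "\<beta> = (if v \<in> A then 1 else 0)" if v: "v \<in> V - F" "independent (insert v F)" for v
  proof -
    let ?s = "insert v F"
    have s: "?s \<subseteq> V" "card ?s = Suc (card F)" and vF: "v \<notin> F" using v F_V fin_F by auto
    have "K.kd b ?s = K.ksign v ?s * (mvar v * b F) + (\<Sum>u\<in>F. K.ksign u ?s * face_power u * b (?s - {u}))"
      unfolding K.kd_def using v fin_F by (simp add: face_power_def mult.assoc)
    then have "K.ksign v ?s * K.kd b ?s = (K.ksign v ?s * K.ksign v ?s) * (mvar v * b F) +
        (\<Sum>u\<in>F. K.ksign v ?s * (K.ksign u ?s * face_power u * b (?s - {u})))"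
      by (simp only: distrib_left sum_distrib_left mult.assoc)
    also have "(\<Sum>u\<in>F. K.ksign v ?s * (K.ksign u ?s * face_power u * b (?s - {u}))) =
        (\<Sum>u\<in>F. K.ksign u ?s * face_power u * (K.ksign v ?s * b (?s - {u})))"
      by (simp only: mult_ac)
    finally have "K.ksign v ?s * K.kd b ?s = mvar v * b F +
        (\<Sum>u\<in>F. K.ksign u ?s * face_power u * (K.ksign v ?s * b (?s - {u})))"
      by (simp only: K.ksign_sq mult_1)
    moreover have "Poly_Mapping.lookup (\<Sum>u\<in>F. K.ksign u ?s * face_power u * (K.ksign v ?s * b (?s - {u})))
        (set_exponent ?s) = 0"
      unfolding lookup_sum using fin_F by (intro sum.neutral ballI lookup_face_power_term) auto
    moreover have "Poly_Mapping.lookup (mvar v * b F) (set_exponent ?s) = \<beta>"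
      unfolding set_exponent_insert[OF fin_F vF] \<beta>_def by (rule lookup_mvar_mult)
    ultimately have "Poly_Mapping.lookup (K.ksign v ?s * K.kd b ?s) (set_exponent ?s) = \<beta>"
      by (simp add: lookup_add)
    moreover have "Poly_Mapping.lookup (K.ksign v ?s * c ?s) (set_exponent ?s) = (if v \<in> A then 1 else 0)"
    proof (cases "v \<in> A")
      case True
      have "K.ksign v ?s * c ?s = (K.ksign v ?s * K.ksign v ?s) * (mvar v * face_monom)"
        using True v by (simp add: c_insert mult.assoc)
      then show ?thesis using True v by (simp add: K.ksign_sq mvar_face_monom)
    qed (use v in \<open>simp add: c_insert\<close>)
    moreover have "K.ksign v ?s * (c ?s - K.kd b ?s) \<in> I"
      using K.ideal_mult[OF I K.ksign_in b[OF s]] .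
    from lookup_edge_ideal_face[OF this v(2)]
    have "Poly_Mapping.lookup (K.ksign v ?s * c ?s) (set_exponent ?s) =
        Poly_Mapping.lookup (K.ksign v ?s * K.kd b ?s) (set_exponent ?s)"
      by (simp add: right_diff_distrib lookup_minus)
    ultimately show ?thesis by simp
  qed
  have "p \<in> V - F" using A by blast
  then show False using coeff[of p] coeff[of q] A B by simp
qed

end

section \<open>Equal facet sizes and connected links in the Cohen-Macaulay case\<close>

context edge_ring
begin

theorem cohen_macaulay_facet:
  assumes CM: "cohen_macaulay_ring Q" and ne: "\<And>e. e \<in> E \<Longrightarrow> e \<noteq> {}"
    and F: "independent F" and facet: "\<And>v. v \<in> V - F \<Longrightarrow> \<not> independent (insert v F)"
    and G: "independent G"
  shows "card G \<le> card F"
proof (rule ccontr)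
  assume "\<not> ?thesis"
  then obtain fs where fs: "regular_sequence Q fs" "set fs \<subseteq> coset ` irrelevant" "card F < length fs"
    using long_regular_sequence[OF CM ne G, of "card F"] by auto
  interpret edge_ring_face V E R F by unfold_locales (rule F)
  show False
    using facet_class[OF facet] regular_sequence_kills_cocycles[OF fs] by blast
qed

theorem cohen_macaulay_link:
  assumes CM: "cohen_macaulay_ring Q" and ne: "\<And>e. e \<in> E \<Longrightarrow> e \<noteq> {}"
    and F: "independent F"
    and A: "A \<subseteq> V - F" "p \<in> A" "independent (insert p F)"
    and B: "q \<in> V - F" "q \<notin> A" "independent (insert q F)"
    and sep: "\<And>v w. v \<in> A \<Longrightarrow> w \<in> V - F \<Longrightarrow> w \<notin> A \<Longrightarrow> \<not> independent (insert v (insert w F))"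
    and G: "independent G"
  shows "card G \<le> Suc (card F)"
proof (rule ccontr)
  assume "\<not> ?thesis"
  then obtain fs where fs: "regular_sequence Q fs" "set fs \<subseteq> coset ` irrelevant" "Suc (card F) < length fs"
    using long_regular_sequence[OF CM ne G, of "Suc (card F)"] by auto
  interpret edge_ring_face V E R F by unfold_locales (rule F)
  show False
    using disconnected_link_class[OF A B sep] regular_sequence_kills_cocycles[OF fs] by blast
qed

end

section \<open>Cohen-Macaulay bipartite graphs come from posets\<close>

text \<open>
  Any linear order would do: it fixes the Koszul signs and makes the polynomial ring an instance of
  the library's integral domains.
\<close>

instantiation vertex :: linorder
begin

fun vertex_code :: "vertex \<Rightarrow> nat" where
  "vertex_code (Xv i) = 2 * i"
| "vertex_code (Yv i) = Suc (2 * i)"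

definition less_eq_vertex :: "vertex \<Rightarrow> vertex \<Rightarrow> bool" where
  "less_eq_vertex v w \<longleftrightarrow> vertex_code v \<le> vertex_code w"

definition less_vertex :: "vertex \<Rightarrow> vertex \<Rightarrow> bool" where
  "less_vertex v w \<longleftrightarrow> vertex_code v < vertex_code w"

instance
proof
  fix v w :: vertex
  assume "v \<le> w" "w \<le> v"
  then have "vertex_code v = vertex_code w" by (simp add: less_eq_vertex_def)
  then show "v = w" by (cases v; cases w; simp; presburger)
qed (auto simp: less_eq_vertex_def less_vertex_def)

end

lemma bipartite_graph_edge:
  assumes "bipartite_graph n E" "e \<in> E"
  shows "\<exists>i j. e = {Xv i, Yv j} \<and> i \<in> {1..n} \<and> j \<in> {1..n}"
proof -
  have "E \<subseteq> {{Xv i, Yv j} | i j. i \<in> {1..n} \<and> j \<in> {1..n}}"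
    using assms(1) unfolding bipartite_graph_def by (rule conjunct1)
  from subsetD[OF this assms(2)] show ?thesis by (rule CollectD)
qed

lemma finite_vertices: "finite (vertices n)"
  by (simp add: vertices_def)

text \<open>From here on algebra enters only through \<open>facet\<close> and \<open>link\<close>:
  maximal independent sets have equal size, and a face with disconnected link lacks at most one
  element of that size.\<close>

locale cohen_macaulay_bipartite =
  fixes n :: nat and E :: "vertex set set" and independent :: "vertex set \<Rightarrow> bool"
  assumes bip: "bipartite_graph n E"
    and independent_def: "independent F \<longleftrightarrow> F \<subseteq> vertices n \<and> (\<forall>e\<in>E. \<not> e \<subseteq> F)"
    and facet: "independent F \<Longrightarrow> (\<And>v. v \<in> vertices n - F \<Longrightarrow> \<not> independent (insert v F)) \<Longrightarrow>
      independent G \<Longrightarrow> card G \<le> card F"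
    and link: "independent F \<Longrightarrow> A \<subseteq> vertices n - F \<Longrightarrow> p \<in> A \<Longrightarrow> independent (insert p F) \<Longrightarrow>
      q \<in> vertices n - F \<Longrightarrow> q \<notin> A \<Longrightarrow> independent (insert q F) \<Longrightarrow>
      (\<And>v w. v \<in> A \<Longrightarrow> w \<in> vertices n - F \<Longrightarrow> w \<notin> A \<Longrightarrow> \<not> independent (insert v (insert w F))) \<Longrightarrow>
      independent G \<Longrightarrow> card G \<le> Suc (card F)"
begin

definition adj :: "nat \<Rightarrow> nat \<Rightarrow> bool" where
  "adj i j \<longleftrightarrow> {Xv i, Yv j} \<in> E"

definition nb :: "nat set \<Rightarrow> nat set" where
  "nb A = {j. \<exists>i\<in>A. adj i j}"

text \<open>For a set A of left vertices, this is the largest set of left vertices with the same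
  neighbourhood.\<close>

definition cl :: "nat set \<Rightarrow> nat set" where
  "cl A = {i \<in> {1..n}. nb {i} \<subseteq> nb A}"

definition face :: "nat set \<Rightarrow> nat set \<Rightarrow> vertex set" where
  "face A B = Xv ` A \<union> Yv ` B"

lemma edge_form: "e \<in> E \<Longrightarrow> \<exists>i j. e = {Xv i, Yv j} \<and> adj i j \<and> i \<in> {1..n} \<and> j \<in> {1..n}"
  using bipartite_graph_edge[OF bip] unfolding adj_def by blast

lemma adj_range: "adj i j \<Longrightarrow> i \<in> {1..n} \<and> j \<in> {1..n}"
  using edge_form[of "{Xv i, Yv j}"] by (auto simp: adj_def doubleton_eq_iff)

lemma x_adj: assumes "i \<in> {1..n}" shows "\<exists>j. adj i j"
proof -
  have "Xv i \<in> vertices n" using assms by (auto simp: vertices_def)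
  then obtain e where e: "e \<in> E" "Xv i \<in> e" using bip unfolding bipartite_graph_def by blast
  then show ?thesis using edge_form[OF e(1)] by auto
qed

lemma y_adj: assumes "j \<in> {1..n}" shows "\<exists>i. adj i j"
proof -
  have "Yv j \<in> vertices n" using assms by (auto simp: vertices_def)
  then obtain e where e: "e \<in> E" "Yv j \<in> e" using bip unfolding bipartite_graph_def by blast
  then show ?thesis using edge_form[OF e(1)] by auto
qed

lemma Xv_face [simp]: "Xv i \<in> face A B \<longleftrightarrow> i \<in> A"
  and Yv_face [simp]: "Yv j \<in> face A B \<longleftrightarrow> j \<in> B"
  by (auto simp: face_def)

lemma insert_face: "insert (Xv i) (face A B) = face (insert i A) B"
  "insert (Yv j) (face A B) = face A (insert j B)"
  by (auto simp: face_def)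

lemma independent_face:
  "independent (face A B) \<longleftrightarrow> A \<subseteq> {1..n} \<and> B \<subseteq> {1..n} \<and> (\<forall>i\<in>A. \<forall>j\<in>B. \<not> adj i j)"
proof -
  have "face A B \<subseteq> vertices n \<longleftrightarrow> A \<subseteq> {1..n} \<and> B \<subseteq> {1..n}"
    by (auto simp: face_def vertices_def)
  moreover have "(\<forall>e\<in>E. \<not> e \<subseteq> face A B) \<longleftrightarrow> (\<forall>i\<in>A. \<forall>j\<in>B. \<not> adj i j)"
  proof
    show "\<forall>i\<in>A. \<forall>j\<in>B. \<not> adj i j" if "\<forall>e\<in>E. \<not> e \<subseteq> face A B"
      using that by (auto simp: adj_def)
    assume *: "\<forall>i\<in>A. \<forall>j\<in>B. \<not> adj i j"
    show "\<forall>e\<in>E. \<not> e \<subseteq> face A B"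
    proof
      fix e assume "e \<in> E"
      then obtain i j where "e = {Xv i, Yv j}" "adj i j" using edge_form by blast
      then show "\<not> e \<subseteq> face A B" using * by auto
    qed
  qed
  ultimately show ?thesis by (simp add: independent_def)
qed

lemma card_face: "finite A \<Longrightarrow> finite B \<Longrightarrow> card (face A B) = card A + card B"
  unfolding face_def by (subst card_Un_disjoint) (auto simp: card_image inj_on_def)

lemma vertex_cases: assumes "v \<in> vertices n"
  obtains i where "i \<in> {1..n}" "v = Xv i" | j where "j \<in> {1..n}" "v = Yv j"
  using assms by (auto simp: vertices_def)

lemma nb_sub: "nb A \<subseteq> {1..n}"
  using adj_range by (auto simp: nb_def)

lemma nb_mono: "A \<subseteq> B \<Longrightarrow> nb A \<subseteq> nb B"
  by (auto simp: nb_def)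

lemma cl_sub: "cl A \<subseteq> {1..n}"
  by (auto simp: cl_def)

lemma cl_ext: "A \<subseteq> {1..n} \<Longrightarrow> A \<subseteq> cl A"
  by (auto simp: cl_def nb_def)

lemma nb_cl: "A \<subseteq> {1..n} \<Longrightarrow> nb (cl A) = nb A"
  using nb_mono[OF cl_ext] by (fastforce simp: cl_def nb_def)

lemma cl_cl: "A \<subseteq> {1..n} \<Longrightarrow> cl (cl A) = cl A"
  unfolding cl_def[of "cl A"] nb_cl by (simp add: cl_def)

lemma finite_nb [simp]: "finite (nb A)" and finite_cl [simp]: "finite (cl A)"
  using finite_subset[OF nb_sub] finite_subset[OF cl_sub] by auto

lemma independent_X: "independent (face {1..n} {})" and card_X: "card (face {1..n} {}) = n"
  by (simp_all add: independent_face card_face)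

text \<open>\<open>cl A\<close> together with the right vertices outside \<open>nb A\<close> is a
  facet, and so is the set of all left vertices, because no right vertex is isolated. By
  \<open>facet\<close> both have n elements.\<close>

lemma card_cl:
  assumes A: "A \<subseteq> {1..n}"
  shows "card (cl A) = card (nb A)"
proof -
  let ?F = "face (cl A) ({1..n} - nb A)"
  have ind: "independent ?F"
    unfolding independent_face by (auto simp: cl_def nb_def)
  have "\<not> independent (insert v ?F)" if v: "v \<in> vertices n - ?F" for v
  proof -
    have "v \<in> vertices n" using v by blast
    then show ?thesis
    proof (cases rule: vertex_cases)
      case (1 i)
      then obtain j where "adj i j" "j \<notin> nb A" using v by (auto simp: cl_def nb_def)
      then show ?thesis using 1 adj_range by (auto simp: insert_face independent_face)
    next
      case (2 j)
      then have "j \<in> nb A" using v by simp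
      then obtain i where "i \<in> A" "adj i j" by (auto simp: nb_def)
      then show ?thesis using 2 cl_ext[OF A] by (auto simp: insert_face independent_face)
    qed
  qed
  from facet[OF ind this independent_X] have 1: "n \<le> card ?F" by (simp only: card_X)
  have "\<not> independent (insert v (face {1..n} {}))" if v: "v \<in> vertices n - face {1..n} {}" for v
  proof -
    obtain j where "j \<in> {1..n}" "v = Yv j" using v by (auto simp: vertices_def)
    then show ?thesis using y_adj[of j] adj_range by (auto simp: insert_face independent_face)
  qed
  from facet[OF independent_X this ind] have "card ?F \<le> n" by (simp only: card_X)
  with 1 have "card (cl A) + card ({1..n} - nb A) = n" by (simp add: card_face)
  moreover have "card ({1..n} - nb A) = n - card (nb A)"
    using nb_sub by (subst card_Diff_subset) auto
  moreover have "card (nb A) \<le> n" using card_mono[OF _ nb_sub, of A] by simp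
  ultimately show ?thesis by simp
qed

text \<open>Choose x with \<open>nb (insert x A)\<close> as small as possible and let B be the
  closure of \<open>insert x A\<close>. Adding any x' in B - A to A then gives the same
  neighbourhood as B. Consider the face formed by A and the right vertices outside nb B: the
  vertices of its link lie in B - A or in nb B - nb A, and all pairs from these two sets are
  adjacent in the graph. So the link is disconnected, the face has at least n - 1 elements, and B
  has at most one element more than A.\<close>

lemma closed_step:
  assumes A: "A \<subseteq> {1..n}" "cl A = A" "card A < n"
  shows "\<exists>x y. x \<in> {1..n} - A \<and> y \<in> {1..n} - nb A \<and> adj x y \<and>
    cl (insert x A) = insert x A \<and> nb (insert x A) = insert y (nb A)"
proof -
  have finA: "finite A" using A(1) finite_subset by auto
  have "{1..n} - A \<noteq> {}" using A(3) card_mono[OF finA, of "{1..n}"] by auto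
  then have "\<exists>x. x \<in> {1..n} - A" by blast
  from exists_least_lemma obtain x where x: "x \<in> {1..n} - A"
    "\<And>x'. x' \<in> {1..n} - A \<Longrightarrow> card (nb (insert x A)) \<le> card (nb (insert x' A))"
    using ex_has_least_nat[of "\<lambda>x. x \<in> {1..n} - A" _ "\<lambda>x. card (nb (insert x A))"]
      \<open>\<exists>x. x \<in> {1..n} - A\<close> by metis
  let ?B = "cl (insert x A)"
  have xA: "insert x A \<subseteq> {1..n}" using x(1) A(1) by blast
  have nbB: "nb ?B = nb (insert x A)" by (rule nb_cl[OF xA])
  have AB: "A \<subseteq> ?B" "x \<in> ?B" using cl_ext[OF xA] by auto
  have nb_eq: "nb (insert x' A) = nb ?B" if "x' \<in> ?B - A" for x'
  proof (rule card_seteq)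
    have x': "x' \<in> {1..n} - A" using that cl_sub by blast
    show "nb (insert x' A) \<subseteq> nb ?B" using that AB(1) by (intro nb_mono) blast
    show "card (nb ?B) \<le> card (nb (insert x' A))" using x(2)[OF x'] nbB by simp
  qed simp
  have cards: "card (nb A) = card A" "card (nb ?B) = card ?B"
    using card_cl[OF A(1)] card_cl[OF cl_sub[of "insert x A"]] A(2) cl_cl[OF xA] by simp_all
  have "card A < card ?B"
    using AB x(1) by (intro psubset_card_mono) auto
  then have "card (nb A) < card (nb ?B)" using cards by simp
  moreover have nbAB: "nb A \<subseteq> nb ?B" using nb_mono[OF AB(1)] .
  ultimately obtain y where y: "y \<in> nb ?B - nb A" by (metis DiffI card_mono finite_nb leD subsetI)
  have yn: "y \<in> {1..n}" using y nb_sub by blast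
  let ?F = "face A ({1..n} - nb ?B)"
  have "card (face {1..n} {}) \<le> Suc (card ?F)"
  proof (rule link[of ?F "Xv ` (?B - A)" "Xv x" "Yv y"])
    show "independent ?F" using A(1) nbAB by (auto simp: independent_face nb_def)
    show "independent (insert (Xv x) ?F)"
      using xA nbAB nbB by (auto simp: insert_face independent_face nb_def)
    show "independent (insert (Yv y) ?F)"
      using A(1) nbAB y yn by (auto simp: insert_face independent_face nb_def)
    show "Xv ` (?B - A) \<subseteq> vertices n - ?F" using cl_sub by (auto simp: vertices_def)
    show "Yv y \<in> vertices n - ?F" using y yn by (auto simp: vertices_def)
    show "Xv x \<in> Xv ` (?B - A)" using AB x(1) by blast
    fix v w assume v: "v \<in> Xv ` (?B - A)" and w: "w \<in> vertices n - ?F" "w \<notin> Xv ` (?B - A)"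
    then obtain i where i: "v = Xv i" "i \<in> ?B - A" by blast
    have "w \<in> vertices n" using w by blast
    then show "\<not> independent (insert v (insert w ?F))"
    proof (cases rule: vertex_cases)
      case (1 l)
      then have "l \<notin> A" "l \<notin> ?B" using w by auto
      then obtain j where "adj l j" "j \<notin> nb ?B" using 1(1) nbB by (auto simp: cl_def nb_def)
      then show ?thesis using 1 i adj_range by (auto simp: insert_face independent_face)
    next
      case (2 j)
      then have "j \<in> nb (insert i A)" using w nb_eq[OF i(2)] by auto
      then obtain l where "l \<in> insert i A" "adj l j" by (auto simp: nb_def)
      then show ?thesis using 2 i by (auto simp: insert_face independent_face)
    qed
  qed (use y independent_X in auto)
  then have "n \<le> Suc (card ?F)" by (simp only: card_X)
  moreover have "card ?F = card A + (n - card ?B)"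
    using finA nb_sub cards by (simp add: card_face card_Diff_subset)
  moreover have "card ?B \<le> n" using card_mono[OF _ cl_sub, of "insert x A"] by simp
  ultimately have "card ?B \<le> Suc (card A)" by simp
  then have B: "?B = insert x A"
    using AB x(1) finA by (intro card_seteq[symmetric]) auto
  have "card (nb (insert x A)) \<le> card (insert y (nb A))"
    using cards B nbB y x(1) finA by simp
  then have "nb (insert x A) = insert y (nb A)"
    using y nbAB nbB by (intro card_seteq[symmetric]) auto
  moreover have "adj x y" using y nbB by (auto simp: nb_def)
  ultimately show ?thesis using x(1) y yn B by blast
qed

definition good_labelling :: "nat \<Rightarrow> (nat \<Rightarrow> nat) \<Rightarrow> (nat \<Rightarrow> nat) \<Rightarrow> bool" where
  "good_labelling k \<alpha> \<beta> \<longleftrightarrow> inj_on \<alpha> {1..k} \<and> inj_on \<beta> {1..k} \<and> \<alpha> ` {1..k} \<subseteq> {1..n} \<and>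
     cl (\<alpha> ` {1..k}) = \<alpha> ` {1..k} \<and> nb (\<alpha> ` {1..k}) = \<beta> ` {1..k} \<and>
     (\<forall>i\<in>{1..k}. adj (\<alpha> i) (\<beta> i)) \<and> (\<forall>i\<in>{1..k}. \<forall>j\<in>{1..k}. adj (\<alpha> i) (\<beta> j) \<longrightarrow> j \<le> i)"

text \<open>The new left vertex x and the single new neighbour y both receive the label k + 1. No
  earlier left vertex is adjacent to y, so edges never lead to a larger right label.\<close>

lemma labelling: "k \<le> n \<Longrightarrow> \<exists>\<alpha> \<beta>. good_labelling k \<alpha> \<beta>"
proof (induction k)
  case 0
  have "nb {} = {}" by (simp add: nb_def)
  moreover have "cl {} = {}" using x_adj by (auto simp: cl_def nb_def)
  ultimately show ?case by (simp add: good_labelling_def)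
next
  case (Suc k)
  then obtain \<alpha> \<beta> where "good_labelling k \<alpha> \<beta>" using Suc_leD by blast
  then have IH: "inj_on \<alpha> {1..k}" "inj_on \<beta> {1..k}" "\<alpha> ` {1..k} \<subseteq> {1..n}"
    "cl (\<alpha> ` {1..k}) = \<alpha> ` {1..k}" "nb (\<alpha> ` {1..k}) = \<beta> ` {1..k}"
    "\<And>i. i \<in> {1..k} \<Longrightarrow> adj (\<alpha> i) (\<beta> i)"
    "\<And>i j. i \<in> {1..k} \<Longrightarrow> j \<in> {1..k} \<Longrightarrow> adj (\<alpha> i) (\<beta> j) \<Longrightarrow> j \<le> i"
    unfolding good_labelling_def by blast+
  have "card (\<alpha> ` {1..k}) < n" using IH(1) Suc.prems by (simp add: card_image)
  from closed_step[OF IH(3,4) this] obtain x y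
    where xy: "x \<in> {1..n} - \<alpha> ` {1..k}" "y \<in> {1..n} - nb (\<alpha> ` {1..k})" "adj x y"
      "cl (insert x (\<alpha> ` {1..k})) = insert x (\<alpha> ` {1..k})"
      "nb (insert x (\<alpha> ` {1..k})) = insert y (nb (\<alpha> ` {1..k}))" by blast
  define \<alpha>' where "\<alpha>' = \<alpha>(Suc k := x)"
  define \<beta>' where "\<beta>' = \<beta>(Suc k := y)"
  have set: "{1..Suc k} = insert (Suc k) {1..k}" by auto
  have old: "\<alpha>' ` {1..k} = \<alpha> ` {1..k}" "\<beta>' ` {1..k} = \<beta> ` {1..k}"
    by (intro image_cong; simp add: \<alpha>'_def \<beta>'_def)+
  have new: "\<alpha>' (Suc k) = x" "\<beta>' (Suc k) = y" by (simp_all add: \<alpha>'_def \<beta>'_def)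
  have "f ` {1..Suc k} = insert (f (Suc k)) (f ` {1..k})" for f :: "nat \<Rightarrow> nat"
    by (subst set) (rule image_insert)
  from this[of \<alpha>'] this[of \<beta>'] have im: "\<alpha>' ` {1..Suc k} = insert x (\<alpha> ` {1..k})" "\<beta>' ` {1..Suc k} = insert y (\<beta> ` {1..k})"
    by (simp_all only: old new)
  have "inj_on \<alpha>' {1..k}" "inj_on \<beta>' {1..k}"
    using IH(1,2) inj_on_cong[of "{1..k}" \<alpha>' \<alpha>] inj_on_cong[of "{1..k}" \<beta>' \<beta>]
    by (simp_all only: \<alpha>'_def \<beta>'_def) simp_all
  moreover have "\<alpha>' (Suc k) \<notin> \<alpha>' ` {1..k}" "\<beta>' (Suc k) \<notin> \<beta>' ` {1..k}"
    unfolding old new using xy(1,2) unfolding IH(5) by blast+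
  ultimately have "inj_on \<alpha>' {1..Suc k}" "inj_on \<beta>' {1..Suc k}"
    unfolding set inj_on_insert by blast+
  moreover have "adj (\<alpha>' i) (\<beta>' i)" if "i \<in> {1..Suc k}" for i
    using that IH(6)[of i] xy(3) by (cases "i = Suc k") (simp_all add: \<alpha>'_def \<beta>'_def)
  moreover have "j \<le> i" if ij: "i \<in> {1..Suc k}" "j \<in> {1..Suc k}" "adj (\<alpha>' i) (\<beta>' j)" for i j
  proof (cases "i = Suc k")
    case False
    then have i: "i \<in> {1..k}" using ij by auto
    have "j \<noteq> Suc k"
    proof
      assume "j = Suc k"
      then have "adj (\<alpha> i) y" using ij(3) False by (simp add: \<alpha>'_def \<beta>'_def)
      then show False using xy(2) i by (auto simp: nb_def)
    qed
    then show ?thesis using IH(7)[OF i, of j] ij False by (simp add: \<alpha>'_def \<beta>'_def)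
  qed (use ij in auto)
  moreover have "insert x (\<alpha> ` {1..k}) \<subseteq> {1..n}" using IH(3) xy(1) by blast
  ultimately have "good_labelling (Suc k) \<alpha>' \<beta>'"
    unfolding good_labelling_def im xy(4,5) IH(5) by blast
  then show ?case by blast
qed

theorem comes_from_poset: "\<exists>r. comes_from n E r"
proof -
  obtain \<alpha> \<beta> where "good_labelling n \<alpha> \<beta>" using labelling[of n] by blast
  then have inj: "inj_on \<alpha> {1..n}" "inj_on \<beta> {1..n}" and sub: "\<alpha> ` {1..n} \<subseteq> {1..n}"
    and nb: "nb (\<alpha> ` {1..n}) = \<beta> ` {1..n}"
    and diag: "\<And>i. i \<in> {1..n} \<Longrightarrow> adj (\<alpha> i) (\<beta> i)"
    and le: "\<And>i j. i \<in> {1..n} \<Longrightarrow> j \<in> {1..n} \<Longrightarrow> adj (\<alpha> i) (\<beta> j) \<Longrightarrow> j \<le> i"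
    unfolding good_labelling_def by blast+
  have \<alpha>: "\<alpha> ` {1..n} = {1..n}" using inj(1) sub by (simp add: endo_inj_surj)
  have \<beta>: "\<beta> ` {1..n} = {1..n}" using inj(2) nb_sub nb by (metis endo_inj_surj finite_atLeastAtMost)
  \<comment> \<open>Right vertices play the role of the x_i here, since an edge between \<alpha> j
    and \<beta> i forces i \<le> j; this is why \<phi> below exchanges the two sides.\<close>
  define r where "r = {(i, j). i \<in> {1..n} \<and> j \<in> {1..n} \<and> adj (\<alpha> j) (\<beta> i)}"
  have card_pre: "card {l \<in> {1..n}. \<gamma> l \<in> U} = card U"
    if \<gamma>: "inj_on \<gamma> {1..n}" "\<gamma> ` {1..n} = {1..n}" "U \<subseteq> {1..n}" for \<gamma> U
  proof -
    have "U = \<gamma> ` {l \<in> {1..n}. \<gamma> l \<in> U}"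
    proof
      show "U \<subseteq> \<gamma> ` {l \<in> {1..n}. \<gamma> l \<in> U}"
      proof
        fix u assume u: "u \<in> U"
        then have "u \<in> \<gamma> ` {1..n}" unfolding \<gamma>(2) using \<gamma>(3) by blast
        then show "u \<in> \<gamma> ` {l \<in> {1..n}. \<gamma> l \<in> U}" using u by blast
      qed
    qed blast
    moreover have "inj_on \<gamma> {l \<in> {1..n}. \<gamma> l \<in> U}"
      using \<gamma>(1) by (rule inj_on_subset) blast
    ultimately show ?thesis using card_image by metis
  qed
  \<comment> \<open>Apply \<open>card_cl\<close> to the single vertex \<alpha> k. By the diagonal
    edges, the labels l with nb {\<alpha> l} \<subseteq> nb {\<alpha> k} are among those with
    \<beta> l in nb {\<alpha> k}; as they are equally many, j belongs to the former, and the
    neighbour \<beta> i of \<alpha> j is one of \<alpha> k.\<close>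
  have trans: "adj (\<alpha> k) (\<beta> i)"
    if ijk: "i \<in> {1..n}" "j \<in> {1..n}" "k \<in> {1..n}" "adj (\<alpha> j) (\<beta> i)" "adj (\<alpha> k) (\<beta> j)" for i j k
  proof -
    let ?A = "{\<alpha> k}"
    have A: "?A \<subseteq> {1..n}" using ijk(3) sub by blast
    define S where "S = {l \<in> {1..n}. \<alpha> l \<in> cl ?A}"
    define T where "T = {l \<in> {1..n}. \<beta> l \<in> nb ?A}"
    have "S \<subseteq> T" using diag by (auto simp: S_def T_def cl_def nb_def)
    moreover have "card S = card (cl ?A)" unfolding S_def by (rule card_pre[OF inj(1) \<alpha> cl_sub])
    moreover have "card T = card (nb ?A)" unfolding T_def by (rule card_pre[OF inj(2) \<beta> nb_sub])
    ultimately have "S = T"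
      using card_cl[OF A] by (intro card_seteq) (auto simp: T_def)
    moreover have "j \<in> T" using ijk by (simp add: T_def nb_def)
    ultimately have "nb {\<alpha> j} \<subseteq> nb ?A" by (auto simp: S_def cl_def)
    then show ?thesis using ijk(4) by (auto simp: nb_def)
  qed
  have r_le: "i \<le> j" if "(i, j) \<in> r" for i j using that le[of j i] by (simp add: r_def)
  have "partial_order_on {1..n} r"
    unfolding partial_order_on_def preorder_on_def
  proof (intro conjI)
    show "r \<subseteq> {1..n} \<times> {1..n}" by (auto simp: r_def)
    show "refl_on {1..n} r" using diag by (auto simp: refl_on_def r_def)
    show "trans r" using trans by (auto simp: trans_def r_def)
    show "antisym r" using r_le by (meson antisymI order_antisym)
  qed
  then have lab: "labelled_poset n r" using r_le by (auto simp: labelled_poset_def)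
  define \<phi> where "\<phi> v = (case v of Xv i \<Rightarrow> Yv (\<beta> i) | Yv i \<Rightarrow> Xv (\<alpha> i))" for v
  have "bij_betw \<phi> (vertices n) (vertices n)"
    unfolding bij_betw_def
  proof
    show "inj_on \<phi> (vertices n)"
    proof (rule inj_onI)
      fix v w assume vw: "v \<in> vertices n" "w \<in> vertices n" "\<phi> v = \<phi> w"
      have mem: "Xv i \<in> vertices n \<longleftrightarrow> i \<in> {1..n}" "Yv i \<in> vertices n \<longleftrightarrow> i \<in> {1..n}" for i
        by (auto simp: vertices_def)
      show "v = w"
      proof (cases v)
        case (Xv i)
        then show ?thesis
          using vw inj_onD[OF inj(2), of i] by (cases w) (simp_all add: \<phi>_def mem)
      next
        case (Yv i)
        then show ?thesis
          using vw inj_onD[OF inj(1), of i] by (cases w) (simp_all add: \<phi>_def mem)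
      qed
    qed
    show "\<phi> ` vertices n = vertices n"
      unfolding vertices_def image_Un image_image \<phi>_def
      by (simp only: vertex.case image_image[of Xv \<alpha>, symmetric] image_image[of Yv \<beta>, symmetric] \<alpha> \<beta> Un_commute)
  qed
  moreover have "E = (\<lambda>e. \<phi> ` e) ` poset_graph n r"
  proof (intro equalityI subsetI)
    fix e assume "e \<in> E"
    then obtain a b where ab: "e = {Xv a, Yv b}" "adj a b" "a \<in> {1..n}" "b \<in> {1..n}"
      using edge_form by blast
    obtain i j where ij: "a = \<alpha> j" "b = \<beta> i" "i \<in> {1..n}" "j \<in> {1..n}"
      using ab(3,4) \<alpha> \<beta> by (metis imageE)
    have "{Xv i, Yv j} \<in> poset_graph n r" using ij ab(2) by (auto simp: poset_graph_def r_def)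
    moreover have "e = \<phi> ` {Xv i, Yv j}" using ab ij by (simp add: \<phi>_def insert_commute)
    ultimately show "e \<in> (\<lambda>e. \<phi> ` e) ` poset_graph n r" by blast
  next
    fix e assume "e \<in> (\<lambda>e. \<phi> ` e) ` poset_graph n r"
    then obtain i j where "(i, j) \<in> r" "e = \<phi> ` {Xv i, Yv j}" by (auto simp: poset_graph_def)
    then show "e \<in> E" by (auto simp: \<phi>_def r_def adj_def insert_commute)
  qed
  ultimately show ?thesis using lab unfolding comes_from_def by blast
qed

end

theorem cohen_macaulay_comes_from_poset:
  assumes bip: "bipartite_graph n E" and CM: "cohen_macaulay_graph TYPE('k::field) (vertices n) E"
  shows "\<exists>r. comes_from n E r"
proof -
  let ?R = "mpoly_ring (vertices n) :: (vertex, 'k) mpoly ring"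
  have edge: "e \<subseteq> vertices n \<and> e \<noteq> {}" if e: "e \<in> E" for e
  proof -
    obtain i j where "e = {Xv i, Yv j}" "i \<in> {1..n}" "j \<in> {1..n}"
      using bipartite_graph_edge[OF bip e] by blast
    then show ?thesis by (auto simp: vertices_def)
  qed
  interpret edge_ring "vertices n" E ?R
    by unfold_locales (use edge finite_vertices in auto)
  have Q: "cohen_macaulay_ring (?R Quot edge_ideal (vertices n) E)"
    using CM by (simp only: cohen_macaulay_graph_def)
  have ne: "e \<noteq> {}" if "e \<in> E" for e using edge[OF that] by blast
  interpret cohen_macaulay_bipartite n E independent
  proof
    show "bipartite_graph n E" by (rule bip)
    show "independent F \<longleftrightarrow> F \<subseteq> vertices n \<and> (\<forall>e\<in>E. \<not> e \<subseteq> F)" for F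
      by (rule independent_def)
  qed (rule cohen_macaulay_facet[OF Q ne] cohen_macaulay_link[OF Q ne]; assumption)+
  show ?thesis by (rule comes_from_poset)
qed

section \<open>Level functions on words\<close>

text \<open>A strict linear order, by decreasing level and then by decreasing label. An ascent of
  labels therefore forces a strict drop of the level.\<close>

definition nonincr_step :: "('a::linorder \<Rightarrow> nat) \<Rightarrow> 'a \<Rightarrow> 'a \<Rightarrow> bool" where
  "nonincr_step w x y \<longleftrightarrow> w y < w x \<or> (w y = w x \<and> y < x)"

lemma nonincr_step_trans: "nonincr_step w x y \<Longrightarrow> nonincr_step w y z \<Longrightarrow> nonincr_step w x z"
  by (auto simp: nonincr_step_def)

lemma sorted_wrt_nonincr_step_unique:
  assumes "sorted_wrt (nonincr_step w) xs" "sorted_wrt (nonincr_step w) ys" "set xs = set ys"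
  shows "xs = ys"
  using assms
proof (induction xs arbitrary: ys)
  case (Cons x xs)
  then obtain y ys' where ys: "ys = y # ys'" by (cases ys) auto
  have "x = y"
  proof (rule ccontr)
    assume "x \<noteq> y"
    then have "x \<in> set ys'" "y \<in> set xs" using Cons.prems(3) ys by auto
    then have "nonincr_step w x y" "nonincr_step w y x" using Cons.prems ys by auto
    then show False by (auto simp: nonincr_step_def)
  qed
  moreover have "x \<notin> set xs" "y \<notin> set ys'"
    using Cons.prems ys by (auto simp: nonincr_step_def)
  ultimately have "set xs = set ys'" using Cons.prems(3) ys by (auto simp: insert_eq_iff)
  then show ?case using Cons.IH[of ys'] Cons.prems ys \<open>x = y\<close> by simp
qed simp

lemma sorted_wrt_nonincr_step_distinct: "sorted_wrt (nonincr_step w) xs \<Longrightarrow> distinct xs"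
  by (induction xs) (auto simp: nonincr_step_def)

lemma sorted_wrt_nonincr_step_exists:
  "finite T \<Longrightarrow> \<exists>xs. set xs = T \<and> sorted_wrt (nonincr_step w) xs"
proof (induction "card T" arbitrary: T)
  case (Suc m)
  then have "T \<noteq> {}" by auto
  define M where "M = Max (w ` T)"
  define t where "t = Max {t \<in> T. w t = M}"
  have "M \<in> w ` T" unfolding M_def using Suc.prems \<open>T \<noteq> {}\<close> by (intro Max_in) auto
  then have "t \<in> {t \<in> T. w t = M}" unfolding t_def using Suc.prems by (intro Max_in) auto
  then have t: "t \<in> T" "w t = M" by auto
  have max: "nonincr_step w t s" if "s \<in> T" "s \<noteq> t" for s
  proof -
    have "w s \<le> M" unfolding M_def using that Suc.prems by auto
    moreover have "s \<le> t" if "w s = M" unfolding t_def using that \<open>s \<in> T\<close> Suc.prems by auto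
    ultimately show ?thesis using t that by (auto simp: nonincr_step_def)
  qed
  obtain xs where "set xs = T - {t}" "sorted_wrt (nonincr_step w) xs"
    using Suc.hyps(1)[of "T - {t}"] Suc.hyps(2) Suc.prems t by fastforce
  then have "set (t # xs) = T" "sorted_wrt (nonincr_step w) (t # xs)" using t max by auto
  then show ?case by blast
qed (use card_eq_0_iff in \<open>auto\<close>)

text \<open>The least level that \<open>x\<close> may have in front of the given word.\<close>

fun next_level :: "('a::linorder \<Rightarrow> nat) \<Rightarrow> 'a \<Rightarrow> 'a list \<Rightarrow> nat" where
  "next_level w x [] = 0"
| "next_level w x (y # ys) = w y + of_bool (x < y)"

fun ascents :: "'a::linorder list \<Rightarrow> nat" where
  "ascents (x # y # xs) = of_bool (x < y) + ascents (y # xs)"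
| "ascents _ = 0"

text \<open>As in the theory of P-partitions, \<open>g x\<close> is the excess of the level of x
  over its least possible value. By \<open>sorted_wrt_levels\<close>, \<open>levels_inj\<close> and
  \<open>levels_surj\<close>, these coordinates parametrize the level functions that sort the
  word.\<close>

fun levels :: "('a::linorder \<Rightarrow> nat) \<Rightarrow> 'a list \<Rightarrow> 'a \<Rightarrow> nat" where
  "levels g [] = (\<lambda>_. 0)"
| "levels g (x # xs) = (levels g xs)(x := g x + next_level (levels g xs) x xs)"

lemma next_level_cong: "(\<And>y. y \<in> set ys \<Longrightarrow> w y = w' y) \<Longrightarrow> next_level w x ys = next_level w' x ys"
  by (cases ys) auto

lemma sorted_wrt_levels:
  "distinct xs \<Longrightarrow> sorted_wrt (nonincr_step (levels g xs)) xs"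
proof (induction xs)
  case (Cons x xs)
  let ?w = "levels g xs" and ?w' = "levels g (x # xs)"
  have eq: "?w' y = ?w y" if "y \<in> set xs" for y using that Cons.prems by auto
  have tail: "sorted_wrt (nonincr_step ?w') xs"
  proof (rule sorted_wrt_mono_rel)
    show "sorted_wrt (nonincr_step ?w) xs" using Cons by auto
  qed (simp add: nonincr_step_def eq del: levels.simps)
  show ?case
  proof (cases xs)
    case (Cons y ys)
    have "x \<noteq> y" "y \<in> set xs" using Cons.prems Cons by auto
    then have "nonincr_step ?w' x y"
      using eq[of y] Cons by (auto simp: nonincr_step_def)
    then show ?thesis using tail Cons nonincr_step_trans by (fastforce simp del: levels.simps)
  qed simp
qed simp

text \<open>The differences telescope along the word. With 0 in front, this is where the number of
  ascents becomes the shift of the cone.\<close>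

lemma levels_hd: "xs \<noteq> [] \<Longrightarrow> levels g xs (hd xs) = ascents xs + sum_list (map g xs)"
proof (induction xs)
  case (Cons x xs)
  then show ?case by (cases xs) auto
qed simp

lemma levels_inj:
  assumes "distinct xs" "\<And>x. x \<in> set xs \<Longrightarrow> levels g xs x = levels g' xs x" "x \<in> set xs"
  shows "g x = g' x"
  using assms
proof (induction xs arbitrary: x)
  case (Cons y ys)
  have eq: "levels g ys z = levels g' ys z" if "z \<in> set ys" for z
  proof -
    have "z \<noteq> y" using that Cons.prems(1) by auto
    then show ?thesis using Cons.prems(2)[of z] that by simp
  qed
  have "g y = g' y"
    using Cons.prems(2)[of y] next_level_cong[of ys "levels g ys" "levels g' ys" y] eq by simp
  then show ?case using Cons eq by auto
qed simp

lemma levels_cong: "(\<And>x. x \<in> set xs \<Longrightarrow> g x = g' x) \<Longrightarrow> levels g xs = levels g' xs"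
  by (induction xs) auto

lemma levels_surj:
  assumes "sorted_wrt (nonincr_step w) xs"
  shows "\<exists>g. \<forall>x\<in>set xs. levels g xs x = w x"
  using assms
proof (induction xs)
  case (Cons x xs)
  then obtain g where g: "\<forall>y\<in>set xs. levels g xs y = w y" by auto
  have notin: "x \<notin> set xs" using Cons.prems by (auto simp: nonincr_step_def)
  \<comment> \<open>The subtraction is exact: sortedness gives
    \<open>next_level w x xs \<le> w x\<close>.\<close>
  define g' where "g' = g(x := w x - next_level w x xs)"
  have lev: "levels g' xs = levels g xs" using notin by (intro levels_cong) (auto simp: g'_def)
  have "next_level w x xs \<le> w x"
    using Cons.prems by (cases xs) (auto simp: nonincr_step_def)
  moreover have "next_level (levels g xs) x xs = next_level w x xs"
    using g by (intro next_level_cong) auto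
  ultimately have "levels g' (x # xs) x = w x" using lev by (simp add: g'_def)
  moreover have "\<forall>y\<in>set xs. levels g' (x # xs) y = w y" using g lev notin by auto
  ultimately show ?case by (intro exI[of _ g']) auto
qed simp

section \<open>Weak compositions and their generating function\<close>

definition compositions :: "nat set \<Rightarrow> nat \<Rightarrow> (nat \<Rightarrow> nat) set" where
  "compositions I d = {g. (\<forall>i. i \<notin> I \<longrightarrow> g i = 0) \<and> sum g I = d}"

lemma finite_compositions:
  assumes I: "finite I"
  shows "finite (compositions I d)"
proof (rule finite_subset)
  show "compositions I d \<subseteq> {g. \<forall>i. (i \<in> I \<longrightarrow> g i \<in> {..d}) \<and> (i \<notin> I \<longrightarrow> g i = 0)}"
    using member_le_sum[OF _ _ I] by (auto simp: compositions_def)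
  show "finite {g. \<forall>i. (i \<in> I \<longrightarrow> g i \<in> {..d}) \<and> (i \<notin> I \<longrightarrow> g i = (0::nat))}"
    using I by (intro finite_set_of_finite_funs) auto
qed

text \<open>Pascal's rule: either g i = 0, or one unit can be taken from g i.\<close>

lemma card_compositions_Suc:
  assumes I: "finite I" and i: "i \<notin> I"
  shows "card (compositions (insert i I) (Suc d)) =
    card (compositions (insert i I) d) + card (compositions I (Suc d))"
proof -
  let ?A = "{g \<in> compositions (insert i I) (Suc d). g i = 0}"
  let ?B = "{g \<in> compositions (insert i I) (Suc d). g i > 0}"
  have sum_upd: "sum (g(i := x)) (insert i I) = x + sum g I" for g and x :: nat
  proof -
    have "sum (g(i := x)) I = sum g I" using i by (intro sum.cong) auto
    then show ?thesis using I i by simp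
  qed
  have "card (compositions (insert i I) (Suc d)) = card (?A \<union> ?B)"
    by (rule arg_cong[of _ _ card]) auto
  also have "\<dots> = card ?A + card ?B"
    using finite_compositions[of "insert i I"] I by (intro card_Un_disjoint) auto
  finally have "card (compositions (insert i I) (Suc d)) = card ?A + card ?B" .
  moreover have "?A = compositions I (Suc d)"
    unfolding compositions_def using I i by (auto, metis)
  moreover have "bij_betw (\<lambda>g. g(i := Suc (g i))) (compositions (insert i I) d) ?B"
  proof (rule bij_betw_byWitness[where f' = "\<lambda>g. g(i := g i - 1)"])
    show "(\<lambda>g. g(i := Suc (g i))) ` compositions (insert i I) d \<subseteq> ?B"
      using I i sum_upd by (auto simp: compositions_def)
    show "(\<lambda>g. g(i := g i - 1)) ` ?B \<subseteq> compositions (insert i I) d"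
      using I i sum_upd by (auto simp: compositions_def)
  qed auto
  then have "card ?B = card (compositions (insert i I) d)" by (simp add: bij_betw_same_card)
  ultimately show ?thesis by simp
qed

lemma compositions_series:
  assumes "finite I"
  shows "Abs_fps (\<lambda>d. int (card (compositions I d))) * (1 - fps_X) ^ card I = 1"
  using assms
proof (induction I)
  case empty
  have "compositions {} d = (if d = 0 then {\<lambda>_. 0} else {})" for d
    by (auto simp: compositions_def)
  then show ?case by (simp add: fps_eq_iff)
next
  case (insert i I)
  let ?F = "\<lambda>I. Abs_fps (\<lambda>d. int (card (compositions I d)))"
  have "?F (insert i I) * (1 - fps_X) = ?F I"
  proof (rule fps_ext)
    fix d
    show "fps_nth (?F (insert i I) * (1 - fps_X)) d = fps_nth (?F I) d"
    proof (cases d)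
      case 0
      have "compositions (insert i I) 0 = compositions I 0"
        using insert by (force simp: compositions_def)
      then show ?thesis using 0 by (simp add: algebra_simps)
    next
      case (Suc e)
      then show ?thesis
        using insert card_compositions_Suc[of I i e] by (simp add: algebra_simps)
    qed
  qed
  then show ?case using insert by (simp add: mult.assoc[symmetric])
qed

lemma sorted_wrt_either:
  "sorted_wrt P xs \<Longrightarrow> x \<in> set xs \<Longrightarrow> y \<in> set xs \<Longrightarrow> x \<noteq> y \<Longrightarrow> P x y \<or> P y x"
  by (induction xs) auto

section \<open>Words of a poset and the ascent count\<close>

definition poset_words :: "nat \<Rightarrow> (nat \<times> nat) set \<Rightarrow> nat list set" where
  "poset_words n r =
     {p. set p \<subseteq> {1..n} \<and> distinct p \<and> sorted_wrt (\<lambda>x y. (y, x) \<notin> r) p}"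

lemma finite_poset_words: "finite (poset_words n r)"
  by (rule finite_subset[OF _ finite_subset_distinct[of "{1..n}"]]) (auto simp: poset_words_def)

definition word_count :: "nat \<Rightarrow> (nat \<times> nat) set \<Rightarrow> nat \<Rightarrow> nat" where
  "word_count n r j = card {p \<in> poset_words n r. ascents (0 # p) = j}"

lemma word_count_antimono: "r \<subseteq> r' \<Longrightarrow> word_count n r' j \<le> word_count n r j"
  unfolding word_count_def
  by (intro card_mono finite_Collect_conjI disjI1)
    (use finite_poset_words in \<open>auto simp: poset_words_def elim: sorted_wrt_mono_rel[rotated]\<close>)

lemma ascents_strict_sorted: "sorted_wrt (<) (x # xs) \<Longrightarrow> ascents (x # xs) = length xs"
  by (induction xs arbitrary: x) auto

text \<open>The labelling is natural, so the increasing word on a j-element set is a linear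
  extension; with 0 in front, all its j steps are ascents.\<close>

lemma word_count_ge_binomial:
  assumes r: "\<And>i j. (i, j) \<in> r \<Longrightarrow> i \<le> j"
  shows "n choose j \<le> word_count n r j"
proof -
  let ?A = "{A. A \<subseteq> {1..n} \<and> card A = j}"
  have "inj_on sorted_list_of_set ?A"
  proof (rule inj_onI)
    fix A B assume "A \<in> ?A" "B \<in> ?A" and eq: "sorted_list_of_set A = sorted_list_of_set B"
    then have "finite A" "finite B" using finite_subset by auto
    then show "A = B" using eq set_sorted_list_of_set by metis
  qed
  moreover have "sorted_list_of_set ` ?A \<subseteq> {p \<in> poset_words n r. ascents (0 # p) = j}"
  proof (intro image_subsetI CollectI conjI)
    fix A assume A: "A \<in> ?A"
    then have fin: "finite A" using finite_subset by auto
    have "sorted_wrt (\<lambda>x y. (y, x) \<notin> r) (sorted_list_of_set A)"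
      by (rule sorted_wrt_mono_rel[OF _ strict_sorted_list_of_set]) (use r in force)
    then show "sorted_list_of_set A \<in> poset_words n r"
      using A fin by (auto simp: poset_words_def)
    have "sorted_wrt (<) (0 # sorted_list_of_set A)"
      using A fin by auto
    then show "ascents (0 # sorted_list_of_set A) = j"
      using A by (subst ascents_strict_sorted) auto
  qed
  ultimately have "card ?A \<le> word_count n r j"
    unfolding word_count_def using finite_poset_words by (intro card_inj_on_le) auto
  then show ?thesis by (simp add: n_subsets)
qed

section \<open>Vertex covers of poset graphs\<close>

declare levels.simps(2) [simp del]

text \<open>\<phi> may mix the two sides of the bipartition, so vertices are addressed as
  \<open>xi i\<close> and \<open>eta i\<close>, the images of x_i and y_i.\<close>

locale poset_graph_labelling =
  fixes n :: nat and E :: "vertex set set" and r :: "(nat \<times> nat) set"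
    and \<phi> :: "vertex \<Rightarrow> vertex"
  assumes po: "partial_order_on {1..n} r"
    and natural: "(i, j) \<in> r \<Longrightarrow> i \<le> j"
    and bij: "bij_betw \<phi> (vertices n) (vertices n)"
    and edges: "E = (\<lambda>e. \<phi> ` e) ` poset_graph n r"
begin

abbreviation xi :: "nat \<Rightarrow> vertex" where "xi i \<equiv> \<phi> (Xv i)"
abbreviation eta :: "nat \<Rightarrow> vertex" where "eta i \<equiv> \<phi> (Yv i)"

lemma r_dom: "(i, j) \<in> r \<Longrightarrow> i \<in> {1..n} \<and> j \<in> {1..n}"
  using po by (auto simp: partial_order_on_def preorder_on_def)

lemma r_refl: "i \<in> {1..n} \<Longrightarrow> (i, i) \<in> r"
  using po by (auto simp: partial_order_on_def preorder_on_def dest: refl_onD)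

lemma r_trans: "(i, j) \<in> r \<Longrightarrow> (j, k) \<in> r \<Longrightarrow> (i, k) \<in> r"
  using po by (auto simp: partial_order_on_def preorder_on_def dest: transD)

lemma finite_below: "finite {j. (j, i) \<in> r}"
  by (rule finite_subset[of _ "{1..n}"]) (use r_dom in blast)+

lemma vertices_eq: "vertices n = xi ` {1..n} \<union> eta ` {1..n}"
  using bij_betw_imp_surj_on[OF bij] by (simp add: vertices_def image_Un image_image)

lemma xi_inj: "i \<in> {1..n} \<Longrightarrow> j \<in> {1..n} \<Longrightarrow> xi i = xi j \<longleftrightarrow> i = j"
  and eta_inj: "i \<in> {1..n} \<Longrightarrow> j \<in> {1..n} \<Longrightarrow> eta i = eta j \<longleftrightarrow> i = j"
  and xi_neq_eta: "i \<in> {1..n} \<Longrightarrow> j \<in> {1..n} \<Longrightarrow> xi i \<noteq> eta j"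
  using inj_on_eq_iff[OF bij_betw_imp_inj_on[OF bij]] by (auto simp: vertices_def)

lemma E_eq: "E = (\<lambda>(i, j). {xi i, eta j}) ` r"
proof -
  have "poset_graph n r = (\<lambda>(i, j). {Xv i, Yv j}) ` r"
    unfolding poset_graph_def using r_dom by force
  then show ?thesis unfolding edges by (simp add: image_image case_prod_unfold)
qed

lemma edge_iff:
  "{v, w} \<in> E \<longleftrightarrow> (\<exists>i j. (i, j) \<in> r \<and> (v = xi i \<and> w = eta j \<or> v = eta j \<and> w = xi i))"
  unfolding E_eq by (simp add: doubleton_eq_iff image_iff Bex_def split_paired_Ex)

lemma cover_iff:
  "vertex_cover_vector n E k c \<longleftrightarrow> Poly_Mapping.keys c \<subseteq> vertices n \<and>
     (\<forall>(i, j)\<in>r. k \<le> Poly_Mapping.lookup c (xi i) + Poly_Mapping.lookup c (eta j))"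
proof -
  have "(\<forall>v w. {v, w} \<in> E \<longrightarrow> k \<le> Poly_Mapping.lookup c v + Poly_Mapping.lookup c w) \<longleftrightarrow>
      (\<forall>i j. (i, j) \<in> r \<longrightarrow>
        k \<le> Poly_Mapping.lookup c (xi i) + Poly_Mapping.lookup c (eta j))"
    unfolding edge_iff by (metis add.commute)
  then show ?thesis unfolding vertex_cover_vector_def by auto
qed

lemma sum_vertices: "(\<Sum>v\<in>vertices n. f v) = (\<Sum>i=1..n. f (xi i) + f (eta i))"
proof -
  have "(\<Sum>v\<in>vertices n. f v) = sum f (xi ` {1..n}) + sum f (eta ` {1..n})"
    unfolding vertices_eq using xi_neq_eta by (intro sum.union_disjoint) auto
  also have "\<dots> = (\<Sum>i=1..n. f (xi i)) + (\<Sum>i=1..n. f (eta i))"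
    using xi_inj eta_inj by (simp add: sum.reindex inj_on_def)
  finally show ?thesis by (simp add: sum.distrib)
qed

definition exponent :: "(nat \<Rightarrow> nat) \<Rightarrow> (nat \<Rightarrow> nat) \<Rightarrow> vertex \<Rightarrow>\<^sub>0 nat" where
  "exponent a b =
     (\<Sum>i=1..n. Poly_Mapping.single (xi i) (a i) + Poly_Mapping.single (eta i) (b i))"

lemma lookup_exponent:
  assumes "i \<in> {1..n}"
  shows "Poly_Mapping.lookup (exponent a b) (xi i) = a i"
    and "Poly_Mapping.lookup (exponent a b) (eta i) = b i"
proof -
  have *: "(\<Sum>j = 1..n. f j when j = i) = (f i :: nat)" for f
    using assms by (simp add: when_def)
  have "Poly_Mapping.lookup (exponent a b) (xi i) = (\<Sum>j=1..n. a j when j = i)"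
    unfolding exponent_def lookup_sum 
    using assms xi_inj[OF _ assms] xi_neq_eta[OF assms, symmetric]
    by (intro sum.cong) (auto simp: lookup_add lookup_single when_def)
  then show "Poly_Mapping.lookup (exponent a b) (xi i) = a i" using * by simp
  have "Poly_Mapping.lookup (exponent a b) (eta i) = (\<Sum>j=1..n. b j when j = i)"
    unfolding exponent_def lookup_sum 
    using assms eta_inj[OF _ assms] xi_neq_eta[OF _ assms]
    by (intro sum.cong) (auto simp: lookup_add lookup_single when_def)
  then show "Poly_Mapping.lookup (exponent a b) (eta i) = b i" using * by simp
qed

lemma keys_exponent: "Poly_Mapping.keys (exponent a b) \<subseteq> vertices n"
proof
  fix v assume v: "v \<in> Poly_Mapping.keys (exponent a b)"
  show "v \<in> vertices n"
  proof (rule ccontr)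
    assume "v \<notin> vertices n"
    then have "Poly_Mapping.lookup (exponent a b) v = 0"
      unfolding exponent_def lookup_sum vertices_eq
      by (intro sum.neutral) (auto simp: lookup_add lookup_single when_def)
    then show False using v by (simp add: in_keys_iff)
  qed
qed

lemma exponent_eqI:
  assumes "Poly_Mapping.keys c \<subseteq> vertices n"
    and "\<And>i. i \<in> {1..n} \<Longrightarrow> Poly_Mapping.lookup c (xi i) = a i"
    and "\<And>i. i \<in> {1..n} \<Longrightarrow> Poly_Mapping.lookup c (eta i) = b i"
  shows "c = exponent a b"
proof (rule poly_mapping_eqI)
  fix v
  show "Poly_Mapping.lookup c v = Poly_Mapping.lookup (exponent a b) v"
  proof (cases "v \<in> vertices n")
    case True
    then show ?thesis unfolding vertices_eq using assms lookup_exponent by auto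
  next
    case False
    then have "v \<notin> Poly_Mapping.keys c" "v \<notin> Poly_Mapping.keys (exponent a b)"
      using assms(1) keys_exponent by auto
    then show ?thesis by (simp add: in_keys_iff)
  qed
qed

text \<open>The exponents of the degree-d monomials of A(G). A generator m_C t has degree 1 but
  contains n variables, so the degree is the exponent sum plus k minus n k; the equation is arranged
  to avoid subtraction.\<close>

definition covers :: "nat \<Rightarrow> ((vertex \<Rightarrow>\<^sub>0 nat) \<times> nat) set" where
  "covers d = {(c, k). vertex_cover_vector n E k c \<and>
     (\<Sum>v\<in>vertices n. Poly_Mapping.lookup c v) + k = d + n * k}"

text \<open>Extends the levels of the letters of \<open>p\<close> to an order-reversing function;
  the letter 0 supplies the cap k.\<close>

definition word_level :: "nat list \<Rightarrow> (nat \<Rightarrow> nat) \<Rightarrow> nat \<Rightarrow> nat" where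
  "word_level p l i = Min (l ` insert 0 {t \<in> set p. (t, i) \<in> r})"

text \<open>
  Of the \<open>2n + 1\<close> coordinates \<open>g\<close> of a point in the cone of the word \<open>p\<close>, those at \<open>0\<close> and at the
  letters of \<open>p\<close> are the excesses of the descents of the levels along \<open>0p\<close> over their least possible
  values, those at the other \<open>i \<le> n\<close> are extra powers of \<open>x\<^sub>i\<close>, and \<open>g (n + i)\<close> is an extra power of
  \<open>y\<^sub>i\<close>.
\<close>

definition cover_of :: "nat list \<Rightarrow> (nat \<Rightarrow> nat) \<Rightarrow> (vertex \<Rightarrow>\<^sub>0 nat) \<times> nat" where
  "cover_of p g = (let l = levels g (0 # p); w = word_level p l in
     (exponent (\<lambda>i. w i + (if i \<in> set p then 0 else g i)) (\<lambda>i. l 0 - w i + g (n + i)), l 0))"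

context
  fixes p :: "nat list" and g :: "nat \<Rightarrow> nat"
  assumes p: "p \<in> poset_words n r"
begin

private abbreviation "l \<equiv> levels g (0 # p)"
private abbreviation "w \<equiv> word_level p l"

lemma word_set: "set p \<subseteq> {1..n}" "distinct p" "distinct (0 # p)"
  using p by (auto simp: poset_words_def)

lemma word_sorted: "sorted_wrt (nonincr_step l) (0 # p)"
  using word_set sorted_wrt_levels by blast

lemma level_less_top: "t \<in> set p \<Longrightarrow> l t < l 0"
  using word_sorted by (auto simp: nonincr_step_def)

text \<open>The word has s before t, and s < t as labels because the labelling is natural. A tie
  would require decreasing labels.\<close>

lemma level_strict:
  assumes st: "s \<in> set p" "t \<in> set p" "(s, t) \<in> r" "s \<noteq> t"
  shows "l t < l s"
proof -
  have srt: "sorted_wrt (nonincr_step l) p" "sorted_wrt (\<lambda>x y. (y, x) \<notin> r) p"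
    using word_sorted p by (auto simp: poset_words_def)
  have "sorted_wrt (\<lambda>x y. nonincr_step l x y \<and> (y, x) \<notin> r) p"
    using srt by (simp add: sorted_wrt_iff_nth_less)
  from sorted_wrt_either[OF this st(1,2,4)] have "nonincr_step l s t" using st(3) by blast
  then show ?thesis using natural[OF st(3)] st(4) by (auto simp: nonincr_step_def)
qed

lemma word_level_attained: "w i = l 0 \<or> (\<exists>t\<in>set p. (t, i) \<in> r \<and> w i = l t)"
proof -
  have "w i \<in> l ` insert 0 {t \<in> set p. (t, i) \<in> r}"
    unfolding word_level_def by (intro Min_in) auto
  then show ?thesis by blast
qed

lemma word_level_le_level: "t \<in> set p \<Longrightarrow> (t, i) \<in> r \<Longrightarrow> w i \<le> l t"
  unfolding word_level_def by (intro Min_le) (auto)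

lemma word_level_le_top: "w i \<le> l 0"
  unfolding word_level_def by (intro Min_le) (auto)

lemma word_level_antimono: "(i, j) \<in> r \<Longrightarrow> w j \<le> w i"
  unfolding word_level_def by (intro Min_antimono) (auto dest: r_trans)

lemma word_level_eq_level:
  assumes t: "t \<in> set p"
  shows "w t = l t"
proof (rule antisym)
  show "w t \<le> l t" using t word_level_le_level r_refl word_set by blast
  show "l t \<le> w t"
    using word_level_attained[of t] level_less_top[OF t] level_strict t by (metis less_imp_le order_refl)
qed

text \<open>The letters can thus be recovered from w. A value below the cap is attained at a letter
  t below i, and strictness leaves only t = i.\<close>

lemma word_level_strict_iff:
  assumes i: "i \<in> {1..n}"
  shows "i \<in> set p \<longleftrightarrow> w i < l 0 \<and> (\<forall>j. (j, i) \<in> r \<and> j \<noteq> i \<longrightarrow> w i < w j)"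
proof
  assume ip: "i \<in> set p"
  have "w i < w j" if j: "(j, i) \<in> r" "j \<noteq> i" for j
  proof -
    consider "w j = l 0" | t where "t \<in> set p" "(t, j) \<in> r" "w j = l t"
      using word_level_attained by blast
    then show ?thesis
    proof cases
      case 2
      have "(t, i) \<in> r" using 2 j r_trans by blast
      moreover have "t \<noteq> i" using natural[OF 2(2)] natural[OF j(1)] j(2) by auto
      ultimately show ?thesis using 2 ip level_strict word_level_eq_level by simp
    qed (use ip level_less_top word_level_eq_level in simp)
  qed
  then show "w i < l 0 \<and> (\<forall>j. (j, i) \<in> r \<and> j \<noteq> i \<longrightarrow> w i < w j)"
    using ip level_less_top word_level_eq_level by simp
next
  assume R: "w i < l 0 \<and> (\<forall>j. (j, i) \<in> r \<and> j \<noteq> i \<longrightarrow> w i < w j)"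
  then obtain t where "t \<in> set p" "(t, i) \<in> r" "w i = w t"
    using word_level_attained[of i] word_level_eq_level by auto
  then show "i \<in> set p" using R by (cases "t = i") auto
qed

lemma snd_cover_of: "snd (cover_of p g) = l 0"
  by (simp add: cover_of_def Let_def)

lemma lookup_cover_of:
  assumes "i \<in> {1..n}"
  shows "Poly_Mapping.lookup (fst (cover_of p g)) (xi i) = w i + (if i \<in> set p then 0 else g i)"
    and "Poly_Mapping.lookup (fst (cover_of p g)) (eta i) = l 0 - w i + g (n + i)"
  using lookup_exponent[OF assms] by (simp_all only: cover_of_def Let_def fst_conv)

lemma cover_of_is_cover: "vertex_cover_vector n E (snd (cover_of p g)) (fst (cover_of p g))"
  unfolding cover_iff snd_cover_of
proof (intro conjI ballI, goal_cases)
  case 1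
  show ?case by (simp only: cover_of_def Let_def fst_conv keys_exponent)
next
  case (2 e)
  then obtain i j where ij: "e = (i, j)" "(i, j) \<in> r" by (cases e) auto
  have "l 0 \<le> w i + (l 0 - w j)" using word_level_antimono[OF ij(2)] by simp
  also have "\<dots> \<le> Poly_Mapping.lookup (fst (cover_of p g)) (xi i) +
      Poly_Mapping.lookup (fst (cover_of p g)) (eta j)"
    using r_dom[OF ij(2)] lookup_cover_of(1)[of i] lookup_cover_of(2)[of j] by simp
  finally show ?case using ij by simp
qed

text \<open>At each i the contributions w i and l 0 - w i add up to l 0 = k, which leaves n k plus
  the extra powers. The remaining summand l 0 is the number of ascents plus the excesses at 0 and at
  the letters, by \<open>levels_hd\<close>.\<close>

lemma degree_cover_of:
  "(\<Sum>v\<in>vertices n. Poly_Mapping.lookup (fst (cover_of p g)) v) + snd (cover_of p g) =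
     ascents (0 # p) + sum g {0..2 * n} + n * snd (cover_of p g)"
proof -
  have "(\<Sum>v\<in>vertices n. Poly_Mapping.lookup (fst (cover_of p g)) v) =
      (\<Sum>i=1..n. l 0 + (if i \<in> set p then 0 else g i) + g (n + i))"
    unfolding sum_vertices
  proof (intro sum.cong refl)
    fix i assume "i \<in> {1..n}"
    then show "Poly_Mapping.lookup (fst (cover_of p g)) (xi i) +
        Poly_Mapping.lookup (fst (cover_of p g)) (eta i) =
        l 0 + (if i \<in> set p then 0 else g i) + g (n + i)"
      using lookup_cover_of[of i] word_level_le_top[of i] by linarith
  qed
  also have "\<dots> = n * l 0 + (\<Sum>i=1..n. if i \<in> set p then 0 else g i) + (\<Sum>i=1..n. g (n + i))"
    by (simp add: sum.distrib)
  also have "(\<Sum>i=1..n. if i \<in> set p then 0 else g i) = sum g ({1..n} - set p)"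
    by (intro sum.mono_neutral_cong_right) auto
  also have "(\<Sum>i=1..n. g (n + i)) = sum g {n+1..2*n}"
    by (intro sum.reindex_bij_witness[of _ "\<lambda>i. i - n" "\<lambda>i. n + i"]) auto
  finally have 1: "(\<Sum>v\<in>vertices n. Poly_Mapping.lookup (fst (cover_of p g)) v) =
      n * l 0 + sum g ({1..n} - set p) + sum g {n+1..2*n}" .
  have "l 0 = ascents (0 # p) + (g 0 + sum g (set p))"
    using levels_hd[of "0 # p" g] word_set(2) by (simp add: sum_list_distinct_conv_sum_set)
  moreover have "sum g {0..2*n} = g 0 + sum g (set p) + sum g ({1..n} - set p) + sum g {n+1..2*n}"
  proof -
    have "{0..2*n} = insert 0 ({1..n} \<union> {n+1..2*n})" by auto
    then have "sum g {0..2*n} = g 0 + (sum g {1..n} + sum g {n+1..2*n})"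
      by (simp add: sum.union_disjoint)
    moreover have "sum g {1..n} = sum g ({1..n} - set p) + sum g (set p)"
      using word_set(1) by (intro sum.subset_diff) auto
    ultimately show ?thesis by simp
  qed
  ultimately show ?thesis using 1 snd_cover_of by simp
qed

end

text \<open>The largest order-reversing function on the poset that is bounded by k and by the
  x-exponents.\<close>

definition truncation :: "(vertex \<Rightarrow>\<^sub>0 nat) \<times> nat \<Rightarrow> nat \<Rightarrow> nat" where
  "truncation ck i = Min (insert (snd ck) ((\<lambda>j. Poly_Mapping.lookup (fst ck) (xi j)) ` {j. (j, i) \<in> r}))"

lemma truncation_attained:
  "truncation ck i = snd ck \<or>
    (\<exists>j. (j, i) \<in> r \<and> truncation ck i = Poly_Mapping.lookup (fst ck) (xi j))"
proof -
  have "truncation ck i \<in>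
      insert (snd ck) ((\<lambda>j. Poly_Mapping.lookup (fst ck) (xi j)) ` {j. (j, i) \<in> r})"
    unfolding truncation_def using finite_below by (intro Min_in) auto
  then show ?thesis by blast
qed

lemma truncation_le_top: "truncation ck i \<le> snd ck"
  unfolding truncation_def using finite_below by (intro Min_le) auto

lemma truncation_le: "(j, i) \<in> r \<Longrightarrow> truncation ck i \<le> Poly_Mapping.lookup (fst ck) (xi j)"
  unfolding truncation_def using finite_below by (intro Min_le) auto

lemma truncation_antimono: "(i, j) \<in> r \<Longrightarrow> truncation ck j \<le> truncation ck i"
  unfolding truncation_def using finite_below by (intro Min_antimono) (auto dest: r_trans)

text \<open>Extra powers of x occur only off the letters, while w i is either the cap or the value
  at a letter below i; so they do not change the truncation.\<close>

lemma truncation_cover_of: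
  assumes p: "p \<in> poset_words n r" and i: "i \<in> {1..n}"
  shows "truncation (cover_of p g) i = word_level p (levels g (0 # p)) i"
proof (rule antisym)
  let ?w = "word_level p (levels g (0 # p))"
  consider "?w i = levels g (0 # p) 0" | t where "t \<in> set p" "(t, i) \<in> r" "?w i = ?w t"
    using word_level_attained[OF p, of g i] word_level_eq_level[OF p] by metis
  then show "truncation (cover_of p g) i \<le> ?w i"
  proof cases
    case 1
    then show ?thesis using truncation_le_top[of "cover_of p g" i] snd_cover_of[OF p] by simp
  next
    case 2
    then show ?thesis
      using truncation_le[OF 2(2), of "cover_of p g"] lookup_cover_of(1)[OF p, of t g] r_dom by auto
  qed
  consider "truncation (cover_of p g) i = snd (cover_of p g)"
    | j where "(j, i) \<in> r"
      "truncation (cover_of p g) i = Poly_Mapping.lookup (fst (cover_of p g)) (xi j)"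
    using truncation_attained by blast
  then show "?w i \<le> truncation (cover_of p g) i"
  proof cases
    case 1
    then show ?thesis using word_level_le_top[OF p] snd_cover_of[OF p] by simp
  next
    case 2
    then have "?w j \<le> truncation (cover_of p g) i"
      using lookup_cover_of(1)[OF p, of j g] r_dom[OF 2(1)] by simp
    then show ?thesis using word_level_antimono[OF p 2(1)] order_trans by blast
  qed
qed

text \<open>The truncation determines w, the strict places of w are the letters, and sorting them by
  level gives the word. The levels and the remaining exponents then determine the
  coordinates.\<close>

lemma cover_of_inj:
  assumes p: "p \<in> poset_words n r" and q: "q \<in> poset_words n r"
    and g: "\<And>i. i \<notin> {0..2*n} \<Longrightarrow> g i = 0" and h: "\<And>i. i \<notin> {0..2*n} \<Longrightarrow> h i = 0"
    and eq: "cover_of p g = cover_of q h"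
  shows "p = q \<and> g = h"
proof -
  let ?l = "levels g (0 # p)" and ?m = "levels h (0 # q)"
  have top: "?l 0 = ?m 0" using eq snd_cover_of[OF p] snd_cover_of[OF q] by metis
  have depth: "word_level p ?l i = word_level q ?m i" if "i \<in> {1..n}" for i
    using truncation_cover_of[OF p that] truncation_cover_of[OF q that] eq by metis
  have "i \<in> set p \<longleftrightarrow> i \<in> set q" if i: "i \<in> {1..n}" for i
  proof -
    have "(\<forall>j. (j, i) \<in> r \<and> j \<noteq> i \<longrightarrow> word_level p ?l i < word_level p ?l j) \<longleftrightarrow>
        (\<forall>j. (j, i) \<in> r \<and> j \<noteq> i \<longrightarrow> word_level q ?m i < word_level q ?m j)"
      using depth r_dom by (intro all_cong) auto
    then show ?thesis
      using word_level_strict_iff[OF p i, of g] word_level_strict_iff[OF q i, of h] top depth[OF i] by simp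
  qed
  then have set_eq: "set p = set q" using word_set(1) p q by blast
  have lev: "?l t = ?m t" if "t \<in> set (0 # p)" for t
  proof (cases "t = 0")
    case False
    then have "t \<in> set p" "t \<in> set q" using that set_eq by auto
    then show ?thesis using word_level_eq_level[OF p] word_level_eq_level[OF q] depth word_set(1)[OF p]
      by (metis subsetD)
  qed (use top in simp)
  have "sorted_wrt (nonincr_step ?m) (0 # p)"
    by (rule sorted_wrt_mono_rel[OF _ word_sorted[OF p, of g]]) (simp add: nonincr_step_def lev)
  then have "0 # p = 0 # q"
    using word_sorted[OF q] set_eq by (intro sorted_wrt_nonincr_step_unique) auto
  then have pq: "p = q" by simp
  have "g i = h i" for i
  proof -
    consider "i \<in> set (0 # p)" | "i \<in> {1..n}" "i \<notin> set p" | "i \<in> {n+1..2*n}"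
      | "i \<notin> {0..2*n}" by force
    then show ?thesis
    proof cases
      case 1
      then show ?thesis using levels_inj[OF word_set(3)[OF p]] lev pq by metis
    next
      case 2
      then show ?thesis
        using lookup_cover_of(1)[OF p 2(1), of g] lookup_cover_of(1)[OF q 2(1), of h] eq pq
          depth[OF 2(1)] by simp
    next
      case 3
      then have i: "i - n \<in> {1..n}" "n + (i - n) = i" by auto
      then show ?thesis
        using lookup_cover_of(2)[OF p i(1), of g] lookup_cover_of(2)[OF q i(1), of h] eq top
          depth[OF i(1)] by simp
    next
      case 4
      then show ?thesis using g h by simp
    qed
  qed
  then show ?thesis using pq by auto
qed

lemma cover_of_surj:
  assumes c: "vertex_cover_vector n E k c"
  shows "\<exists>p g. p \<in> poset_words n r \<and> (\<forall>i. i \<notin> {0..2*n} \<longrightarrow> g i = 0) \<and> cover_of p g = (c, k)"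
proof -
  let ?x = "\<lambda>i. Poly_Mapping.lookup c (xi i)" and ?y = "\<lambda>i. Poly_Mapping.lookup c (eta i)"
  define w where "w = truncation (c, k)"
  have w_le: "w i \<le> k" for i using truncation_le_top[of "(c, k)"] by (simp add: w_def)
  have w_anti: "(i, j) \<in> r \<Longrightarrow> w j \<le> w i" for i j using truncation_antimono by (simp add: w_def)
  have w_x: "(j, i) \<in> r \<Longrightarrow> w i \<le> ?x j" for i j using truncation_le[of j i "(c, k)"] by (simp add: w_def)
  have w_att: "w i = k \<or> (\<exists>j. (j, i) \<in> r \<and> w i = ?x j)" for i
    using truncation_attained[of "(c, k)" i] by (simp add: w_def)
  \<comment> \<open>The set of letters that \<open>word_level_strict_iff\<close> forces.\<close>
  define T where "T = {i \<in> {1..n}. w i < k \<and> (\<forall>j. (j, i) \<in> r \<and> j \<noteq> i \<longrightarrow> w i < w j)}"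
  \<comment> \<open>Labels start at 1, so the index 0 is free to carry the cap k.\<close>
  define l where "l = w(0 := k)"
  have "finite (insert 0 T)" by (simp add: T_def)
  from sorted_wrt_nonincr_step_exists[OF this] obtain xs
    where xs: "set xs = insert 0 T" "sorted_wrt (nonincr_step l) xs" by blast
  obtain p where p: "xs = 0 # p"
  proof (cases xs)
    case (Cons x p)
    have "x = 0"
    proof (rule ccontr)
      assume "x \<noteq> 0"
      have "x \<in> insert 0 T" "0 \<in> set (x # p)"
        using Cons by (simp_all only: xs(1)[symmetric] list.set_intros)
          (simp only: Cons[symmetric] xs(1) insertI1)
      then have "x \<in> T" "0 \<in> set p" using \<open>x \<noteq> 0\<close> by simp_all
      moreover have "nonincr_step l x 0" using xs(2) Cons \<open>0 \<in> set p\<close> by simp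
      ultimately show False using \<open>x \<noteq> 0\<close> by (auto simp: nonincr_step_def l_def T_def)
    qed
    then show thesis using that Cons by simp
  qed (use xs in auto)
  have dist: "distinct xs" using xs(2) by (rule sorted_wrt_nonincr_step_distinct)
  have "set p = set xs - {0}" using p dist by auto
  then have set_p: "set p = T" unfolding xs(1) by (auto simp: T_def)
  have "sorted_wrt (nonincr_step l) p" using xs p by simp
  then have "sorted_wrt (\<lambda>x y. (y, x) \<notin> r) p"
  proof (rule sorted_wrt_mono_rel[rotated])
    fix x y assume xy: "x \<in> set p" "y \<in> set p" "nonincr_step l x y"
    then have "x \<noteq> y" "w y \<le> w x" using set_p by (auto simp: nonincr_step_def l_def T_def)
    then show "(y, x) \<notin> r" using xy(1) set_p by (auto simp: T_def)
  qed
  then have pw: "p \<in> poset_words n r"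
    using dist p set_p by (auto simp: poset_words_def T_def)
  obtain g0 where g0: "\<forall>x\<in>set xs. levels g0 xs x = l x" using levels_surj[OF xs(2)] by blast
  \<comment> \<open>Off the letters, g records the surplus of x_i over w i and of y_i over k - w i.
    The latter is written y_i + w i - k, a true difference by the cover condition.\<close>
  define g where "g i = (if i \<in> set xs then g0 i else if i \<in> {1..n} then ?x i - w i
    else if i \<in> {n+1..2*n} then ?y (i - n) + w (i - n) - k else 0)" for i
  have "levels g (0 # p) = levels g0 (0 # p)"
    using p by (intro levels_cong) (simp add: g_def)
  then have lev: "levels g (0 # p) x = l x" if "x \<in> set (0 # p)" for x
    using g0 p that by auto
  \<comment> \<open>If i is not a letter and w i < k, some smaller element has the same value. Its
    label is smaller too, so the descent ends at a letter.\<close>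
  have w_eq: "w i = k \<or> (\<exists>t\<in>T. (t, i) \<in> r \<and> w t = w i)" if "i \<in> {1..n}" for i
    using that
  proof (induction i rule: less_induct)
    case (less i)
    show ?case
    proof (cases "i \<in> T \<or> w i = k")
      case True
      then show ?thesis using less.prems r_refl by blast
    next
      case False
      then obtain j where j: "(j, i) \<in> r" "j \<noteq> i" "w j \<le> w i"
        using less.prems w_le[of i] by (force simp: T_def)
      then have "w j = w i" using w_anti by (simp add: antisym)
      moreover have "j < i" "j \<in> {1..n}" using j natural[OF j(1)] r_dom by auto
      ultimately show ?thesis using less.IH[of j] j r_trans by metis
    qed
  qed
  have depth: "word_level p (levels g (0 # p)) i = w i" if i: "i \<in> {1..n}" for i
  proof (rule antisym)
    show "word_level p (levels g (0 # p)) i \<le> w i"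
      using w_eq[OF i]
    proof
      assume "w i = k"
      then show ?thesis using word_level_le_top[OF pw, of g i] lev[of 0] by (simp add: l_def)
    next
      assume "\<exists>t\<in>T. (t, i) \<in> r \<and> w t = w i"
      then obtain t where t: "t \<in> set p" "(t, i) \<in> r" "w t = w i" using set_p by auto
      then show ?thesis using word_level_le_level[OF pw t(1,2), of g] lev[of t] r_dom[OF t(2)]
        by (simp add: l_def)
    qed
    show "w i \<le> word_level p (levels g (0 # p)) i"
      using word_level_attained[OF pw, of g i]
    proof
      assume "word_level p (levels g (0 # p)) i = levels g (0 # p) 0"
      then show ?thesis using lev[of 0] w_le by (simp add: l_def)
    next
      assume "\<exists>t\<in>set p. (t, i) \<in> r \<and> word_level p (levels g (0 # p)) i = levels g (0 # p) t"
      then obtain t where t: "t \<in> set p" "(t, i) \<in> r"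
        "word_level p (levels g (0 # p)) i = levels g (0 # p) t" by blast
      then show ?thesis using lev[of t] r_dom[OF t(2)] w_anti[OF t(2)] by (simp add: l_def)
    qed
  qed
  have top: "levels g (0 # p) 0 = k" using lev[of 0] by (simp add: l_def)
  have "c = exponent (\<lambda>i. word_level p (levels g (0 # p)) i + (if i \<in> set p then 0 else g i))
      (\<lambda>i. levels g (0 # p) 0 - word_level p (levels g (0 # p)) i + g (n + i))"
  proof (rule exponent_eqI)
    show "Poly_Mapping.keys c \<subseteq> vertices n" using c by (simp add: vertex_cover_vector_def)
    fix i assume i: "i \<in> {1..n}"
    \<comment> \<open>For a letter, w i is the x-exponent of some j below i. Then w j \<le> w i, so
      strictness forces j = i and there is no extra power.\<close>
    show "?x i = word_level p (levels g (0 # p)) i + (if i \<in> set p then 0 else g i)"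
    proof (cases "i \<in> T")
      case True
      then obtain j where j: "(j, i) \<in> r" "w i = ?x j" using w_att[of i] by (auto simp: T_def)
      then have "w j \<le> w i" using w_x[of j j] r_refl r_dom by simp
      then have "j = i" using True j(1) by (auto simp: T_def)
      then show ?thesis using j True set_p depth[OF i] by simp
    next
      case False
      then have "g i = ?x i - w i" using i xs(1) by (simp add: g_def)
      moreover have "w i \<le> ?x i" using i r_refl w_x by blast
      ultimately show ?thesis using False set_p depth[OF i] by simp
    qed
    \<comment> \<open>If w i is not k, it is the x-exponent of some j below i, and the edge of the
      pair (j, i) gives the bound.\<close>
    have "k \<le> ?y i + w i"
    proof (cases "w i = k")
      case False
      then obtain j where "(j, i) \<in> r" "w i = ?x j" using w_att by blast
      then show ?thesis using c unfolding cover_iff by fastforce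
    qed simp
    moreover have "n + i \<notin> set xs" "n + i \<notin> {1..n}" "n + i \<in> {n+1..2*n}"
      using i xs(1) by (auto simp: T_def)
    then have "g (n + i) = ?y i + w i - k" by (simp add: g_def)
    ultimately show "?y i = levels g (0 # p) 0 - word_level p (levels g (0 # p)) i + g (n + i)"
      using depth[OF i] top w_le[of i] by simp
  qed
  then have "cover_of p g = (c, k)" using top by (simp only: cover_of_def Let_def)
  moreover have "g i = 0" if "i \<notin> {0..2*n}" for i
  proof -
    have "i \<notin> set xs" using that xs(1) by (auto simp: T_def)
    then show ?thesis using that by (auto simp: g_def)
  qed
  ultimately show ?thesis using pw by blast
qed

text \<open>Each word accounts for the lattice points of one cone with 2n + 1 free coordinates,
  shifted in degree by its number of ascents.\<close>

lemma card_covers: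
  "card (covers d) = (\<Sum>p\<in>poset_words n r.
     if ascents (0 # p) \<le> d then card (compositions {0..2*n} (d - ascents (0 # p))) else 0)"
proof -
  let ?W = "{p \<in> poset_words n r. ascents (0 # p) \<le> d}"
  let ?S = "SIGMA p:?W. compositions {0..2*n} (d - ascents (0 # p))"
  have "bij_betw (\<lambda>(p, g). cover_of p g) ?S (covers d)"
    unfolding bij_betw_def
  proof
    show "inj_on (\<lambda>(p, g). cover_of p g) ?S"
    proof (rule inj_onI)
      fix a b assume ab: "a \<in> ?S" "b \<in> ?S"
        "(case a of (p, g) \<Rightarrow> cover_of p g) = (case b of (p, g) \<Rightarrow> cover_of p g)"
      obtain p g q h where [simp]: "a = (p, g)" "b = (q, h)" by fastforce
      have "p = q \<and> g = h"
        by (rule cover_of_inj) (use ab in \<open>auto simp: compositions_def\<close>)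
      then show "a = b" by simp
    qed
    show "(\<lambda>(p, g). cover_of p g) ` ?S = covers d"
    proof (intro equalityI subsetI)
      fix ck assume "ck \<in> (\<lambda>(p, g). cover_of p g) ` ?S"
      then obtain p g where pg: "ck = cover_of p g" "p \<in> poset_words n r" "ascents (0 # p) \<le> d"
        "sum g {0..2*n} = d - ascents (0 # p)"
        by (auto simp: compositions_def)
      then show "ck \<in> covers d"
        using cover_of_is_cover[OF pg(2), of g] degree_cover_of[OF pg(2), of g]
        by (simp add: covers_def case_prod_unfold)
    next
      fix ck assume ck: "ck \<in> covers d"
      then obtain p g where pg: "p \<in> poset_words n r" "\<forall>i. i \<notin> {0..2*n} \<longrightarrow> g i = 0"
        "cover_of p g = ck"
        using cover_of_surj by (cases ck) (fastforce simp: covers_def)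
      then have "ascents (0 # p) + sum g {0..2*n} = d"
        using ck degree_cover_of[OF pg(1), of g] by (simp add: covers_def case_prod_unfold)
      then have "(p, g) \<in> ?S" using pg by (simp add: compositions_def)
      then show "ck \<in> (\<lambda>(p, g). cover_of p g) ` ?S" using pg(3) by force
    qed
  qed
  then have "card (covers d) = card ?S" by (simp add: bij_betw_same_card)
  also have "\<dots> = (\<Sum>p\<in>?W. card (compositions {0..2*n} (d - ascents (0 # p))))"
    using finite_poset_words finite_compositions by simp
  also have "\<dots> = (\<Sum>p\<in>poset_words n r.
      if ascents (0 # p) \<le> d then card (compositions {0..2*n} (d - ascents (0 # p))) else 0)"
    using finite_poset_words by (simp add: sum.inter_filter)
  finally show ?thesis .
qed

lemma covers_series:
  "Abs_fps (\<lambda>d. int (card (covers d))) * (1 - fps_X) ^ (2 * n + 1) =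
     Abs_fps (\<lambda>j. int (word_count n r j))"
proof -
  let ?C = "Abs_fps (\<lambda>d. int (card (compositions {0..2*n} d)))"
  have "Abs_fps (\<lambda>d. int (card (covers d))) = (\<Sum>p\<in>poset_words n r. fps_X ^ ascents (0 # p) * ?C)"
    by (rule fps_ext) (auto simp: card_covers fps_sum_nth fps_X_power_mult_nth intro!: sum.cong)
  then have "Abs_fps (\<lambda>d. int (card (covers d))) * (1 - fps_X) ^ (2 * n + 1) =
      (\<Sum>p\<in>poset_words n r. fps_X ^ ascents (0 # p) * (?C * (1 - fps_X) ^ card {0..2*n}))"
    by (simp add: sum_distrib_right mult.assoc)
  also have "\<dots> = (\<Sum>p\<in>poset_words n r. fps_X ^ ascents (0 # p))"
    by (subst compositions_series) auto
  also have "\<dots> = Abs_fps (\<lambda>j. int (word_count n r j))"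
  proof (rule fps_ext)
    fix j
    have "fps_nth (\<Sum>p\<in>poset_words n r. fps_X ^ ascents (0 # p)) j =
        (\<Sum>p\<in>poset_words n r. if ascents (0 # p) = j then 1 else (0::int))"
      unfolding fps_sum_nth by (intro sum.cong) (auto simp: fps_X_power_nth)
    also have "\<dots> = int (word_count n r j)"
      using finite_poset_words by (simp add: word_count_def flip: sum.inter_filter)
    finally show "fps_nth (\<Sum>p\<in>poset_words n r. fps_X ^ ascents (0 # p)) j =
        fps_nth (Abs_fps (\<lambda>j. int (word_count n r j))) j" by simp
  qed
  finally show ?thesis .
qed

end

section \<open>The Hilbert function\<close>

definition cover_monom :: "(vertex \<Rightarrow>\<^sub>0 nat) \<times> nat \<Rightarrow> (vertex, 'k::field) mpoly poly" where
  "cover_monom ck = monom (Poly_Mapping.single (fst ck) 1) (snd ck)"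

lemma cover_monom_mult: "cover_monom (c, k) * cover_monom (c', k') = cover_monom (c + c', k + k')"
  by (simp add: cover_monom_def mult_monom mult_single)

lemma coeff_kscale_cover_monom:
  "Poly_Mapping.lookup (coeff (kscale a (cover_monom ck)) (snd ck')) (fst ck') =
    (if ck = ck' then a else 0)"
  by (auto simp: kscale_def cover_monom_def smult_monom mult_single lookup_single when_def prod_eq_iff)

lemma inj_cover_monom: "inj cover_monom"
proof (rule injI)
  fix a b assume "cover_monom a = cover_monom b"
  then show "a = b"
    using coeff_kscale_cover_monom[of 1 a a] coeff_kscale_cover_monom[of 1 b a]
    by (metis zero_neq_one)
qed

lemma independent_cover_monoms:
  "kvs.independent (range (cover_monom :: _ \<Rightarrow> (vertex, 'k::field) mpoly poly))"
proof
  assume "kvs.dependent (range (cover_monom :: _ \<Rightarrow> (vertex, 'k) mpoly poly))"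
  then obtain U and u :: "(vertex, 'k) mpoly poly \<Rightarrow> 'k" where U: "finite U" "U \<subseteq> range cover_monom" "(\<Sum>f\<in>U. kscale (u f) f) = 0"
    and "\<exists>f\<in>U. u f \<noteq> 0"
    unfolding kvs.dependent_explicit by (elim exE conjE)
  then obtain ck where ck: "cover_monom ck \<in> U" "u (cover_monom ck) \<noteq> 0" by blast
  have "0 = Poly_Mapping.lookup (coeff (\<Sum>f\<in>U. kscale (u f) f) (snd ck)) (fst ck)"
    using U(3) by simp
  also have "\<dots> = (\<Sum>f\<in>U. Poly_Mapping.lookup (coeff (kscale (u f) f) (snd ck)) (fst ck))"
    by (simp add: coeff_sum lookup_sum)
  also have "\<dots> = (\<Sum>f\<in>U. if f = cover_monom ck then u f else 0)"
  proof (intro sum.cong refl)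
    fix f assume "f \<in> U"
    then obtain ck' where "f = cover_monom ck'" using U(2) by auto
    then show "Poly_Mapping.lookup (coeff (kscale (u f) f) (snd ck)) (fst ck) =
        (if f = cover_monom ck then u f else 0)"
      by (auto simp: coeff_kscale_cover_monom inj_eq[OF inj_cover_monom])
  qed
  also have "\<dots> = u (cover_monom ck)" using U(1) ck(1) by simp
  finally show False using ck(2) by simp
qed

lemma subspace_vertex_cover_algebra: "kvs.subspace (vertex_cover_algebra n E)"
proof (rule kvs.subspaceI)
  have "kscale 0 1 \<in> vertex_cover_algebra n E"
    unfolding vertex_cover_algebra_def by (intro subalgebra_generated.scale subalgebra_generated.one)
  then show "0 \<in> vertex_cover_algebra n E" by simp
qed (simp_all add: vertex_cover_algebra_def subalgebra_generated.add subalgebra_generated.scale)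

section \<open>Degree-one generators and the standard grading\<close>

context poset_graph_labelling
begin

lemma coversD:
  "(c, k) \<in> covers d \<Longrightarrow> (i, j) \<in> r \<Longrightarrow>
    k \<le> Poly_Mapping.lookup c (xi i) + Poly_Mapping.lookup c (eta j)"
  unfolding covers_def cover_iff by auto

lemma covers_add: "(c, k) \<in> covers d \<Longrightarrow> (c', k') \<in> covers d' \<Longrightarrow> (c + c', k + k') \<in> covers (d + d')"
proof -
  assume c: "(c, k) \<in> covers d" and c': "(c', k') \<in> covers d'"
  have "Poly_Mapping.keys (c + c') \<subseteq> vertices n"
    using keys_add[of c c'] c c' by (auto simp: covers_def vertex_cover_vector_def)
  moreover have "k + k' \<le> Poly_Mapping.lookup (c + c') (xi i) + Poly_Mapping.lookup (c + c') (eta j)"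
    if "(i, j) \<in> r" for i j
    using coversD[OF c that] coversD[OF c' that] by (simp add: lookup_add)
  ultimately have "vertex_cover_vector n E (k + k') (c + c')"
    unfolding cover_iff by auto
  then show ?thesis using c c' by (simp add: covers_def lookup_add sum.distrib algebra_simps)
qed

lemma var_in_covers:
  assumes "v \<in> vertices n"
  shows "(Poly_Mapping.single v 1, 0) \<in> covers 1"
  using assms finite_vertices by (auto simp: covers_def vertex_cover_vector_def lookup_single when_def)

lemma covers_both:
  assumes C: "vertex_cover n E C"
  shows "(i, j) \<in> r \<Longrightarrow> xi i \<in> C \<or> eta j \<in> C"
  using C unfolding vertex_cover_def E_eq by auto

text \<open>If C contained both vertices, minimality would give an edge (i, b) covered only by
  \<open>xi i\<close> and an edge (a', i) covered only by \<open>eta i\<close>. By transitivity (a',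
  b) is an edge, and C misses it. Hence minimal covers have n elements.\<close>

lemma minimal_cover_exactly_one:
  assumes C: "minimal_vertex_cover n E C" and i: "i \<in> {1..n}"
  shows "xi i \<in> C \<longleftrightarrow> eta i \<notin> C"
proof
  assume x: "xi i \<in> C"
  show "eta i \<notin> C"
  proof
    assume y: "eta i \<in> C"
    have cov: "vertex_cover n E C" and sub: "C \<subseteq> vertices n"
      using C by (auto simp: minimal_vertex_cover_def vertex_cover_def)
    have "\<exists>e\<in>E. e \<inter> (C - {v}) = {}" if "v \<in> C" for v
    proof -
      have "C - {v} \<subset> C" using that by blast
      then have "\<not> vertex_cover n E (C - {v})" using C by (simp add: minimal_vertex_cover_def)
      then show ?thesis using sub by (auto simp: vertex_cover_def)
    qed
    from this[OF x] this[OF y] obtain e f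
      where e: "e \<in> E" "e \<inter> (C - {xi i}) = {}" and f: "f \<in> E" "f \<inter> (C - {eta i}) = {}" by blast
    obtain a b where ab: "(a, b) \<in> r" "e = {xi a, eta b}" using e(1) E_eq by auto
    obtain a' b' where ab': "(a', b') \<in> r" "f = {xi a', eta b'}" using f(1) E_eq by auto
    have "eta b \<notin> C" using e(2) ab(2) xi_neq_eta[OF i, of b] r_dom[OF ab(1)] by auto
    moreover have "xi a \<in> C" using covers_both[OF cov ab(1)] calculation by blast
    then have "xi a = xi i" using e(2) ab(2) by auto
    then have "a = i" using xi_inj[OF _ i] r_dom[OF ab(1)] by blast
    moreover have "xi a' \<notin> C" using f(2) ab'(2) xi_neq_eta[OF _ i, of a'] r_dom[OF ab'(1)] by auto
    moreover have "eta b' \<in> C" using covers_both[OF cov ab'(1)] \<open>xi a' \<notin> C\<close> by blast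
    then have "eta b' = eta i" using f(2) ab'(2) by auto
    then have "b' = i" using eta_inj[OF _ i] r_dom[OF ab'(1)] by blast
    ultimately have "(a', b) \<in> r" "xi a' \<notin> C" "eta b \<notin> C"
      using ab(1) ab'(1) r_trans by blast+
    then show False using covers_both[OF cov] by blast
  qed
next
  assume "eta i \<notin> C"
  moreover have "vertex_cover n E C" using C by (simp add: minimal_vertex_cover_def)
  ultimately show "xi i \<in> C" using covers_both r_refl[OF i] by blast
qed

lemma minimal_cover_in_covers:
  assumes C: "minimal_vertex_cover n E C"
  shows "(set_exponent C, 1) \<in> covers 1"
proof -
  let ?c = "set_exponent C"
  have cov: "vertex_cover n E C" and sub: "C \<subseteq> vertices n"
    using C by (auto simp: minimal_vertex_cover_def vertex_cover_def)
  then have fin: "finite C" using finite_vertices finite_subset by blast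
  have "(\<Sum>v\<in>vertices n. Poly_Mapping.lookup ?c v) = (\<Sum>i=1..n. 1)"
    unfolding sum_vertices using minimal_cover_exactly_one[OF C]
    by (intro sum.cong) (auto simp: lookup_set_exponent[OF fin])
  moreover have "vertex_cover_vector n E 1 ?c"
    unfolding cover_iff
  proof (intro conjI)
    show "Poly_Mapping.keys ?c \<subseteq> vertices n"
      using sub by (auto simp: in_keys_iff lookup_set_exponent[OF fin])
    show "\<forall>(i, j)\<in>r. 1 \<le> Poly_Mapping.lookup ?c (xi i) + Poly_Mapping.lookup ?c (eta j)"
      unfolding lookup_set_exponent[OF fin] using covers_both[OF cov] by fastforce
  qed
  ultimately show ?thesis by (simp add: covers_def)
qed

lemma xi_image_iff: "i \<in> {1..n} \<Longrightarrow> A \<subseteq> {1..n} \<Longrightarrow> xi i \<in> xi ` A \<longleftrightarrow> i \<in> A"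
  and eta_image_iff: "i \<in> {1..n} \<Longrightarrow> A \<subseteq> {1..n} \<Longrightarrow> eta i \<in> eta ` A \<longleftrightarrow> i \<in> A"
  and xi_notin_eta_image: "i \<in> {1..n} \<Longrightarrow> A \<subseteq> {1..n} \<Longrightarrow> xi i \<notin> eta ` A"
  and eta_notin_xi_image: "i \<in> {1..n} \<Longrightarrow> A \<subseteq> {1..n} \<Longrightarrow> eta i \<notin> xi ` A"
  using xi_inj eta_inj xi_neq_eta by (blast, blast, blast, metis imageE subsetD)

lemma split_cover_mem:
  assumes "i \<in> {1..n}"
  shows "xi i \<in> xi ` ({1..n} \<inter> D) \<union> eta ` ({1..n} - D) \<longleftrightarrow> i \<in> D"
    and "eta i \<in> xi ` ({1..n} \<inter> D) \<union> eta ` ({1..n} - D) \<longleftrightarrow> i \<notin> D"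
  unfolding Un_iff using assms
  by (simp_all only: xi_image_iff eta_image_iff xi_notin_eta_image eta_notin_xi_image
      Int_lower1 Diff_subset Int_iff Diff_iff simp_thms)

text \<open>On each diagonal edge the cover has exactly one endpoint, so no vertex can be
  removed.\<close>

lemma down_set_minimal_cover:
  assumes D: "\<And>i j. (i, j) \<in> r \<Longrightarrow> j \<in> D \<Longrightarrow> i \<in> D"
  shows "minimal_vertex_cover n E (xi ` ({1..n} \<inter> D) \<union> eta ` ({1..n} - D))" (is "minimal_vertex_cover n E ?C")
proof -
  have "vertex_cover n E ?C"
    unfolding vertex_cover_def vertices_eq E_eq using D r_dom by fastforce
  moreover have False if A: "A \<subset> ?C" "vertex_cover n E A" for A
  proof -
    obtain v where v: "v \<in> ?C" "v \<notin> A" using A(1) by blast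
    then obtain i where i: "i \<in> {1..n}" "v = (if i \<in> D then xi i else eta i)" by auto
    have "(if i \<in> D then eta i else xi i) \<in> A"
      using covers_both[OF A(2) r_refl[OF i(1)]] v(2) i(2) by (auto split: if_splits)
    then have "(if i \<in> D then eta i else xi i) \<in> ?C" using A(1) by blast
    then show False using split_cover_mem[OF i(1), of D] by (cases "i \<in> D") simp_all
  qed
  ultimately show ?thesis by (auto simp: minimal_vertex_cover_def)
qed

text \<open>This is why A(G) is generated in degree one. Let D be the largest down-set on which all
  x-exponents are positive, and let C be its minimal cover. An i outside D has some j below it with
  x-exponent 0, so y_i alone is at least k + 1. Hence subtracting C stays nonnegative and leaves at
  least k on every edge.\<close>

lemma covers_peel:
  assumes ck: "(c, Suc k) \<in> covers (Suc d)"
  obtains C c' where "minimal_vertex_cover n E C" "(c', k) \<in> covers d"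
    "c = c' + set_exponent C"
proof -
  let ?x = "\<lambda>i. Poly_Mapping.lookup c (xi i)" and ?y = "\<lambda>i. Poly_Mapping.lookup c (eta i)"
  note cov = coversD[OF ck]
  define D where "D = {i. \<forall>j. (j, i) \<in> r \<longrightarrow> ?x j \<ge> 1}"
  define C where "C = xi ` ({1..n} \<inter> D) \<union> eta ` ({1..n} - D)"
  have min: "minimal_vertex_cover n E C"
    unfolding C_def by (rule down_set_minimal_cover) (use r_trans in \<open>auto simp: D_def\<close>)
  have fin: "finite C" by (simp add: C_def)
  let ?e = "set_exponent C"
  have xC: "xi i \<in> C \<longleftrightarrow> i \<in> D" and yC: "eta i \<in> C \<longleftrightarrow> i \<notin> D" if "i \<in> {1..n}" for i
    unfolding C_def by (rule split_cover_mem[OF that])+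
  have yD: "Suc k \<le> ?y i" if "(i', i) \<in> r" "i \<notin> D" for i i'
  proof -
    have "\<exists>j. (j, i) \<in> r \<and> \<not> 1 \<le> ?x j" using that(2) by (simp add: D_def)
    then obtain j where "(j, i) \<in> r" "?x j = 0" by auto
    then show ?thesis using cov by force
  qed
  have le: "Poly_Mapping.lookup ?e v \<le> Poly_Mapping.lookup c v" for v
  proof (cases "v \<in> C")
    case True
    then consider i where "i \<in> {1..n}" "i \<in> D" "v = xi i" | i where "i \<in> {1..n}" "i \<notin> D" "v = eta i"
      unfolding C_def by blast
    then show ?thesis
    proof cases
      case 1
      then show ?thesis using r_refl True by (auto simp: D_def lookup_set_exponent[OF fin])
    next
      case 2
      then show ?thesis using yD[OF r_refl] True by (force simp: lookup_set_exponent[OF fin])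
    qed
  qed (simp add: lookup_set_exponent[OF fin])
  define c' where "c' = c - ?e"
  have eq: "c = c' + ?e"
    by (rule poly_mapping_eqI) (use le in \<open>simp add: c'_def lookup_add lookup_minus\<close>)
  have "vertex_cover_vector n E k c'"
    unfolding cover_iff
  proof (intro conjI ballI, goal_cases)
    case 1
    have "Poly_Mapping.keys c' \<subseteq> Poly_Mapping.keys c"
      by (auto simp: c'_def in_keys_iff lookup_minus)
    then show ?case using ck by (auto simp: covers_def vertex_cover_vector_def)
  next
    case (2 e)
    then obtain i j where ij: "e = (i, j)" "(i, j) \<in> r" by (cases e) blast
    have *: "Poly_Mapping.lookup c' v = Poly_Mapping.lookup c v - of_bool (v \<in> C)" for v
      by (simp add: c'_def lookup_minus lookup_set_exponent[OF fin])
    have "k \<le> (?x i - of_bool (i \<in> D)) + (?y j - of_bool (j \<notin> D))"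
    proof (cases "j \<in> D")
      case True
      then have "1 \<le> ?x i" using ij by (auto simp: D_def)
      then show ?thesis using cov[OF ij(2)] True by auto
    next
      case False
      then show ?thesis using yD[OF ij(2)] by auto
    qed
    then show ?case using ij r_dom[OF ij(2)] by (simp add: * xC yC)
  qed
  moreover have "(\<Sum>v\<in>vertices n. Poly_Mapping.lookup c v) =
      (\<Sum>v\<in>vertices n. Poly_Mapping.lookup c' v) + (\<Sum>v\<in>vertices n. Poly_Mapping.lookup ?e v)"
    by (subst eq) (simp add: lookup_add sum.distrib)
  moreover have "(\<Sum>v\<in>vertices n. Poly_Mapping.lookup ?e v) = n"
    using minimal_cover_in_covers[OF min] by (simp add: covers_def)
  ultimately have "(c', k) \<in> covers d" using ck by (simp add: covers_def)
  then show thesis using that min eq by blast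
qed

text \<open>The diagonal edges force an exponent sum of at least n k, so the degree is at least
  k.\<close>

lemma covers_0:
  assumes "(c, k) \<in> covers 0"
  shows "c = 0 \<and> k = 0"
proof -
  have "n * k = (\<Sum>i=1..n. k)" by simp
  also have "\<dots> \<le> (\<Sum>v\<in>vertices n. Poly_Mapping.lookup c v)"
    unfolding sum_vertices using coversD[OF assms r_refl] by (intro sum_mono) blast
  finally have k: "k = 0" using assms by (simp add: covers_def)
  then have sum0: "(\<Sum>v\<in>vertices n. Poly_Mapping.lookup c v) = 0"
    using assms by (simp add: covers_def)
  have "Poly_Mapping.lookup c v = 0" for v
  proof (cases "v \<in> vertices n")
    case False
    then have "v \<notin> Poly_Mapping.keys c" using assms by (auto simp: covers_def vertex_cover_vector_def)
    then show ?thesis by (simp add: in_keys_iff)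
  qed (use sum0 finite_vertices in simp)
  then show ?thesis using k by (simp add: poly_mapping_eqI)
qed

lemma generator_in_covers:
  "f \<in> degree_one_generators n E \<Longrightarrow> f \<in> cover_monom ` covers 1"
proof -
  assume "f \<in> degree_one_generators n E"
  then consider v where "v \<in> vertices n" "f = monom (mvar v) 0"
    | C where "minimal_vertex_cover n E C" "f = monom (\<Prod>v\<in>C. mvar v) 1"
    unfolding degree_one_generators_def by blast
  then show ?thesis
  proof cases
    case 1
    then show ?thesis
      using var_in_covers by (intro image_eqI[of _ _ "(Poly_Mapping.single v 1, 0)"])
        (auto simp: cover_monom_def mvar_def)
  next
    case 2
    then have "finite C"
      using finite_vertices finite_subset by (auto simp: minimal_vertex_cover_def vertex_cover_def)
    then show ?thesis
      using 2 minimal_cover_in_covers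
      by (intro image_eqI[of _ _ "(set_exponent C, 1)"])
        (auto simp: cover_monom_def prod_mvar)
  qed
qed

text \<open>Products of generators add up their exponents and degrees. Conversely, a cover with k >
  0 loses a minimal cover by \<open>covers_peel\<close>, and one with k = 0 and positive degree
  loses a variable.\<close>

lemma generators_products:
  "{prod_list fs | fs. length fs = d \<and> set fs \<subseteq> degree_one_generators n E} =
    (cover_monom ` covers d :: (vertex, 'k::field) mpoly poly set)"
proof (intro equalityI subsetI)
  have "length fs = d \<Longrightarrow> set fs \<subseteq> degree_one_generators n E \<Longrightarrow> prod_list fs \<in> cover_monom ` covers d"
    for fs :: "(vertex, 'k) mpoly poly list"
  proof (induction fs arbitrary: d)
    case Nil
    have "(0, 0) \<in> covers 0" by (simp add: covers_def vertex_cover_vector_def)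
    then show ?case using Nil
      by (intro image_eqI[of _ _ "(0, 0)"]) (auto simp: cover_monom_def single_one one_pCons monom_0)
  next
    case (Cons f fs)
    then obtain c k c' k' where "(c, k) \<in> covers 1" "f = cover_monom (c, k)"
      "(c', k') \<in> covers (length fs)" "prod_list fs = cover_monom (c', k')"
      using generator_in_covers[of f] by fastforce
    then show ?case
      using Cons.prems covers_add[of c k 1 c' k' "length fs"]
      by (intro image_eqI[of _ _ "(c + c', k + k')"]) (auto simp: cover_monom_mult)
  qed
  then show "f \<in> cover_monom ` covers d"
    if "f \<in> {prod_list fs | fs. length fs = d \<and> set fs \<subseteq> degree_one_generators n E}"
    for f :: "(vertex, 'k) mpoly poly" using that by blast
next
  have "\<exists>fs. length fs = d \<and> set fs \<subseteq> degree_one_generators n E \<and>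
      prod_list fs = (cover_monom (c, k) :: (vertex, 'k) mpoly poly)"
    if "(c, k) \<in> covers d" for c k
    using that
  proof (induction d arbitrary: c k)
    case 0
    then show ?case using covers_0[OF 0] by (auto simp: cover_monom_def single_one one_pCons monom_0)
  next
    case (Suc d)
    have "\<exists>f c' k'. f \<in> degree_one_generators n E \<and> (c', k') \<in> covers d \<and>
        cover_monom (c, k) = f * (cover_monom (c', k') :: (vertex, 'k) mpoly poly)"
    proof (cases k)
      case 0
      then have "(\<Sum>v\<in>vertices n. Poly_Mapping.lookup c v) \<noteq> 0"
        using Suc.prems by (simp add: covers_def)
      then obtain v where v: "v \<in> vertices n" "Poly_Mapping.lookup c v \<noteq> 0"
        by (meson sum.neutral)
      define c' where "c' = c - Poly_Mapping.single v 1"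
      have eq: "c = Poly_Mapping.single v 1 + c'"
        by (rule poly_mapping_eqI)
          (use v in \<open>auto simp: c'_def lookup_add lookup_minus lookup_single when_def\<close>)
      have "Poly_Mapping.keys c' \<subseteq> Poly_Mapping.keys c"
        by (auto simp: c'_def in_keys_iff lookup_minus)
      moreover have "(\<Sum>w\<in>vertices n. Poly_Mapping.lookup c w) =
          1 + (\<Sum>w\<in>vertices n. Poly_Mapping.lookup c' w)"
        by (subst eq) (use v finite_vertices in \<open>simp add: lookup_add sum.distrib lookup_single when_def\<close>)
      ultimately have "(c', 0) \<in> covers d"
        using Suc.prems 0 by (auto simp: covers_def vertex_cover_vector_def)
      moreover have "cover_monom (c, k) = monom (mvar v) 0 * (cover_monom (c', 0) :: (vertex, 'k) mpoly poly)"
        using 0 eq by (simp add: cover_monom_def mvar_def mult_monom mult_single)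
      moreover have "monom (mvar v) 0 \<in> (degree_one_generators n E :: (vertex, 'k) mpoly poly set)"
        using v(1) by (auto simp: degree_one_generators_def)
      ultimately show ?thesis by blast
    next
      case (Suc k')
      then obtain C c' where C: "minimal_vertex_cover n E C" and c': "(c', k') \<in> covers d"
        "c = c' + set_exponent C"
        using covers_peel Suc.prems by metis
      then have "finite C"
        using finite_vertices finite_subset by (auto simp: minimal_vertex_cover_def vertex_cover_def)
      then have "cover_monom (c, k) =
          monom (\<Prod>v\<in>C. mvar v) 1 * (cover_monom (c', k') :: (vertex, 'k) mpoly poly)"
        using c' Suc by (simp add: cover_monom_def prod_mvar mult_monom mult_single add.commute)
      moreover have "monom (\<Prod>v\<in>C. mvar v) 1 \<in> (degree_one_generators n E :: (vertex, 'k) mpoly poly set)"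
        using C by (auto simp: degree_one_generators_def)
      ultimately show ?thesis using c'(1) by blast
    qed
    then obtain f c' k' where f: "f \<in> degree_one_generators n E" "(c', k') \<in> covers d"
      "cover_monom (c, k) = f * (cover_monom (c', k') :: (vertex, 'k) mpoly poly)" by blast
    then obtain fs where "length fs = d" "set fs \<subseteq> degree_one_generators n E"
      "prod_list fs = (cover_monom (c', k') :: (vertex, 'k) mpoly poly)"
      using Suc.IH by blast
    then show ?case using f by (intro exI[of _ "f # fs"]) auto
  qed
  then show "f \<in> {prod_list fs | fs. length fs = d \<and> set fs \<subseteq> degree_one_generators n E}"
    if "f \<in> cover_monom ` covers d" for f :: "(vertex, 'k) mpoly poly"
    using that by (smt (verit) image_iff mem_Collect_eq prod.exhaust)
qed

text \<open>The products of d generators are linearly independent monomials that already lie in the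
  algebra, so the intersection in \<open>graded_component\<close> removes nothing.\<close>

lemma hilbert_function_eq: "hilbert_function TYPE('k::field) n E d = card (covers d)"
proof -
  let ?B = "cover_monom ` covers d :: (vertex, 'k) mpoly poly set"
  have "?B \<subseteq> {monom (Poly_Mapping.single c 1) k | c k. vertex_cover_vector n E k c}"
    by (force simp: covers_def cover_monom_def)
  then have "?B \<subseteq> vertex_cover_algebra n E"
    unfolding vertex_cover_algebra_def using subalgebra_generated.gen by blast
  then have "kvs.span ?B \<subseteq> vertex_cover_algebra n E"
    by (rule kvs.span_minimal[OF _ subspace_vertex_cover_algebra])
  then have "graded_component n E d = kvs.span ?B"
    unfolding graded_component_def generators_products by blast
  moreover have "kvs.independent ?B"
    using independent_cover_monoms kvs.independent_mono by (metis image_mono subset_UNIV)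
  ultimately show ?thesis
    unfolding hilbert_function_def using inj_cover_monom
    by (simp add: kvs.dim_eq_card_independent card_image inj_on_subset[OF inj_cover_monom])
qed

theorem h_vector_eq: "h_vector TYPE('k::field) n E j = int (word_count n r j)"
  by (simp only: h_vector_def hilbert_series_def hilbert_function_eq covers_series fps_nth_Abs_fps)

end

lemma comes_from_imp_labelling:
  assumes "comes_from n E r"
  shows "\<exists>\<phi>. poset_graph_labelling n E r \<phi>"
  using assms by (auto simp: comes_from_def labelled_poset_def poset_graph_labelling_def)

corollary h_vector_poset:
  assumes "comes_from n E r"
  shows "h_vector TYPE('k::field) n E j = int (word_count n r j)"
  using comes_from_imp_labelling[OF assms] poset_graph_labelling.h_vector_eq by blast

theorem proposition3p12:
  fixes n :: nat and G G'' :: "vertex set set"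
  assumes "n \<ge> 1"
    and "bipartite_graph n G"
    and "cohen_macaulay_graph TYPE('k::field) (vertices n) G"
    and "bipartite_graph n G''"
    and "comes_from_antichain n G''"
  shows "\<forall>j\<le>n. int (n choose j) \<le> h_vector TYPE('k) n G j \<and>
               h_vector TYPE('k) n G j \<le> h_vector TYPE('k) n G'' j"
proof -
  obtain r where r: "comes_from n G r"
    using cohen_macaulay_comes_from_poset[OF assms(2,3)] by blast
  obtain r'' where r'': "comes_from n G'' r''" "\<forall>(i, j)\<in>r''. i = j"
    using assms(5) unfolding comes_from_antichain_def by blast
  interpret poset_graph_labelling n G r "SOME \<phi>. poset_graph_labelling n G r \<phi>"
    by (rule someI_ex[OF comes_from_imp_labelling[OF r]])
  obtain \<phi>'' where "poset_graph_labelling n G'' r'' \<phi>''"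
    using comes_from_imp_labelling[OF r''(1)] by blast
  then have "i \<in> {1..n}" if "(i, j) \<in> r''" for i j
    using poset_graph_labelling.r_dom that by blast
  \<comment> \<open>The antichain relation lies on the diagonal, which the reflexive relation
    \<open>r\<close> contains; so every word of \<open>r\<close> is a word of
    \<open>r''\<close>.\<close>
  then have "r'' \<subseteq> r" using r''(2) r_refl by auto
  then show ?thesis
    using word_count_ge_binomial[of r, OF natural] word_count_antimono
    by (simp add: h_vector_poset[OF r] h_vector_poset[OF r''(1)])
qed

end
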